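(* Let $T>0$ and let $\alpha_1,\alpha_2\in(0,2]$ satisfy $\max\{\alpha_1,\alpha_2\}>1$. Let $X^{\alpha_1}$ and $\widetilde X^{\alpha_2}$ be two independent real-valued symmetric stable processes with indices $\alpha_1$ and $\alpha_2$ respectively, and let $\widetilde L(T)$ be their collision local time on $[0,T]$. Then, for $p\in\mathbb{R}$, $$E\big[\widetilde L(T)^{-p}\big]<+\infty\quad\text{if and only if}\quad p<1 .$$
   Context: All processes live on a complete probability space $(\Omega,\mathcal F,P)$ with a filtration $(\mathcal F_t)$. A symmetric $\alpha$-stable process with $\alpha\in(0,2]$ is an $(\mathcal F_t)$-adapted real-valued process $X=\{X_t,t\ge0\}$ with sample paths in the Skorokhod space $D[0,\infty)$ (right-continuous with left limits), $X_0=0$, and $E[e^{iu(X_t-X_s)}\mid\mathcal F_s]=e^{-(t-s)|u|^{\alpha}}$ for all $t>s\ge0$ and $u\in\mathbb{R}$. Collision local time: for $\varepsilon>0$ let $p_\varepsilon(x)=(2\pi\varepsilon)^{-1/2}e^{-x^2/(2\varepsilon)}$, $x\in\mathbb{R}$, and $\widetilde L_\varepsilon(T)=\int_0^T p_\varepsilon(X^{\alpha_1}_t-\widetilde X^{\alpha_2}_t)\,dt$. The collision local time $\widetilde L(T)$ (formally $\int_0^T\delta(X^{\alpha_1}_t-\widetilde X^{\alpha_2}_t)\,dt$ with $\delta$ the Dirac function) is the limit of $\widetilde L_\varepsilon(T)$ in $L^2(P)$ as $\varepsilon\downarrow0$; this limit exists when $\max\{\alpha_1,\alpha_2\}>1$,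 and is a non-negative random variable. For $p>0$ the convention $0^{-p}=+\infty$ is used, and the expectation takes values in $[0,+\infty]$. *)

theory Defs
  imports "HOL-Probability.Probability"
begin

text \<open>The library locale \<open>filtration\<close> is indexed by a whole type; here the time set is \<open>[0, \<infinity>)\<close>.\<close>

definition filtration_nonneg :: "'a measure \<Rightarrow> (real \<Rightarrow> 'a measure) \<Rightarrow> bool" where
  "filtration_nonneg M F \<longleftrightarrow>
     (\<forall>t\<ge>0. subalgebra M (F t)) \<and> (\<forall>s t. 0 \<le> s \<and> s \<le> t \<longrightarrow> subalgebra (F t) (F s))"

definition cadlag :: "(real \<Rightarrow> real) \<Rightarrow> bool" where
  "cadlag f \<longleftrightarrow>
     (\<forall>t\<ge>0. (f \<longlongrightarrow> f t) (at_right t)) \<and> (\<forall>t>0. \<exists>l. (f \<longlongrightarrow> l) (at_left t))"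

text \<open>The library has conditional expectations of real random variables only.\<close>

definition complex_cond_exp ::
    "'a measure \<Rightarrow> 'a measure \<Rightarrow> ('a \<Rightarrow> complex) \<Rightarrow> 'a \<Rightarrow> complex" where
  "complex_cond_exp M G f \<omega> =
     Complex (real_cond_exp M G (\<lambda>x. Re (f x)) \<omega>) (real_cond_exp M G (\<lambda>x. Im (f x)) \<omega>)"

text \<open>Processes are total functions of a real time; only times \<open>t \<ge> 0\<close> are relevant.\<close>

definition symmetric_stable_process ::
    "'a measure \<Rightarrow> (real \<Rightarrow> 'a measure) \<Rightarrow> real \<Rightarrow> (real \<Rightarrow> 'a \<Rightarrow> real) \<Rightarrow> bool" where
  "symmetric_stable_process M F \<alpha> X \<longleftrightarrow>
     0 < \<alpha> \<and> \<alpha> \<le> 2 \<and>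
     (\<forall>t\<ge>0. X t \<in> borel_measurable (F t)) \<and>
     (\<forall>\<omega>\<in>space M. cadlag (\<lambda>t. X t \<omega>)) \<and>
     (\<forall>\<omega>\<in>space M. X 0 \<omega> = 0) \<and>
     (\<forall>s t u. 0 \<le> s \<and> s < t \<longrightarrow>
        (AE \<omega> in M. complex_cond_exp M (F s) (\<lambda>\<omega>. iexp (u * (X t \<omega> - X s \<omega>))) \<omega>
                     = complex_of_real (exp (- (t - s) * \<bar>u\<bar> powr \<alpha>))))"

text \<open>Independence of the whole processes, as random elements of the product space
  \<open>\<real>\<^bsup>[0,\<infinity>)\<^esup>\<close>; \<open>restrict\<close> is needed because \<open>PiM\<close> consists of extensional functions.\<close>

definition indep_processes ::
    "'a measure \<Rightarrow> (real \<Rightarrow> 'a \<Rightarrow> real) \<Rightarrow> (real \<Rightarrow> 'a \<Rightarrow> real) \<Rightarrow> bool" where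
  "indep_processes M X Y \<longleftrightarrow>
     prob_space.indep_var M
       (PiM {0..} (\<lambda>_. borel)) (\<lambda>\<omega>. \<lambda>t\<in>{0..}. X t \<omega>)
       (PiM {0..} (\<lambda>_. borel)) (\<lambda>\<omega>. \<lambda>t\<in>{0..}. Y t \<omega>)"

text \<open>The kernel \<open>p\<^sub>\<epsilon>\<close> is the centred normal density of variance \<open>\<epsilon>\<close>; the library's
  \<open>normal_density\<close> takes the standard deviation.\<close>

definition approx_collision_local_time ::
    "(real \<Rightarrow> 'a \<Rightarrow> real) \<Rightarrow> (real \<Rightarrow> 'a \<Rightarrow> real) \<Rightarrow> real \<Rightarrow> real \<Rightarrow> 'a \<Rightarrow> real" where
  "approx_collision_local_time X Y T \<epsilon> \<omega> =
     (LINT t:{0..T}|lborel. normal_density 0 (sqrt \<epsilon>) (X t \<omega> - Y t \<omega>))"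

text \<open>\<open>L\<close> is a version of the \<open>L\<^sup>2\<close>-limit. It is determined, and non-negative, only up to
  a null set.\<close>

definition is_collision_local_time ::
    "'a measure \<Rightarrow> (real \<Rightarrow> 'a \<Rightarrow> real) \<Rightarrow> (real \<Rightarrow> 'a \<Rightarrow> real) \<Rightarrow> real \<Rightarrow> ('a \<Rightarrow> real) \<Rightarrow> bool" where
  "is_collision_local_time M X Y T L \<longleftrightarrow>
     L \<in> borel_measurable M \<and>
     integrable M (\<lambda>\<omega>. (L \<omega>)\<^sup>2) \<and>
     ((\<lambda>\<epsilon>. \<integral>\<^sup>+\<omega>. ennreal ((approx_collision_local_time X Y T \<epsilon> \<omega> - L \<omega>)\<^sup>2) \<partial>M) \<longlongrightarrow> 0)
       (at_right 0)"

text \<open>Power of a non-negative real with values in \<open>[0, \<infinity>]\<close>, where \<open>0\<^sup>a = \<infinity>\<close> for \<open>a < 0\<close> and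
  \<open>0\<^sup>0 = 1\<close> (whereas \<open>0 powr a = 0\<close> for all \<open>a\<close>). Negative arguments are treated like \<open>0\<close>.\<close>

definition ennreal_power :: "real \<Rightarrow> real \<Rightarrow> ennreal" where
  "ennreal_power x a =
     (if x > 0 then ennreal (x powr a) else if a < 0 then \<infinity> else if a = 0 then 1 else 0)"

end

theory Submission
  imports Defs
begin

text \<open>The difference \<open>Z = X - Y\<close> is a Levy process with exponent
  \<open>\<psi> v = \<bar>v\<bar> powr \<alpha>\<^sub>1 + \<bar>v\<bar> powr \<alpha>\<^sub>2\<close>; let \<open>q t\<close> be the density of \<open>Z t\<close> at \<open>0\<close>, that is, the integral of
  \<open>exp (- t * \<psi> v) / (2 * pi)\<close> over \<open>v\<close>.  Formally, the Laplace transform \<open>f t\<close> of the local time up to time \<open>t\<close>,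
  at the point \<open>c\<close>, solves the renewal equation \<open>f t = 1 - c * \<integral>\<^bsub>0\<^esub>\<^bsup>t\<^esup> q s * f (t - s) ds\<close>.  As \<open>f\<close> is decreasing,
  this gives \<open>f t \<le> const / c\<close>; as \<open>q\<close> is decreasing and strictly convex, comparing the equations at
  times \<open>t\<close> and \<open>2 * t\<close> gives \<open>f t \<ge> const / c\<close> for \<open>c \<ge> 1\<close>.  For \<open>p > 0\<close> the moment of order \<open>- p\<close> is comparable to
  the integral of \<open>c powr (p - 1) * f\<close> over \<open>c\<close>, which near infinity is finite exactly for \<open>p < 1\<close>.  For \<open>p \<le> 0\<close> the same
  equation with negative \<open>c\<close> provides exponential moments.

  The renewal equation is only established approximately, for Riemann sums along a grid of the mollified
  local time, that is, for functionals of a random walk.  The error vanishes when first the mesh \<open>h\<close> and then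
  \<open>\<epsilon>\<close> tends to \<open>0\<close>, because \<open>1 / (1 + \<psi>)\<close> is integrable; this is where \<open>max \<alpha>\<^sub>1 \<alpha>\<^sub>2 > 1\<close> is used.\<close>

subsection \<open>Gaussian kernels and exponential sums\<close>

text \<open>Of \<open>Z t\<close> only the characteristic function is known, and a density is never
  constructed. All kernels are therefore integrals of a bounded weight times
  \<open>exp (- t * \<psi> v)\<close>. The elementary bound for a single \<open>t\<close> is too
  weak to be summed over a grid; taking \<open>t = k * h\<close> and summing over \<open>k\<close>
  under the integral turns the exponentials into a multiple of \<open>1 / (1 + \<psi> v)\<close>
  that is free of the mesh, and this uniformity carries the whole approximation. A grid is used
  because there the damping is a finite product: one-step independence of the pair of processes
  evaluates its expectation, and no Markov property in continuous time has to be derived. The lower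
  bound cannot come from monotonicity of \<open>f\<close> alone; besides the gap of \<open>q\<close>
  it requires a lower bound for the integral of \<open>f\<close>, which is obtained by integrating
  the renewal equation once more. The comparison of two times is the reason why errors are
  controlled up to \<open>2 * T\<close>.\<close>

lemma gauss_fourier:
  fixes \<epsilon> x :: real
  assumes "\<epsilon> > 0"
  shows "integrable lborel (\<lambda>v. cos (x * v) * exp (- \<epsilon> * v\<^sup>2 / 2))"
    and "normal_density 0 (sqrt \<epsilon>) x = (LBINT v. cos (x * v) * exp (- \<epsilon> * v\<^sup>2 / 2)) / (2 * pi)"
proof -
  have std: "(LBINT v. cos (t * v) * std_normal_density v) = exp (- t\<^sup>2 / 2)" 
    and int: "integrable lborel (\<lambda>v. cos (t * v) * std_normal_density v)" for t
  proof -
    interpret real_distribution std_normal_distribution by (rule real_dist_normal_dist)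
    have i: "integrable std_normal_distribution (\<lambda>v. iexp (t * v))"
      by (rule integrable_iexp) auto
    have "exp (- t\<^sup>2 / 2) = Re (char std_normal_distribution t)"
      by (simp add: char_std_normal_distribution Re_exp)
    also have "\<dots> = (LINT v|std_normal_distribution. cos (t * v))"
      unfolding char_def using i by (subst integral_Re[symmetric]) (auto simp: Re_exp)
    also have "\<dots> = (LBINT v. cos (t * v) * std_normal_density v)"
      by (subst integral_density) (auto simp: mult.commute)
    finally show "(LBINT v. cos (t * v) * std_normal_density v) = exp (- t\<^sup>2 / 2)" ..
    show "integrable lborel (\<lambda>v. cos (t * v) * std_normal_density v)"
      by (rule Bochner_Integration.integrable_bound[of _ std_normal_density])
         (auto intro!: AE_I2 mult_left_le_one_le simp: abs_mult)
  qed
  define s where "s = sqrt \<epsilon>"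
  have s: "s > 0" "s * s = \<epsilon>" using assms by (auto simp: s_def)
  define g where "g = (\<lambda>v. cos (x / s * v) * std_normal_density v)"
  \<comment> \<open>Replacing \<open>v\<close> by \<open>s * v\<close> turns the weight into a
    standard normal density, whose characteristic function is known.\<close>
  have eq: "cos (x * v) * exp (- \<epsilon> * v\<^sup>2 / 2) = sqrt (2 * pi) * g (0 + s * v)" for v
    using s unfolding g_def std_normal_density_def
    by (simp add: field_simps power2_eq_square)
  have ig: "integrable lborel g" unfolding g_def by (rule int)
  have i1: "integrable lborel (\<lambda>v. g (0 + s * v))" 
    by (rule lborel_integrable_real_affine[OF ig]) (use s in auto)
  then show "integrable lborel (\<lambda>v. cos (x * v) * exp (- \<epsilon> * v\<^sup>2 / 2))"
    unfolding eq by (rule integrable_mult_right)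
  have "(LBINT v. cos (x * v) * exp (- \<epsilon> * v\<^sup>2 / 2)) = sqrt (2 * pi) * (LBINT v. g (0 + s * v))"
    unfolding eq by simp
  also have "(LBINT v. g (0 + s * v)) = (LBINT v. g v) / s"
    using lborel_integral_real_affine[of s g 0] s by simp
  also have "(LBINT v. g v) = exp (- (x/s)\<^sup>2 / 2)" unfolding g_def by (rule std)
  finally have *: "(LBINT v. cos (x * v) * exp (- \<epsilon> * v\<^sup>2 / 2)) = sqrt (2 * pi) * (exp (- (x/s)\<^sup>2 / 2) / s)" .
  have "sqrt (2 * pi * \<epsilon>) = sqrt (2 * pi) * s" by (simp add: s_def real_sqrt_mult)
  moreover have "1 / (sqrt (2 * pi) * s) = sqrt (2 * pi) / (s * (2 * pi))"
    using s by (simp add: field_simps)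
  ultimately show "normal_density 0 (sqrt \<epsilon>) x = (LBINT v. cos (x * v) * exp (- \<epsilon> * v\<^sup>2 / 2)) / (2 * pi)"
    unfolding * normal_density_def using s assms
    by (simp add: power_divide power2_eq_square mult.commute)
qed

text \<open>The sum is at most \<open>T\<close> because each term is at most \<open>h\<close>, and
  \<open>s\<close> times the sum is at most 1 by the geometric series; adding both bounds gives the
  quotient. The mesh does not enter the bound, which is what lets it tend to \<open>0\<close>
  later.\<close>

lemma exp_sum_bound:
  fixes h s T :: real
  assumes "h > 0" "s \<ge> 0" "real n * h \<le> T"
  shows "(\<Sum>k=1..n. h * exp (- (real k * h) * s)) \<le> 2 * max 1 T / (1 + s)"
proof -
  let ?S = "\<Sum>k=1..n. h * exp (- (real k * h) * s)"
  have T: "?S \<le> T"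
  proof -
    have "?S \<le> (\<Sum>k=1..n. h * 1)"
      by (intro sum_mono mult_left_mono) (use assms in auto)
    then show ?thesis using assms by simp
  qed
  have "s * ?S \<le> 1"
  proof (cases "s = 0")
    case False
    define r where "r = exp (- h * s)"
    have r: "0 < r" "r < 1" using False assms by (auto simp: r_def)
    \<comment> \<open>\<open>1 - r\<close> is of order \<open>h * s\<close>, so the prefactor
      \<open>h\<close> compensates the blow-up of \<open>1 / (1 - r)\<close>.\<close>
    have "h * s * r \<le> 1 - r"
    proof -
      have "1 + h * s \<le> exp (h * s)" by (rule exp_ge_add_one_self)
      then have "(1 + h * s) * r \<le> exp (h * s) * r" using r by (intro mult_right_mono) auto
      then show ?thesis by (simp add: r_def algebra_simps flip: exp_add)
    qed
    moreover have "?S = h * (\<Sum>k=1..n. r ^ k)"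
      unfolding sum_distrib_left r_def
      by (intro sum.cong refl) (simp add: mult.assoc flip: exp_of_nat_mult)
    moreover have "(1 - r) * (\<Sum>k=1..n. r ^ k) = r * (1 - r ^ n)"
    proof (induction n)
      case (Suc n)
      have "(1 - r) * (\<Sum>k=1..Suc n. r ^ k) = (1 - r) * (\<Sum>k=1..n. r ^ k) + (1 - r) * r ^ Suc n"
        by (simp add: distrib_left)
      also have "(1 - r) * (\<Sum>k=1..n. r ^ k) = r * (1 - r ^ n)" by (rule Suc)
      also have "r * (1 - r ^ n) + (1 - r) * r ^ Suc n = r * (1 - r ^ Suc n)"
        by (simp add: algebra_simps)
      finally show ?case .
    qed simp
    moreover have "(\<Sum>k=1..n. r ^ k) \<ge> 0" using r by (intro sum_nonneg) auto
    ultimately have "h * s * r * (\<Sum>k=1..n. r ^ k) \<le> r * (1 - r ^ n)" "?S = h * (\<Sum>k=1..n. r ^ k)"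
      by (metis mult_right_mono)+
    then have "r * (s * ?S) \<le> r * (1 - r ^ n)"
      by (simp only: mult_ac)
    then have "s * ?S \<le> 1 - r ^ n" using r by simp
    then show ?thesis using r by (smt (verit) zero_le_power)
  qed simp
  then have "(1 + s) * ?S \<le> 2 * max 1 T" using T by (simp add: algebra_simps)
  then show ?thesis using assms by (simp add: field_simps)
qed

subsection \<open>Convolution families with integrable resolvent\<close>

text \<open>\<open>N\<close> has mass 1, so a dominating function of \<open>v\<close> alone is
  integrable on the product.\<close>

lemma fubini_dominated:
  fixes f :: "real \<Rightarrow> real \<Rightarrow> real" and N :: "real measure"
  assumes N: "prob_space N" and [measurable_cong]: "sets N = sets borel"
    and f[measurable]: "(\<lambda>(v, z). f v z) \<in> borel_measurable (borel \<Otimes>\<^sub>M borel)"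
    and g: "integrable lborel g" and bnd: "\<And>v z. \<bar>f v z\<bar> \<le> g v"
  shows "(LINT z|N. (LBINT v. f v z)) = (LBINT v. LINT z|N. f v z)"
proof -
  interpret N: prob_space N by fact
  interpret pair_sigma_finite lborel N ..
  have [measurable]: "f v \<in> borel_measurable borel" for v
    using measurable_Pair2[OF f, of v] by simp
  have iN: "integrable N (f v)" for v
    by (rule N.integrable_const_bound[of _ "g v"]) (use bnd in auto)
  have int: "integrable (lborel \<Otimes>\<^sub>M N) (\<lambda>(v, z). f v z)"
  proof (rule Fubini_integrable)
    show "integrable lborel (\<lambda>v. LINT z|N. norm (case (v, z) of (v, z) \<Rightarrow> f v z))"
    proof (rule Bochner_Integration.integrable_bound[OF g])
      have "norm (LINT z|N. norm (f v z)) \<le> norm (g v)" for v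
      proof -
        have "(LINT z|N. \<bar>f v z\<bar>) \<le> (LINT z|N. g v)"
          by (rule integral_mono) (use bnd iN in auto)
        then show ?thesis by (simp add: N.prob_space)
      qed
      then show "AE v in lborel. norm (LINT z|N. norm (case (v, z) of (v, z) \<Rightarrow> f v z)) \<le> norm (g v)"
        by simp
    qed simp
  qed (use iN in auto)
  show "(LINT z|N. (LBINT v. f v z)) = (LBINT v. LINT z|N. f v z)"
    using Fubini_integral[OF int] by simp
qed

text \<open>Integrability of \<open>1 / (1 + \<psi>)\<close> is the classical condition under which
  a symmetric Levy process hits points and has local times there. Symmetry is encoded by the real
  characteristic functions, and the semigroup property is a consequence of
  \<open>char_nu\<close>.\<close>

locale symmetric_convolution_family =
  fixes \<psi> :: "real \<Rightarrow> real" and \<nu> :: "real \<Rightarrow> real measure"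
  assumes psi_measurable [measurable]: "\<psi> \<in> borel_measurable borel"
    and psi_nonneg: "\<psi> v \<ge> 0"
    and psi_pos: "v \<noteq> 0 \<Longrightarrow> \<psi> v > 0"
    and integrable_resolvent: "integrable lborel (\<lambda>v. 1 / (1 + \<psi> v))"
    and nu_dist: "t \<ge> 0 \<Longrightarrow> real_distribution (\<nu> t)"
    and char_nu: "t \<ge> 0 \<Longrightarrow> char (\<nu> t) v = complex_of_real (exp (- t * \<psi> v))"
begin

abbreviation V :: "real \<Rightarrow> real \<Rightarrow> real" where "V \<delta> \<equiv> normal_density 0 (sqrt \<delta>)"

definition P :: "real \<Rightarrow> (real \<Rightarrow> real) \<Rightarrow> real \<Rightarrow> real" where
  "P t G x = (LINT z|\<nu> t. G (x + z))"

definition q :: "real \<Rightarrow> real" where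
  "q t = (LBINT v. exp (- t * \<psi> v)) / (2 * pi)"

text \<open>Fourier bound for the change of the density of \<open>\<nu> t\<close> under a shift by
  \<open>y\<close>: the factor \<open>min 2 \<bar>y * v\<bar>\<close> dominates the difference of
  the two cosines.\<close>

definition D :: "real \<Rightarrow> real \<Rightarrow> real" where
  "D t y = (LBINT v. min 2 \<bar>y * v\<bar> * exp (- t * \<psi> v)) / (2 * pi)"

text \<open>The drop of the value at \<open>0\<close> when the density of \<open>\<nu> t\<close> is
  convolved with a Gaussian of variance \<open>\<epsilon>\<close>, which multiplies its Fourier
  transform by \<open>exp (- \<epsilon> * v\<^sup>2 / 2)\<close>.\<close>

definition R :: "real \<Rightarrow> real \<Rightarrow> real" where
  "R t \<epsilon> = (LBINT v. (1 - exp (- \<epsilon> * v\<^sup>2 / 2)) * exp (- t * \<psi> v)) / (2 * pi)"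

lemma sets_nu [measurable_cong]: "t \<ge> 0 \<Longrightarrow> sets (\<nu> t) = sets borel"
  using nu_dist real_distribution.events_eq_borel by blast

lemma prob_space_nu: "t \<ge> 0 \<Longrightarrow> prob_space (\<nu> t)"
  using nu_dist unfolding real_distribution_def by blast

text \<open>Serves integrability at a single \<open>t > 0\<close>. The constant grows like
  \<open>1 / t\<close>, and \<open>h / (k * h)\<close> summed over \<open>k\<close> diverges as the
  grid is refined, so sums over a grid are estimated by \<open>exp_sum_bound\<close>
  instead.\<close>

lemma exp_psi_le:
  assumes "t > 0"
  shows "exp (- t * \<psi> v) \<le> max 1 (1 / t) * (1 / (1 + \<psi> v))"
proof -
  have t: "0 \<le> t * \<psi> v" using psi_nonneg[of v] assms by simp
  have "1 + t * \<psi> v \<le> exp (t * \<psi> v)" by (rule exp_ge_add_one_self)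
  then have "exp (- t * \<psi> v) \<le> 1 / (1 + t * \<psi> v)"
    using t by (simp add: exp_minus field_simps)
  also have "1 / (1 + t * \<psi> v) \<le> max 1 (1 / t) * (1 / (1 + \<psi> v))"
  proof -
    have "1 + \<psi> v = 1 + (1 / t) * (t * \<psi> v)" using assms by simp
    also have "\<dots> \<le> max 1 (1 / t) * 1 + max 1 (1 / t) * (t * \<psi> v)"
      by (intro add_mono mult_right_mono t) auto
    finally show ?thesis using t psi_nonneg[of v] by (simp add: field_simps)
  qed
  finally show ?thesis .
qed

lemma integrable_bounded_resolvent:
  assumes [measurable]: "g \<in> borel_measurable borel" and "\<And>v. \<bar>g v\<bar> \<le> B"
  shows "integrable lborel (\<lambda>v. g v * (1 / (1 + \<psi> v)))"
proof (rule Bochner_Integration.integrable_bound[OF integrable_mult_right[OF integrable_resolvent, of B]])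
  show "AE v in lborel. norm (g v * (1 / (1 + \<psi> v))) \<le> norm (B * (1 / (1 + \<psi> v)))"
  proof (rule AE_I2)
    fix v
    have "0 \<le> B" using assms(2)[of v] by linarith
    then show "norm (g v * (1 / (1 + \<psi> v))) \<le> norm (B * (1 / (1 + \<psi> v)))"
      using assms(2)[of v] psi_nonneg[of v] by (simp add: abs_mult divide_right_mono)
  qed
qed simp

lemma integrable_bounded_exp_psi:
  assumes "t > 0" and [measurable]: "g \<in> borel_measurable borel" and "\<And>v. \<bar>g v\<bar> \<le> B"
  shows "integrable lborel (\<lambda>v. g v * exp (- t * \<psi> v))"
proof (rule Bochner_Integration.integrable_bound[OF integrable_mult_right[OF integrable_resolvent, of "B * max 1 (1/t)"]])
  show "AE v in lborel. norm (g v * exp (- t * \<psi> v)) \<le> norm (B * max 1 (1/t) * (1 / (1 + \<psi> v)))"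
  proof (rule AE_I2)
    fix v
    have B: "0 \<le> B" using assms(3)[of v] by linarith
    have "norm (g v * exp (- t * \<psi> v)) = \<bar>g v\<bar> * exp (- t * \<psi> v)" by (simp add: abs_mult)
    also have "\<dots> \<le> B * (max 1 (1/t) * (1 / (1 + \<psi> v)))"
      by (rule mult_mono[OF assms(3) exp_psi_le[OF assms(1)] B]) simp
    finally show "norm (g v * exp (- t * \<psi> v)) \<le> norm (B * max 1 (1/t) * (1 / (1 + \<psi> v)))"
      by (simp only: real_norm_def mult.assoc)
  qed
qed simp

lemma integrable_exp_psi: "t > 0 \<Longrightarrow> integrable lborel (\<lambda>v. exp (- t * \<psi> v))"
  using integrable_bounded_exp_psi[of t "\<lambda>_. 1" 1] by simp

lemma q_nonneg: "q t \<ge> 0"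
  unfolding q_def by simp

text \<open>This is the real part of a shifted characteristic function; since \<open>char_nu\<close>
  is real, the sine part drops out.\<close>

lemma cos_nu:
  assumes "t \<ge> 0"
  shows "(LINT z|\<nu> t. cos ((c - z) * v)) = cos (c * v) * exp (- t * \<psi> v)"
proof -
  interpret real_distribution "\<nu> t" using nu_dist assms .
  have i: "integrable (\<nu> t) (\<lambda>z. iexp ((- v) * z))"
    by (rule integrable_iexp) auto
  have i2: "integrable (\<nu> t) (\<lambda>z. iexp (c * v) * iexp ((- v) * z))"
    using i by (rule integrable_mult_right)
  have "(LINT z|\<nu> t. cos ((c - z) * v)) = (LINT z|\<nu> t. Re (iexp (c * v) * iexp ((- v) * z)))"
    by (intro Bochner_Integration.integral_cong refl) (simp add: Re_exp algebra_simps flip: exp_add)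
  also have "\<dots> = Re (LINT z|\<nu> t. iexp (c * v) * iexp ((- v) * z))"
    using integral_Re[OF i2] by simp
  also have "(LINT z|\<nu> t. iexp (c * v) * iexp ((- v) * z)) = iexp (c * v) * char (\<nu> t) (- v)"
    unfolding char_def using i by simp
  also have "char (\<nu> t) (- v) = cnj (char (\<nu> t) v)"
  proof -
    have "char (\<nu> t) (- v) = (LINT z|\<nu> t. cnj (iexp (v * z)))"
      unfolding char_def by (intro Bochner_Integration.integral_cong refl) (simp add: exp_cnj)
    then show ?thesis by (simp add: char_def integral_cnj)
  qed
  also have "Re (iexp (c * v) * cnj (char (\<nu> t) v)) = cos (c * v) * exp (- t * \<psi> v)"
    by (simp add: char_nu assms Re_exp)
  finally show ?thesis .
qed

text \<open>Expanding the kernel by \<open>gauss_fourier\<close> and exchanging integrals leaves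
  \<open>cos_nu\<close>. The Gaussian weight justifies the exchange even at \<open>t = 0\<close>,
  where \<open>\<nu> t\<close> has no density.\<close>

lemma gauss_nu:
  assumes t: "t \<ge> 0" and d: "\<delta> > 0"
  shows "(LINT z|\<nu> t. V \<delta> (c - z)) = (LBINT v. cos (c * v) * exp (- \<delta> * v\<^sup>2 / 2) * exp (- t * \<psi> v)) / (2 * pi)"
proof -
  have g: "integrable lborel (\<lambda>v. exp (- \<delta> * v\<^sup>2 / 2))"
    using gauss_fourier(1)[OF d, of 0] by simp
  have "(LINT z|\<nu> t. (LBINT v. cos ((c - z) * v) * exp (- \<delta> * v\<^sup>2 / 2)))
      = (LBINT v. LINT z|\<nu> t. cos ((c - z) * v) * exp (- \<delta> * v\<^sup>2 / 2))"
    by (rule fubini_dominated[OF prob_space_nu[OF t] sets_nu[OF t] _ g])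
       (auto simp: abs_mult)
  also have "\<dots> = (LBINT v. cos (c * v) * exp (- \<delta> * v\<^sup>2 / 2) * exp (- t * \<psi> v))"
    by (simp only: integral_mult_left_zero cos_nu[OF t]) (simp add: mult_ac)
  finally show ?thesis
    by (subst gauss_fourier(2)[OF d]) simp
qed

end

lemma abs_lebesgue_integral_le:
  fixes f g :: "'b \<Rightarrow> real"
  assumes g: "integrable M g" and le: "\<And>x. x \<in> space M \<Longrightarrow> \<bar>f x\<bar> \<le> g x"
  shows "\<bar>LINT x|M. f x\<bar> \<le> (LINT x|M. g x)"
proof (cases "integrable M f")
  case True
  have "\<bar>LINT x|M. f x\<bar> \<le> (LINT x|M. \<bar>f x\<bar>)"
    by (rule integral_abs_bound)
  also have "\<dots> \<le> (LINT x|M. g x)"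
    using True g le by (intro integral_mono) auto
  finally show ?thesis .
next
  \<comment> \<open>A non-integrable \<open>f\<close> has integral \<open>0\<close> by convention,
    so it remains to see that the right-hand side is nonnegative.\<close>
  case False
  have "0 \<le> (LINT x|M. g x)"
    by (rule integral_nonneg_AE) (use le in \<open>auto intro!: AE_I2 intro: order_trans[OF abs_ge_zero]\<close>)
  with False show ?thesis by (simp add: not_integrable_integral_eq)
qed

lemma abs_cos_diff_le: "\<bar>cos a - cos b\<bar> \<le> min 2 \<bar>a - b\<bar>" for a b :: real
proof -
  have "\<bar>cos a - cos b\<bar> = 2 * \<bar>sin ((a + b) / 2)\<bar> * \<bar>sin ((b - a) / 2)\<bar>"
    by (simp add: cos_diff_cos abs_mult)
  also have "\<dots> \<le> 2 * 1 * \<bar>(b - a) / 2\<bar>"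
    by (intro mult_mono abs_sin_x_le_abs_x) auto
  also have "\<dots> = \<bar>a - b\<bar>" by simp
  finally have "\<bar>cos a - cos b\<bar> \<le> \<bar>a - b\<bar>" .
  moreover have "\<bar>cos a - cos b\<bar> \<le> 2"
    using abs_cos_le_one[of a] abs_cos_le_one[of b] by linarith
  ultimately show ?thesis by simp
qed

lemma normal_density_le: "s > 0 \<Longrightarrow> normal_density m s x \<le> 1 / sqrt (2 * pi * s\<^sup>2)"
  by (simp add: normal_density_def divide_right_mono)

lemma integral_normal_density_shift:
  fixes G :: "real \<Rightarrow> real"
  assumes "s > 0"
  shows "(LBINT w. G w * normal_density 0 s (w - c)) = (LBINT n. G (c + s * n) * std_normal_density n)"
proof -
  have "(LBINT w. G w * normal_density 0 s (w - c))
      = s * (LBINT n. G (c + s * n) * normal_density 0 s (c + s * n - c))"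
    using lborel_integral_real_affine[of s "\<lambda>w. G w * normal_density 0 s (w - c)" c] assms by simp
  also have "\<dots> = (LBINT n. s * (G (c + s * n) * normal_density 0 s (c + s * n - c)))" by simp
  also have "\<dots> = (LBINT n. G (c + s * n) * std_normal_density n)"
    using assms by (intro Bochner_Integration.integral_cong refl)
      (simp add: normal_density_def power_mult_distrib real_sqrt_mult)
  finally show ?thesis .
qed

lemma abs_integral_mult_std_normal_le:
  assumes [measurable]: "G \<in> borel_measurable borel" and B: "\<And>x. \<bar>G x\<bar> \<le> B"
  shows "\<bar>LBINT n. G n * std_normal_density n\<bar> \<le> B"
proof -
  have "\<bar>LBINT n. G n * std_normal_density n\<bar> \<le> (LBINT n. B * std_normal_density n)"
    using B by (intro abs_lebesgue_integral_le) (auto simp: abs_mult intro!: mult_right_mono)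
  then show ?thesis by simp
qed

section \<open>Bounds for the transition operators by Fourier inversion\<close>

context symmetric_convolution_family
begin

text \<open>Smoothing \<open>G\<close> with a Gaussian kernel makes \<open>P t G\<close> accessible by Fourier inversion of the kernel alone, so
  no density of \<open>\<nu> t\<close> has to be constructed.\<close>

lemma P_smoothing_limit:
  fixes G :: "real \<Rightarrow> real"
  assumes t: "t \<ge> 0" and G: "continuous_on UNIV G" and B: "\<And>x. \<bar>G x\<bar> \<le> B" and iG: "integrable lborel G"
  shows "(\<lambda>n. LBINT w. G w * (LINT z|\<nu> t. V (1 / real (Suc n)) (w - x - z))) \<longlonglongrightarrow> P t G x"
proof -
  interpret real_distribution "\<nu> t" using nu_dist t .
  have [measurable]: "G \<in> borel_measurable borel"
    using G by (rule borel_measurable_continuous_onI)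
  define s where "s n = sqrt (1 / real (Suc n))" for n
  have s: "s n > 0" for n by (simp add: s_def)
  have s0: "s \<longlonglongrightarrow> 0"
    unfolding s_def using tendsto_real_sqrt[OF LIMSEQ_inverse_real_of_nat]
    by (simp add: inverse_eq_divide)
  \<comment> \<open>Exchanging the integrals makes this the expectation of a Gaussian average of
    \<open>G\<close> around \<open>x + z\<close>, whose width \<open>s n\<close> shrinks to
    \<open>0\<close>.\<close>
  have eq: "(LBINT w. G w * (LINT z|\<nu> t. V (1 / real (Suc n)) (w - x - z)))
      = (LINT z|\<nu> t. (LBINT m. G (x + z + s n * m) * std_normal_density m))" for n
  proof -
    have "(LINT z|\<nu> t. (LBINT w. G w * normal_density 0 (s n) (w - x - z)))
      = (LBINT w. LINT z|\<nu> t. G w * normal_density 0 (s n) (w - x - z))"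
    proof (rule fubini_dominated[OF prob_space_nu[OF t] sets_nu[OF t]])
      show "integrable lborel (\<lambda>w. \<bar>G w\<bar> * (1 / sqrt (2 * pi * (s n)\<^sup>2)))"
        using iG by (intro integrable_mult_left integrable_abs)
      show "\<bar>G w * normal_density 0 (s n) (w - x - z)\<bar> \<le> \<bar>G w\<bar> * (1 / sqrt (2 * pi * (s n)\<^sup>2))" for w z
        using mult_left_mono[OF normal_density_le[OF s[of n], of 0 "w - x - z"], of "\<bar>G w\<bar>"]
          by (simp add: abs_mult)
    qed measurable
    moreover have "(LBINT w. G w * normal_density 0 (s n) (w - x - z))
        = (LBINT m. G (x + z + s n * m) * std_normal_density m)" for z
      using integral_normal_density_shift[OF s, of G n "x + z"] by (simp add: algebra_simps)
    ultimately show ?thesis by (simp add: s_def)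
  qed
  have meas: "(\<lambda>z. LBINT m. G (x + z + s n * m) * std_normal_density m) \<in> borel_measurable borel" for n
    by measurable
  have lim: "(\<lambda>n. LBINT m. G (c + s n * m) * std_normal_density m) \<longlonglongrightarrow> G c" for c
  proof -
    have "(\<lambda>n. LBINT m. G (c + s n * m) * std_normal_density m) \<longlonglongrightarrow> (LBINT m. G c * std_normal_density m)"
    proof (rule integral_dominated_convergence[where w="\<lambda>m. B * std_normal_density m"])
      show "AE m in lborel. (\<lambda>n. G (c + s n * m) * std_normal_density m) \<longlonglongrightarrow> G c * std_normal_density m"
      proof (rule AE_I2)
        fix m :: real
        have "(\<lambda>n. c + s n * m) \<longlonglongrightarrow> c + 0 * m" by (intro tendsto_intros s0)
        then have "(\<lambda>n. G (c + s n * m)) \<longlonglongrightarrow> G c"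
          using continuous_on_tendsto_compose[OF G] by simp
        then show "(\<lambda>n. G (c + s n * m) * std_normal_density m) \<longlonglongrightarrow> G c * std_normal_density m"
          by (intro tendsto_intros)
      qed
    qed (use B in \<open>auto simp: abs_mult intro!: mult_right_mono\<close>)
    then show ?thesis by simp
  qed
  show ?thesis unfolding eq P_def
  proof (rule integral_dominated_convergence[where w="\<lambda>_. B"])
    show "AE z in \<nu> t. (\<lambda>n. LBINT m. G (x + z + s n * m) * std_normal_density m) \<longlonglongrightarrow> G (x + z)"
      using lim by simp
    show "AE z in \<nu> t. norm (LBINT m. G (x + z + s n * m) * std_normal_density m) \<le> B" for n
      using abs_integral_mult_std_normal_le[of "\<lambda>m. G (x + z + s n * m)" B for z] B by simp
  qed (use meas in auto)
qed

text \<open>The cosine and the Gaussian factor are at most 1 in absolute value. The bound is uniform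
  in \<open>\<delta>\<close> and \<open>c\<close> and therefore passes to the limit in
  \<open>P_smoothing_limit\<close>.\<close>

lemma gauss_nu_le:
  assumes t: "t > 0" and d: "\<delta> > 0"
  shows "\<bar>LINT z|\<nu> t. V \<delta> (c - z)\<bar> \<le> q t"
proof -
  have "\<bar>LBINT v. cos (c * v) * exp (- \<delta> * v\<^sup>2 / 2) * exp (- t * \<psi> v)\<bar> \<le> (LBINT v. exp (- t * \<psi> v))"
  proof (rule abs_lebesgue_integral_le)
    have b: "\<bar>cos (c * v) * exp (- \<delta> * v\<^sup>2 / 2)\<bar> \<le> 1" for v
      using mult_mono[OF abs_cos_le_one[of "c * v"], of "exp (- \<delta> * v\<^sup>2 / 2)" 1] d by (simp add: abs_mult)
    show "\<bar>cos (c * v) * exp (- \<delta> * v\<^sup>2 / 2) * exp (- t * \<psi> v)\<bar> \<le> exp (- t * \<psi> v)" for v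
      using mult_right_mono[OF b[of v], of "exp (- t * \<psi> v)"] by (simp add: abs_mult)
  qed (rule integrable_exp_psi[OF t])
  then show ?thesis
    using t unfolding gauss_nu[OF less_imp_le[OF t] d] q_def by (simp add: divide_right_mono)
qed

lemma gauss_nu_diff_le:
  assumes t: "t > 0" and d: "\<delta> > 0"
  shows "\<bar>(LINT z|\<nu> t. V \<delta> (c - y - z)) - (LINT z|\<nu> t. V \<delta> (c - z))\<bar> \<le> D t y"
proof -
  define f where "f c v = cos (c * v) * exp (- \<delta> * v\<^sup>2 / 2) * exp (- t * \<psi> v)" for c v
  have i: "integrable lborel (f c)" for c
  proof -
    have b: "\<bar>cos (c * v) * exp (- \<delta> * v\<^sup>2 / 2)\<bar> \<le> 1" for v
      using mult_mono[OF abs_cos_le_one[of "c * v"], of "exp (- \<delta> * v\<^sup>2 / 2)" 1] d by (simp add: abs_mult)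
    then show ?thesis unfolding f_def
      by (intro integrable_bounded_exp_psi[OF t, of _ 1]) auto
  qed
  have "\<bar>(LBINT v. f (c - y) v) - (LBINT v. f c v)\<bar> = \<bar>LBINT v. f (c - y) v - f c v\<bar>"
    using i by simp
  also have "\<dots> \<le> (LBINT v. min 2 \<bar>y * v\<bar> * exp (- t * \<psi> v))"
  proof (rule abs_lebesgue_integral_le)
    show "integrable lborel (\<lambda>v. min 2 \<bar>y * v\<bar> * exp (- t * \<psi> v))"
      by (rule integrable_bounded_exp_psi[OF t, of _ 2]) auto
    fix v
    have "\<bar>cos ((c - y) * v) - cos (c * v)\<bar> * exp (- \<delta> * v\<^sup>2 / 2) \<le> min 2 \<bar>y * v\<bar> * 1"
      using abs_cos_diff_le[of "(c - y) * v" "c * v"] d by (intro mult_mono) (auto simp: algebra_simps)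
    then have "\<bar>cos ((c - y) * v) - cos (c * v)\<bar> * exp (- \<delta> * v\<^sup>2 / 2) * exp (- t * \<psi> v)
        \<le> min 2 \<bar>y * v\<bar> * exp (- t * \<psi> v)" by (simp add: mult_right_mono)
    moreover have "\<bar>f (c - y) v - f c v\<bar>
        = \<bar>cos ((c - y) * v) - cos (c * v)\<bar> * exp (- \<delta> * v\<^sup>2 / 2) * exp (- t * \<psi> v)"
      unfolding f_def left_diff_distrib[symmetric] by (simp add: abs_mult)
    ultimately show "\<bar>f (c - y) v - f c v\<bar> \<le> min 2 \<bar>y * v\<bar> * exp (- t * \<psi> v)" by simp
  qed
  finally have "\<bar>(LBINT v. f (c - y) v) - (LBINT v. f c v)\<bar> / (2 * pi) \<le> D t y"
    unfolding D_def by (simp add: divide_right_mono)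
  then show ?thesis
    unfolding gauss_nu[OF less_imp_le[OF t] d] f_def diff_divide_distrib[symmetric] by (simp add: abs_divide)
qed

text \<open>Takes the place of the statement that the density of \<open>\<nu> t\<close> is bounded
  by its value \<open>q t\<close> at \<open>0\<close>: the smoothed kernels obey this bound, and
  \<open>P_smoothing_limit\<close> transfers it to \<open>P t G\<close>.\<close>

lemma abs_P_le_q:
  assumes t: "t > 0" and G: "continuous_on UNIV G" "\<And>x. \<bar>G x\<bar> \<le> B" "integrable lborel G"
  shows "\<bar>P t G x\<bar> \<le> q t * (LBINT w. \<bar>G w\<bar>)"
proof (rule tendsto_upperbound[OF tendsto_rabs[OF P_smoothing_limit[OF less_imp_le[OF t] G]]])
  have "\<bar>LBINT w. G w * (LINT z|\<nu> t. V \<delta> (w - x - z))\<bar> \<le> q t * (LBINT w. \<bar>G w\<bar>)" if d: "\<delta> > 0" for \<delta>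
  proof -
    have "\<bar>LBINT w. G w * (LINT z|\<nu> t. V \<delta> (w - x - z))\<bar> \<le> (LBINT w. q t * \<bar>G w\<bar>)"
    proof (rule abs_lebesgue_integral_le)
      show "integrable lborel (\<lambda>w. q t * \<bar>G w\<bar>)" using G by simp
      show "\<bar>G w * (LINT z|\<nu> t. V \<delta> (w - x - z))\<bar> \<le> q t * \<bar>G w\<bar>" for w
        using mult_left_mono[OF gauss_nu_le[OF t d, of "w - x"], of "\<bar>G w\<bar>"] by (simp add: abs_mult mult.commute)
    qed
    then show ?thesis by simp
  qed
  then show "\<forall>\<^sub>F n in sequentially. \<bar>LBINT w. G w * (LINT z|\<nu> t. V (1 / real (Suc n)) (w - x - z))\<bar>
      \<le> q t * (LBINT w. \<bar>G w\<bar>)" by simp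
qed simp

text \<open>The same transfer for the shift bound \<open>gauss_nu_diff_le\<close>. Only the
  \<open>L1\<close> norm of \<open>G\<close> enters the estimate, so \<open>G\<close> may be a
  narrow peak such as \<open>V \<epsilon>\<close>.\<close>

lemma abs_P_diff_le_D:
  assumes t: "t > 0" and G: "continuous_on UNIV G" "\<And>x. \<bar>G x\<bar> \<le> B" "integrable lborel G"
  shows "\<bar>P t G y - P t G 0\<bar> \<le> D t y * (LBINT w. \<bar>G w\<bar>)"
proof (rule tendsto_upperbound[OF tendsto_rabs[OF tendsto_diff[OF
    P_smoothing_limit[OF less_imp_le[OF t] G] P_smoothing_limit[OF less_imp_le[OF t] G]]]])
  define r where "r \<delta> c = (LINT z|\<nu> t. V \<delta> (c - z))" for \<delta> c
  have "\<bar>(LBINT w. G w * r \<delta> (w - y)) - (LBINT w. G w * r \<delta> (w - 0))\<bar> \<le> D t y * (LBINT w. \<bar>G w\<bar>)"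
    if d: "\<delta> > 0" for \<delta>
  proof -
    have [measurable]: "r \<delta> \<in> borel_measurable borel"
      unfolding r_def by (subst gauss_nu[OF less_imp_le[OF t] d]) simp
    have i: "integrable lborel (\<lambda>w. G w * r \<delta> (w - x))" for x
    proof (rule Bochner_Integration.integrable_bound[of _ "\<lambda>w. q t * G w"])
      have "norm (G w * r \<delta> (w - x)) \<le> norm (q t * G w)" for w
        using mult_left_mono[OF gauss_nu_le[OF t d, of "w - x"], of "\<bar>G w\<bar>"] q_nonneg[of t]
        by (simp add: abs_mult mult.commute r_def)
      then show "AE w in lborel. norm (G w * r \<delta> (w - x)) \<le> norm (q t * G w)" by simp
    qed (use G borel_measurable_integrable[OF G(3)] in auto)
    have "\<bar>(LBINT w. G w * r \<delta> (w - y)) - (LBINT w. G w * r \<delta> (w - 0))\<bar>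
        = \<bar>LBINT w. G w * r \<delta> (w - y) - G w * r \<delta> (w - 0)\<bar>"
      using i[of y] i[of 0] by simp
    also have "\<dots> \<le> (LBINT w. D t y * \<bar>G w\<bar>)"
    proof (rule abs_lebesgue_integral_le)
      show "integrable lborel (\<lambda>w. D t y * \<bar>G w\<bar>)" using G by simp
      show "\<bar>G w * r \<delta> (w - y) - G w * r \<delta> (w - 0)\<bar> \<le> D t y * \<bar>G w\<bar>" for w
        using mult_left_mono[OF gauss_nu_diff_le[OF t d, of w y], of "\<bar>G w\<bar>"]
        by (simp add: abs_mult mult.commute r_def flip: right_diff_distrib)
    qed
    finally show ?thesis by simp
  qed
  then show "\<forall>\<^sub>F n in sequentially. \<bar>(LBINT w. G w * (LINT z|\<nu> t. V (1 / real (Suc n)) (w - y - z))) -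
       (LBINT w. G w * (LINT z|\<nu> t. V (1 / real (Suc n)) (w - 0 - z)))\<bar> \<le> D t y * (LBINT w. \<bar>G w\<bar>)"
    by (simp add: r_def)
qed simp

end

subsection \<open>The damped random walk\<close>

context symmetric_convolution_family
begin

text \<open>By \<open>char_nu\<close> the characteristic functions multiply, and Levy's uniqueness
  theorem identifies the measures.\<close>

lemma nu_add:
  assumes s: "s \<ge> 0" and t: "t \<ge> 0"
  shows "\<nu> (s + t) = distr (\<nu> s \<Otimes>\<^sub>M \<nu> t) borel (\<lambda>(x, y). x + y)"
proof (rule Levy_uniqueness)
  interpret S: real_distribution "\<nu> s" using nu_dist s .
  interpret T: real_distribution "\<nu> t" using nu_dist t .
  interpret pair_prob_space "\<nu> s" "\<nu> t" ..
  note [measurable_cong] = sets_nu[OF s] sets_nu[OF t]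
  have m[measurable]: "(\<lambda>(x, y). x + y) \<in> borel_measurable (\<nu> s \<Otimes>\<^sub>M \<nu> t)" by measurable
  show "real_distribution (\<nu> (s + t))" using nu_dist s t by simp
  show "real_distribution (distr (\<nu> s \<Otimes>\<^sub>M \<nu> t) borel (\<lambda>(x, y). x + y))"
    by (simp add: real_distribution_def real_distribution_axioms_def prob_space_distr)
  show "char (\<nu> (s + t)) = char (distr (\<nu> s \<Otimes>\<^sub>M \<nu> t) borel (\<lambda>(x, y). x + y))"
  proof
    fix v
    have i: "integrable (\<nu> s \<Otimes>\<^sub>M \<nu> t) (\<lambda>(x, y). iexp (v * x) * iexp (v * y))"
      by (rule integrable_const_bound[of _ 1]) (auto simp: norm_mult split_beta)
    have "char (distr (\<nu> s \<Otimes>\<^sub>M \<nu> t) borel (\<lambda>(x, y). x + y)) v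
        = (LINT p|(\<nu> s \<Otimes>\<^sub>M \<nu> t). iexp (v * (fst p + snd p)))"
      unfolding char_def by (subst integral_distr) (auto simp: split_beta)
    also have "\<dots> = (LINT p|(\<nu> s \<Otimes>\<^sub>M \<nu> t). (\<lambda>(x, y). iexp (v * x) * iexp (v * y)) p)"
      by (intro Bochner_Integration.integral_cong refl) (auto simp: algebra_simps simp flip: exp_add)
    also have "\<dots> = (LINT x|\<nu> s. LINT y|\<nu> t. iexp (v * x) * iexp (v * y))"
      using integral_fst'[OF i] by simp
    also have "\<dots> = char (\<nu> s) v * char (\<nu> t) v"
      by (simp add: char_def)
    also have "\<dots> = char (\<nu> (s + t)) v"
      using s t by (simp add: char_nu algebra_simps flip: exp_add of_real_mult)
    finally show "char (\<nu> (s + t)) v = char (distr (\<nu> s \<Otimes>\<^sub>M \<nu> t) borel (\<lambda>(x, y). x + y)) v" ..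
  qed
qed

lemma
  assumes t: "t \<ge> 0" and G: "continuous_on UNIV G" and B: "\<And>x. \<bar>G x\<bar> \<le> B"
  shows integrable_nu: "integrable (\<nu> t) (\<lambda>z. G (x + z))"
    and continuous_on_P: "continuous_on UNIV (P t G)"
    and abs_P_le: "\<bar>P t G x\<bar> \<le> B"
proof -
  interpret real_distribution "\<nu> t" using nu_dist t .
  have [measurable]: "G \<in> borel_measurable borel"
    using G by (rule borel_measurable_continuous_onI)
  show "integrable (\<nu> t) (\<lambda>z. G (x + z))"
    by (rule integrable_const_bound[of _ B]) (use B in auto)
  show "\<bar>P t G x\<bar> \<le> B"
    using abs_lebesgue_integral_le[of "\<nu> t" "\<lambda>_. B" "\<lambda>z. G (x + z)"] B
      prob_space by (simp add: P_def)
  show "continuous_on UNIV (P t G)"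
    unfolding continuous_on_sequentially P_def comp_def
  proof safe
    fix y :: "nat \<Rightarrow> real" and a assume y: "y \<longlonglongrightarrow> a"
    show "(\<lambda>n. LINT z|\<nu> t. G (y n + z)) \<longlonglongrightarrow> (LINT z|\<nu> t. G (a + z))"
    proof (rule integral_dominated_convergence[where w="\<lambda>_. B"])
      show "AE z in \<nu> t. (\<lambda>n. G (y n + z)) \<longlonglongrightarrow> G (a + z)"
        using continuous_on_tendsto_compose[OF G tendsto_add[OF y tendsto_const]] by simp
    qed (use B in auto)
  qed
qed

lemma P_semigroup:
  assumes s: "s \<ge> 0" and t: "t \<ge> 0" and G: "continuous_on UNIV G" and B: "\<And>x. \<bar>G x\<bar> \<le> B"
  shows "P s (P t G) x = P (s + t) G x"
proof -
  interpret S: real_distribution "\<nu> s" using nu_dist s .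
  interpret T: real_distribution "\<nu> t" using nu_dist t .
  interpret pair_prob_space "\<nu> s" "\<nu> t" ..
  note [measurable_cong] = sets_nu[OF s] sets_nu[OF t]
  have [measurable]: "G \<in> borel_measurable borel"
    using G by (rule borel_measurable_continuous_onI)
  have i: "integrable (\<nu> s \<Otimes>\<^sub>M \<nu> t) (\<lambda>(y, z). G (x + (y + z)))"
    by (rule integrable_const_bound[of _ B]) (use B in \<open>auto simp: split_beta\<close>)
  have "P (s + t) G x = (LINT p|(\<nu> s \<Otimes>\<^sub>M \<nu> t). G (x + (\<lambda>(y, z). y + z) p))"
    unfolding P_def nu_add[OF s t] by (subst integral_distr) auto
  also have "\<dots> = (LINT p|(\<nu> s \<Otimes>\<^sub>M \<nu> t). (\<lambda>(y, z). G (x + (y + z))) p)"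
    by (simp add: split_beta)
  also have "\<dots> = (LINT y|\<nu> s. LINT z|\<nu> t. G (x + (y + z)))"
    using integral_fst'[OF i] by simp
  finally show ?thesis by (simp add: P_def add.assoc)
qed

text \<open>A discrete Feynman-Kac functional: the mean of the product of \<open>a\<close> over the
  positions after steps \<open>1..n\<close> of a random walk from \<open>x\<close> with step law
  \<open>\<nu> h\<close>. The starting point contributes no factor, in accordance with Riemann sums
  at right endpoints.\<close>

primrec u :: "(real \<Rightarrow> real) \<Rightarrow> real \<Rightarrow> nat \<Rightarrow> real \<Rightarrow> real" where
  "u a h 0 = (\<lambda>_. 1)"
| "u a h (Suc n) = P h (\<lambda>y. a y * u a h n y)"

lemma
  assumes h: "h \<ge> 0" and a: "continuous_on UNIV a" and A: "\<And>x. \<bar>a x\<bar> \<le> A"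
  shows continuous_on_u: "continuous_on UNIV (u a h n)"
    and abs_u_le: "\<bar>u a h n x\<bar> \<le> A ^ n"
proof (induction n arbitrary: x)
  case (Suc n)
  have A0: "A \<ge> 0" using A[of 0] by linarith
  have b: "\<bar>a y * u a h n y\<bar> \<le> A ^ Suc n" for y
    using mult_mono[OF A Suc.IH(2) A0] by (simp add: abs_mult)
  have c: "continuous_on UNIV (\<lambda>y. a y * u a h n y)"
    using a Suc.IH(1) by (intro continuous_intros)
  case 1 show ?case using continuous_on_P[OF h c b] by simp
  case 2 show ?case using abs_P_le[OF h c b] by simp
qed auto

text \<open>Mean of the telescoping identity \<open>1 - a_1 * ... * a_n = (sum over k of (1 - a_k) *
  a_(k+1) * ... * a_n)\<close>, where the factors after step \<open>k\<close> are collected in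
  \<open>u a h (n - k)\<close>. \<open>A\<close> may exceed 1, so amplification is covered as well
  as damping.\<close>

lemma u_renewal:
  assumes h: "h \<ge> 0" and a: "continuous_on UNIV a" and A: "\<And>x. \<bar>a x\<bar> \<le> A"
  shows "u a h n x = 1 - (\<Sum>k=1..n. P (real k * h) (\<lambda>y. (1 - a y) * u a h (n - k) y) x)"
proof (induction n arbitrary: x)
  case (Suc n)
  let ?b = "\<lambda>j y. (1 - a y) * u a h j y"
  have c: "continuous_on UNIV (?b j)" for j
    using a continuous_on_u[OF assms] by (intro continuous_intros)
  have b: "\<bar>?b j y\<bar> \<le> (1 + A) * A ^ j" for j y
  proof -
    have "\<bar>1 - a y\<bar> \<le> 1 + A" using A[of y] by linarith
    then show ?thesis
      using mult_mono[OF _ abs_u_le[OF assms, of n y], of "\<bar>1 - a y\<bar>" "1 + A"] abs_u_le[OF assms, of j y]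
      by (simp add: abs_mult mult_mono)
  qed
  interpret real_distribution "\<nu> h" using nu_dist h .
  have iu: "integrable (\<nu> h) (\<lambda>z. u a h n (x + z))"
    by (rule integrable_nu[OF h continuous_on_u[OF assms] abs_u_le[OF assms]])
  have ib: "integrable (\<nu> h) (\<lambda>z. ?b n (x + z))"
    by (rule integrable_nu[OF h c b])
  have iP: "integrable (\<nu> h) (\<lambda>z. P (real k * h) (?b j) (x + z))" for j k
    using h by (intro integrable_nu[OF h continuous_on_P[OF _ c b] abs_P_le[OF _ c b]]) auto
  \<comment> \<open>Writes \<open>a = 1 - (1 - a)\<close> at the first step: the part with
    \<open>1\<close> meets the induction hypothesis and yields the summands from
    \<open>k = 2\<close> on, the other part is the summand \<open>k = 1\<close>.\<close>
  have "u a h (Suc n) x = (LINT z|\<nu> h. u a h n (x + z) - ?b n (x + z))"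
    by (simp add: P_def algebra_simps)
  also have "\<dots> = (LINT z|\<nu> h. u a h n (x + z)) - P h (?b n) x"
    using iu ib by (simp add: P_def)
  also have "(LINT z|\<nu> h. u a h n (x + z))
      = (LINT z|\<nu> h. 1 - (\<Sum>k=1..n. P (real k * h) (?b (n - k)) (x + z)))"
    by (intro Bochner_Integration.integral_cong refl) (rule Suc.IH)
  also have "\<dots> = 1 - (\<Sum>k=1..n. P h (P (real k * h) (?b (n - k))) x)"
    using iP prob_space by (simp add: P_def)
  also have "\<dots> = 1 - (\<Sum>k=1..n. P (real (Suc k) * h) (?b (n - k)) x)"
  proof -
    have "P h (P (real k * h) (?b j)) x = P (real (Suc k) * h) (?b j) x" for k j
      using P_semigroup[OF h _ c b, of "real k * h"] h by (simp add: algebra_simps)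
    then show ?thesis by simp
  qed
  also have "\<dots> - P h (?b n) x = 1 - (\<Sum>k=1..Suc n. P (real k * h) (?b (Suc n - k)) x)"
  proof -
    have "(\<Sum>k=1..Suc n. g k) = g 1 + (\<Sum>k=1..n. g (Suc k))" for g :: "nat \<Rightarrow> real"
      by (simp add: sum.atLeast_Suc_atMost sum.shift_bounds_cl_Suc_ivl del: sum.cl_ivl_Suc)
    from this[of "\<lambda>k. P (real k * h) (?b (Suc n - k)) x"] show ?thesis by simp
  qed
  finally show ?case .
qed simp

section \<open>Grid sums estimated by resolvent integrals\<close>

definition W :: "real \<Rightarrow> (real \<Rightarrow> real) \<Rightarrow> real" where
  "W T g = 2 * max 1 T * (LBINT v. g v * (1 / (1 + \<psi> v))) / (2 * pi)"

lemma W_nonneg: "(\<And>v. g v \<ge> 0) \<Longrightarrow> W T g \<ge> 0"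
  unfolding W_def using psi_nonneg
  by (intro divide_nonneg_nonneg mult_nonneg_nonneg integral_nonneg_AE AE_I2) (auto simp: add_nonneg_nonneg)

text \<open>The sum is taken under the integral before anything is estimated, so that
  \<open>exp_sum_bound\<close> applies for each \<open>v\<close>; its constant
  \<open>2 * max 1 T\<close> is the prefactor in \<open>W\<close>. The result is uniform in
  \<open>h\<close>.\<close>

lemma walk_sum_le:
  assumes h: "h > 0" and n: "real n * h \<le> T" and g[measurable]: "g \<in> borel_measurable borel"
    and g0: "\<And>v. 0 \<le> g v" and gB: "\<And>v. g v \<le> B"
  shows "(\<Sum>k=1..n. h * ((LBINT v. g v * exp (- (real k * h) * \<psi> v)) / (2 * pi))) \<le> W T g"
proof -
  have gb: "\<bar>g v\<bar> \<le> B" for v using g0[of v] gB[of v] by simp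
  have i: "integrable lborel (\<lambda>v. g v * exp (- (real k * h) * \<psi> v))" if "k \<in> {1..n}" for k
    using that h by (intro integrable_bounded_exp_psi[OF _ g gb]) auto
  have "(\<Sum>k=1..n. h * (LBINT v. g v * exp (- (real k * h) * \<psi> v)))
      = (LBINT v. \<Sum>k=1..n. h * (g v * exp (- (real k * h) * \<psi> v)))"
    using i by (subst Bochner_Integration.integral_sum) auto
  also have "\<dots> \<le> (LBINT v. 2 * max 1 T * (g v * (1 / (1 + \<psi> v))))"
  proof (rule integral_mono)
    show "integrable lborel (\<lambda>v. \<Sum>k=1..n. h * (g v * exp (- (real k * h) * \<psi> v)))"
      using i by auto
    show "integrable lborel (\<lambda>v. 2 * max 1 T * (g v * (1 / (1 + \<psi> v))))"
      by (intro integrable_mult_right integrable_bounded_resolvent[OF g gb])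
    fix v
    have "(\<Sum>k=1..n. h * (g v * exp (- (real k * h) * \<psi> v))) = g v * (\<Sum>k=1..n. h * exp (- (real k * h) * \<psi> v))"
      by (simp add: sum_distrib_left mult_ac)
    also have "\<dots> \<le> g v * (2 * max 1 T / (1 + \<psi> v))"
      by (rule mult_left_mono[OF exp_sum_bound[OF h psi_nonneg n] g0])
    finally show "(\<Sum>k=1..n. h * (g v * exp (- (real k * h) * \<psi> v))) \<le> 2 * max 1 T * (g v * (1 / (1 + \<psi> v)))"
      by (simp add: mult_ac)
  qed
  finally have "(\<Sum>k=1..n. h * (LBINT v. g v * exp (- (real k * h) * \<psi> v))) / (2 * pi)
      \<le> (LBINT v. 2 * max 1 T * (g v * (1 / (1 + \<psi> v)))) / (2 * pi)"
    by (rule divide_right_mono) simp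
  moreover have "(LBINT v. 2 * max 1 T * (g v * (1 / (1 + \<psi> v)))) = 2 * max 1 T * (LBINT v. g v * (1 / (1 + \<psi> v)))"
    by (rule integral_mult_right_zero)
  ultimately show ?thesis
    by (simp only: W_def sum_divide_distrib times_divide_eq_right)
qed

text \<open>\<open>Q\<close>, \<open>modulus\<close> and \<open>\<rho>\<close> bound the sums of
  \<open>q\<close>, \<open>D\<close> and \<open>R\<close> over any equidistant grid in
  \<open>(0, T]\<close>: the total mass of the renewal kernel, the sensitivity to the starting
  point, and the cost of mollification.\<close>

definition Q :: "real \<Rightarrow> real" where "Q T = W T (\<lambda>_. 1)"
definition modulus :: "real \<Rightarrow> real \<Rightarrow> real" where "modulus T y = W T (\<lambda>v. min 2 \<bar>y * v\<bar>)"
definition \<rho> :: "real \<Rightarrow> real \<Rightarrow> real" where "\<rho> T \<epsilon> = W T (\<lambda>v. 1 - exp (- \<epsilon> * v\<^sup>2 / 2))"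

lemma
  assumes h: "h > 0" and n: "real n * h \<le> T"
  shows sum_q_le: "(\<Sum>k=1..n. h * q (real k * h)) \<le> Q T"
    and sum_D_le: "(\<Sum>k=1..n. h * D (real k * h) y) \<le> modulus T y"
    and sum_R_le: "\<epsilon> > 0 \<Longrightarrow> (\<Sum>k=1..n. h * R (real k * h) \<epsilon>) \<le> \<rho> T \<epsilon>"
  using walk_sum_le[OF h n, of "\<lambda>_. 1" 1] walk_sum_le[OF h n, of "\<lambda>v. min 2 \<bar>y * v\<bar>" 2]
    walk_sum_le[OF h n, of "\<lambda>v. 1 - exp (- \<epsilon> * v\<^sup>2 / 2)" 1]
  by (simp_all add: Q_def modulus_def \<rho>_def q_def D_def R_def)

lemma Q_nonneg: "Q T \<ge> 0" and modulus_nonneg: "modulus T y \<ge> 0"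
  unfolding Q_def modulus_def by (intro W_nonneg; simp)+

lemma modulus_le: "modulus T y \<le> 2 * Q T"
proof -
  have "(LBINT v. min 2 \<bar>y * v\<bar> * (1 / (1 + \<psi> v))) \<le> (LBINT v. 2 * (1 / (1 + \<psi> v)))"
    using integrable_resolvent psi_nonneg
    by (intro integral_mono integrable_bounded_resolvent[of _ 2] mult_right_mono integrable_mult_right)
       (auto simp: add_nonneg_nonneg)
  then have "2 * max 1 T * (LBINT v. min 2 \<bar>y * v\<bar> * (1 / (1 + \<psi> v))) / (2 * pi)
     \<le> 2 * max 1 T * (LBINT v. 2 * (1 / (1 + \<psi> v))) / (2 * pi)"
    by (intro divide_right_mono mult_left_mono) auto
  also have "(LBINT v. 2 * (1 / (1 + \<psi> v))) = 2 * (LBINT v. 1 / (1 + \<psi> v))"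
    by (rule integral_mult_right_zero)
  finally show ?thesis unfolding modulus_def Q_def W_def by simp
qed

lemma modulus_measurable [measurable]: "modulus T \<in> borel_measurable borel"
  unfolding modulus_def[abs_def] W_def by measurable

text \<open>Dominated convergence with \<open>2 / (1 + \<psi>)\<close>. The truncation at
  \<open>2\<close> in \<open>D\<close> makes this bound available, since
  \<open>\<bar>v\<bar> / (1 + \<psi> v)\<close> need not be integrable.\<close>

lemma modulus_tendsto_0:
  assumes y: "y \<longlonglongrightarrow> (0::real)"
  shows "(\<lambda>n. modulus T (y n)) \<longlonglongrightarrow> 0"
proof -
  have "(\<lambda>n. LBINT v. min 2 \<bar>y n * v\<bar> * (1 / (1 + \<psi> v))) \<longlonglongrightarrow> integral\<^sup>L lborel (\<lambda>v::real. 0::real)"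
  proof (rule integral_dominated_convergence[where w="\<lambda>v. 2 * (1 / (1 + \<psi> v))"])
    show "AE v in lborel. (\<lambda>n. min 2 \<bar>y n * v\<bar> * (1 / (1 + \<psi> v))) \<longlonglongrightarrow> 0"
    proof (rule AE_I2)
      fix v
      have "(\<lambda>n. min 2 \<bar>y n * v\<bar> * (1 / (1 + \<psi> v))) \<longlonglongrightarrow> min 2 \<bar>0 * v\<bar> * (1 / (1 + \<psi> v))"
        by (intro tendsto_intros y)
      then show "(\<lambda>n. min 2 \<bar>y n * v\<bar> * (1 / (1 + \<psi> v))) \<longlonglongrightarrow> 0" by simp
    qed
    show "AE v in lborel. norm (min 2 \<bar>y n * v\<bar> * (1 / (1 + \<psi> v))) \<le> 2 * (1 / (1 + \<psi> v))" for n
      using psi_nonneg by (intro AE_I2) (simp add: abs_mult divide_right_mono add_nonneg_nonneg)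
    show "integrable lborel (\<lambda>v. 2 * (1 / (1 + \<psi> v)))"
      by (rule integrable_mult_right[OF integrable_resolvent])
  qed auto
  then have "(\<lambda>n. 2 * max 1 T * (LBINT v. min 2 \<bar>y n * v\<bar> * (1 / (1 + \<psi> v))) / (2 * pi)) \<longlonglongrightarrow> 2 * max 1 T * 0 / (2 * pi)"
    by (intro tendsto_intros) simp_all
  then show ?thesis unfolding modulus_def W_def by simp
qed

lemma rho_tendsto_0:
  assumes y: "\<epsilon> \<longlonglongrightarrow> (0::real)" and pos: "\<And>n. \<epsilon> n > 0"
  shows "(\<lambda>n. \<rho> T (\<epsilon> n)) \<longlonglongrightarrow> 0"
proof -
  have "(\<lambda>n. LBINT v. (1 - exp (- \<epsilon> n * v\<^sup>2 / 2)) * (1 / (1 + \<psi> v))) \<longlonglongrightarrow> integral\<^sup>L lborel (\<lambda>v::real. 0::real)"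
  proof (rule integral_dominated_convergence[where w="\<lambda>v. 1 / (1 + \<psi> v)"])
    show "AE v in lborel. (\<lambda>n. (1 - exp (- \<epsilon> n * v\<^sup>2 / 2)) * (1 / (1 + \<psi> v))) \<longlonglongrightarrow> 0"
    proof (rule AE_I2)
      fix v
      have "(\<lambda>n. (1 - exp (- \<epsilon> n * v\<^sup>2 / 2)) * (1 / (1 + \<psi> v))) \<longlonglongrightarrow> (1 - exp (- 0 * v\<^sup>2 / 2)) * (1 / (1 + \<psi> v))"
        by (intro tendsto_intros y) auto
      then show "(\<lambda>n. (1 - exp (- \<epsilon> n * v\<^sup>2 / 2)) * (1 / (1 + \<psi> v))) \<longlonglongrightarrow> 0" by simp
    qed
    have "\<bar>1 - exp (- \<epsilon> n * v\<^sup>2 / 2)\<bar> * (1 / (1 + \<psi> v)) \<le> 1 * (1 / (1 + \<psi> v))" for n v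
      using psi_nonneg[of v] pos[of n] by (intro mult_right_mono) auto
    then show "AE v in lborel. norm ((1 - exp (- \<epsilon> n * v\<^sup>2 / 2)) * (1 / (1 + \<psi> v))) \<le> 1 / (1 + \<psi> v)" for n
      using psi_nonneg by (intro AE_I2) (simp add: abs_mult add_nonneg_nonneg)
  qed (use integrable_resolvent in auto)
  then have "(\<lambda>n. 2 * max 1 T * (LBINT v. (1 - exp (- \<epsilon> n * v\<^sup>2 / 2)) * (1 / (1 + \<psi> v))) / (2 * pi)) \<longlonglongrightarrow> 2 * max 1 T * 0 / (2 * pi)"
    by (intro tendsto_intros) simp_all
  then show ?thesis unfolding \<rho>_def W_def by simp
qed

end

lemma integrable_dominated:
  fixes f g :: "'b \<Rightarrow> real"
  assumes "integrable M g" and "f \<in> borel_measurable M" and "\<And>x. \<bar>f x\<bar> \<le> g x"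
  shows "integrable M f"
  using assms(3) by (intro Bochner_Integration.integrable_bound[OF assms(1,2)] AE_I2)
    (auto intro: order_trans[OF _ abs_ge_self])

lemma continuous_on_normal_density: "s \<noteq> 0 \<Longrightarrow> continuous_on A (normal_density m s)"
  unfolding normal_density_def[abs_def] by (intro continuous_intros) auto

lemma one_minus_exp_minus_le:
  fixes x :: real
  assumes "x \<ge> 0"
  shows "1 - exp (- x) \<le> x" "x - x\<^sup>2 \<le> 1 - exp (- x)"
proof -
  show "1 - exp (- x) \<le> x" using exp_ge_add_one_self[of "-x"] by simp
  have "(1 + x) * exp (- x) \<le> exp x * exp (- x)"
    by (intro mult_right_mono exp_ge_add_one_self) auto
  then have "exp (- x) \<le> 1 / (1 + x)" using assms by (simp add: field_simps flip: exp_add)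
  moreover have "(1 + x) * (1 - x + x\<^sup>2) = 1 + x ^ 3" by (simp add: algebra_simps power2_eq_square power3_eq_cube)
  then have "1 / (1 + x) \<le> 1 - x + x\<^sup>2" using assms by (simp add: divide_le_eq mult.commute)
  ultimately show "x - x\<^sup>2 \<le> 1 - exp (- x)" by linarith
qed

section \<open>Approximate renewal equation for the damped walk\<close>

context symmetric_convolution_family
begin

lemma D_nonneg: "D t y \<ge> 0"
  unfolding D_def by simp

lemma P_gauss:
  assumes "t > 0" "\<epsilon> > 0"
  shows "P t (V \<epsilon>) 0 = q t - R t \<epsilon>"
proof -
  have "P t (V \<epsilon>) 0 = (LINT z|\<nu> t. V \<epsilon> (0 - z))"
    unfolding P_def by (simp add: normal_density_def)
  also have "\<dots> = (LBINT v. exp (- \<epsilon> * v\<^sup>2 / 2) * exp (- t * \<psi> v)) / (2 * pi)"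
    using assms by (subst gauss_nu) auto
  also have "(LBINT v. exp (- \<epsilon> * v\<^sup>2 / 2) * exp (- t * \<psi> v))
      = (LBINT v. exp (- t * \<psi> v) - (1 - exp (- \<epsilon> * v\<^sup>2 / 2)) * exp (- t * \<psi> v))"
    by (intro Bochner_Integration.integral_cong refl) (simp add: algebra_simps)
  also have "\<dots> = (LBINT v. exp (- t * \<psi> v)) - (LBINT v. (1 - exp (- \<epsilon> * v\<^sup>2 / 2)) * exp (- t * \<psi> v))"
    using assms by (intro Bochner_Integration.integral_diff integrable_exp_psi integrable_bounded_exp_psi[of _ _ 1]) auto
  finally show ?thesis by (simp add: q_def R_def diff_divide_distrib)
qed

lemma R_nonneg: "\<epsilon> > 0 \<Longrightarrow> R t \<epsilon> \<ge> 0"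
  unfolding R_def by (intro divide_nonneg_nonneg integral_nonneg_AE) auto

text \<open>With \<open>V \<epsilon>\<close> in place of the Dirac function, the product of these
  factors over the grid is the exponential of \<open>- c\<close> times a Riemann sum of the
  mollified local time. A negative \<open>c\<close> gives the amplified walk.\<close>

definition damp :: "real \<Rightarrow> real \<Rightarrow> real \<Rightarrow> real \<Rightarrow> real" where
  "damp c h \<epsilon> y = exp (- (c * h * V \<epsilon> y))"

lemma continuous_on_damp: "\<epsilon> > 0 \<Longrightarrow> continuous_on UNIV (damp c h \<epsilon>)"
  unfolding damp_def[abs_def] by (intro continuous_intros continuous_on_normal_density) auto

lemma damp_bounds:
  assumes "c \<ge> 0" "h \<ge> 0"
  shows "0 \<le> damp c h \<epsilon> y" "damp c h \<epsilon> y \<le> 1"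
    "1 - damp c h \<epsilon> y \<le> c * h * V \<epsilon> y" "c * h * V \<epsilon> y - (c * h * V \<epsilon> y)\<^sup>2 \<le> 1 - damp c h \<epsilon> y"
  using one_minus_exp_minus_le[of "c * h * V \<epsilon> y"] assms by (auto simp: damp_def)

lemma V_le: "\<epsilon> > 0 \<Longrightarrow> V \<epsilon> y \<le> 1 / sqrt (2 * pi * \<epsilon>)"
  using normal_density_le[of "sqrt \<epsilon>" 0 y] by simp

text \<open>The three terms stem from linearising \<open>damp\<close>, from restarting the walk at \<open>0\<close> instead of near \<open>0\<close>,
  and from mollifying the Dirac function.\<close>

definition walk_error :: "real \<Rightarrow> real \<Rightarrow> real \<Rightarrow> real \<Rightarrow> real" where
  "walk_error c h \<epsilon> T = c\<^sup>2 * h / sqrt (2 * pi * \<epsilon>) * Q T + c\<^sup>2 * Q T * (LBINT y. V \<epsilon> y * modulus T y) + c * \<rho> T \<epsilon>"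

context
  fixes c h \<epsilon> T :: real
  assumes c: "c \<ge> 0" and h: "h > 0" and eps: "\<epsilon> > 0"
begin

abbreviation "w \<equiv> u (damp c h \<epsilon>) h"
abbreviation "G j y \<equiv> (1 - damp c h \<epsilon> y) * w j y"

lemma abs_damp_le: "\<bar>damp c h \<epsilon> y\<bar> \<le> 1"
  using damp_bounds[OF c less_imp_le[OF h]] by auto

lemma continuous_on_w: "continuous_on UNIV (w j)"
  by (rule continuous_on_u[OF less_imp_le[OF h] continuous_on_damp[OF eps] abs_damp_le])

lemma abs_w_le: "\<bar>w j y\<bar> \<le> 1"
  using abs_u_le[OF less_imp_le[OF h] continuous_on_damp[OF eps] abs_damp_le] by simp

lemma continuous_on_G: "continuous_on UNIV (G j)"
  by (intro continuous_intros continuous_on_w continuous_on_damp eps)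

lemma abs_G_le: "\<bar>G j y\<bar> \<le> c * h * V \<epsilon> y"
  using mult_mono[OF damp_bounds(3)[OF c less_imp_le[OF h]] abs_w_le[of j y]]
    damp_bounds[OF c less_imp_le[OF h]] c h by (simp add: abs_mult)

lemma abs_G_le_1: "\<bar>G j y\<bar> \<le> 1"
  using mult_mono[of "\<bar>1 - damp c h \<epsilon> y\<bar>" 1 "\<bar>w j y\<bar>" 1]
    damp_bounds[OF c less_imp_le[OF h]] abs_w_le by (simp add: abs_mult)

lemma measurable_w [measurable]: "w j \<in> borel_measurable borel"
  by (rule borel_measurable_continuous_onI[OF continuous_on_w])

lemma measurable_damp [measurable]: "damp c h \<epsilon> \<in> borel_measurable borel"
  by (rule borel_measurable_continuous_onI[OF continuous_on_damp[OF eps]])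

lemma integrable_G: "integrable lborel (G j)"
  by (rule integrable_dominated[of _ "\<lambda>y. c * h * V \<epsilon> y"]) (use eps abs_G_le in auto)

text \<open>\<open>V \<epsilon>\<close> has mass 1, so the bound does not see
  \<open>\<epsilon>\<close>; this keeps the shift estimate \<open>w_diff_le\<close> uniform as
  \<open>\<epsilon>\<close> tends to \<open>0\<close>.\<close>

lemma integral_abs_G_le: "(LBINT y. \<bar>G j y\<bar>) \<le> c * h"
proof -
  have "(LBINT y. \<bar>G j y\<bar>) \<le> (LBINT y. c * h * V \<epsilon> y)"
    using eps abs_G_le integrable_G by (intro integral_mono) auto
  then show ?thesis using eps by simp
qed

lemma w_renewal: "w n x = 1 - (\<Sum>k=1..n. P (real k * h) (G (n - k)) x)"
  by (rule u_renewal[OF less_imp_le[OF h] continuous_on_damp[OF eps] abs_damp_le])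

text \<open>Subtracting the renewal equations for the two starting points leaves differences of
  \<open>P (k * h) (G (n - k))\<close>, each at most \<open>D (k * h) y\<close> times the
  \<open>L1\<close> bound \<open>c * h\<close>.\<close>

lemma w_diff_le:
  assumes n: "real n * h \<le> T"
  shows "\<bar>w n y - w n 0\<bar> \<le> c * modulus T y"
proof -
  have eq: "w n y - w n 0 = (\<Sum>k=1..n. P (real k * h) (G (n - k)) 0 - P (real k * h) (G (n - k)) y)"
    by (subst (1 2) w_renewal) (simp add: sum_subtractf)
  have "\<bar>w n y - w n 0\<bar> \<le> (\<Sum>k=1..n. \<bar>P (real k * h) (G (n - k)) 0 - P (real k * h) (G (n - k)) y\<bar>)"
    unfolding eq by (rule sum_abs)
  also have "\<dots> \<le> (\<Sum>k=1..n. c * (h * D (real k * h) y))"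
  proof (rule sum_mono)
    fix k assume k: "k \<in> {1..n}"
    have "real k * h > 0" using k h by simp
    then have "\<bar>P (real k * h) (G (n - k)) y - P (real k * h) (G (n - k)) 0\<bar> \<le> D (real k * h) y * (LBINT y. \<bar>G (n - k) y\<bar>)"
      by (rule abs_P_diff_le_D[OF _ continuous_on_G[where j = "n - k"] abs_G_le_1[where j = "n - k"] integrable_G[where j = "n - k"]])
    also have "\<dots> \<le> D (real k * h) y * (c * h)"
      by (intro mult_left_mono integral_abs_G_le D_nonneg)
    finally show "\<bar>P (real k * h) (G (n - k)) 0 - P (real k * h) (G (n - k)) y\<bar> \<le> c * (h * D (real k * h) y)"
      by (simp add: mult_ac abs_minus_commute)
  qed
  also have "\<dots> = c * (\<Sum>k=1..n. h * D (real k * h) y)"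
    by (rule sum_distrib_left[symmetric])
  also have "\<dots> \<le> c * modulus T y"
    by (intro mult_left_mono sum_D_le h n c)
  finally show ?thesis .
qed

lemma P_G_approx:
  assumes t: "t > 0" and j: "real j * h \<le> T"
  shows "\<bar>P t (G j) 0 - c * h * q t * w j 0\<bar>
    \<le> c\<^sup>2 * h\<^sup>2 / sqrt (2 * pi * \<epsilon>) * q t + c\<^sup>2 * h * q t * (LBINT y. V \<epsilon> y * modulus T y) + c * h * R t \<epsilon>"
proof -
  let ?m = "1 / sqrt (2 * pi * \<epsilon>)"
  \<comment> \<open>\<open>G j\<close> equals
    \<open>G1 + c * h * G2 + c * h * w j 0 * V \<epsilon>\<close>. Here \<open>G1\<close> is
    quadratic in \<open>c * h * V \<epsilon>\<close>, \<open>G2\<close> is small because the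
    Gaussian concentrates near \<open>0\<close>, where \<open>w j\<close> is close to
    \<open>w j 0\<close>, and the last term gives \<open>q t - R t \<epsilon>\<close> by
    \<open>P_gauss\<close>.\<close>
  define G1 where "G1 y = (1 - damp c h \<epsilon> y - c * h * V \<epsilon> y) * w j y" for y
  define G2 where "G2 y = V \<epsilon> y * (w j y - w j 0)" for y
  have h0: "h \<ge> 0" and t0: "t \<ge> 0" using h t by auto
  have V0: "V \<epsilon> y \<ge> 0" for y by simp
  have contV: "continuous_on UNIV (V \<epsilon>)" using eps by (intro continuous_on_normal_density) auto
  have c1: "continuous_on UNIV G1" unfolding G1_def[abs_def]
    by (intro continuous_intros continuous_on_w continuous_on_damp eps contV)
  have c2: "continuous_on UNIV G2" unfolding G2_def[abs_def]
    by (intro continuous_intros continuous_on_w contV)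
  have [measurable]: "G1 \<in> borel_measurable borel" "G2 \<in> borel_measurable borel"
    using c1 c2 by (auto intro: borel_measurable_continuous_onI)
  have g1: "\<bar>G1 y\<bar> \<le> c\<^sup>2 * h\<^sup>2 * ?m * V \<epsilon> y" for y
  proof -
    have "(c * h * V \<epsilon> y)\<^sup>2 = c\<^sup>2 * h\<^sup>2 * (V \<epsilon> y * V \<epsilon> y)"
      by (simp add: power_mult_distrib power2_eq_square)
    \<comment> \<open>Only one of the two factors \<open>V \<epsilon> y\<close> is replaced by its
      maximum; the other one keeps the \<open>L1\<close> norm finite.\<close>
    also have "\<dots> \<le> c\<^sup>2 * h\<^sup>2 * (?m * V \<epsilon> y)"
      by (intro mult_left_mono mult_right_mono V_le eps) auto
    finally have "\<bar>1 - damp c h \<epsilon> y - c * h * V \<epsilon> y\<bar> \<le> c\<^sup>2 * h\<^sup>2 * ?m * V \<epsilon> y"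
      using damp_bounds[OF c h0, of \<epsilon> y] by (simp add: abs_le_iff)
    from mult_mono[OF this abs_w_le[of j y]] show ?thesis
      using eps by (simp add: G1_def abs_mult)
  qed
  have g2: "\<bar>G2 y\<bar> \<le> c * (V \<epsilon> y * modulus T y)" for y
    using mult_left_mono[OF w_diff_le[OF j, of y] V0[of y]] by (simp add: G2_def abs_mult mult_ac)
  have iVm: "integrable lborel (\<lambda>y. V \<epsilon> y * modulus T y)"
  proof (rule Bochner_Integration.integrable_bound[of _ "\<lambda>y. 2 * Q T * V \<epsilon> y"])
    have "norm (V \<epsilon> y * modulus T y) \<le> norm (2 * Q T * V \<epsilon> y)" for y
      using mult_left_mono[OF modulus_le[of T y] V0[of y]] modulus_nonneg[of T y] Q_nonneg[of T]
      by (simp add: abs_mult mult_ac)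
    then show "AE y in lborel. norm (V \<epsilon> y * modulus T y) \<le> norm (2 * Q T * V \<epsilon> y)" by simp
  qed (use eps in auto)
  have i1: "integrable lborel G1"
    by (rule integrable_dominated[OF _ _ g1]) (use eps in auto)
  have i2: "integrable lborel G2"
    by (rule integrable_dominated[OF integrable_mult_right[OF iVm] _ g2]) auto
  have b1: "\<bar>G1 y\<bar> \<le> c\<^sup>2 * h\<^sup>2 * ?m * ?m" for y
    by (rule order_trans[OF g1]) (use V_le[OF eps, of y] eps in \<open>intro mult_left_mono, auto\<close>)
  have b2: "\<bar>G2 y\<bar> \<le> ?m * 2" for y
    unfolding G2_def abs_mult using abs_w_le[of j y] abs_w_le[of j 0] V_le[OF eps, of y] eps
    by (intro mult_mono) auto
  have "(LBINT y. \<bar>G1 y\<bar>) \<le> (LBINT y. c\<^sup>2 * h\<^sup>2 * ?m * V \<epsilon> y)"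
    using eps i1 g1 by (intro integral_mono) auto
  then have n1: "(LBINT y. \<bar>G1 y\<bar>) \<le> c\<^sup>2 * h\<^sup>2 * ?m"
    using eps by simp
  have "(LBINT y. \<bar>G2 y\<bar>) \<le> (LBINT y. c * (V \<epsilon> y * modulus T y))"
    using i2 g2 iVm by (intro integral_mono) auto
  then have n2: "(LBINT y. \<bar>G2 y\<bar>) \<le> c * (LBINT y. V \<epsilon> y * modulus T y)" by simp
  have iP: "integrable (\<nu> t) (\<lambda>z. G1 (0 + z))" "integrable (\<nu> t) (\<lambda>z. G2 (0 + z))" "integrable (\<nu> t) (\<lambda>z. V \<epsilon> (0 + z))"
    using V_le[OF eps] V0 by (intro integrable_nu[OF t0 c1 b1] integrable_nu[OF t0 c2 b2] integrable_nu[OF t0 contV, of ?m]; simp)+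
  have "P t (G j) 0 = (LINT z|\<nu> t. G1 (0 + z) + c * h * G2 (0 + z) + c * h * w j 0 * V \<epsilon> (0 + z))"
    unfolding P_def by (intro Bochner_Integration.integral_cong refl) (simp add: G1_def G2_def algebra_simps)
  also have "\<dots> = P t G1 0 + c * h * P t G2 0 + c * h * w j 0 * P t (V \<epsilon>) 0"
    using iP by (simp add: P_def)
  finally have eq: "P t (G j) 0 - c * h * q t * w j 0 = P t G1 0 + c * h * P t G2 0 + - (c * h * R t \<epsilon> * w j 0)"
    by (simp add: P_gauss[OF t eps] algebra_simps)
  have "\<bar>P t (G j) 0 - c * h * q t * w j 0\<bar> \<le> \<bar>P t G1 0\<bar> + c * h * \<bar>P t G2 0\<bar> + c * h * R t \<epsilon> * \<bar>w j 0\<bar>"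
  proof -
    have "\<bar>a + b + - d\<bar> \<le> \<bar>a\<bar> + \<bar>b\<bar> + \<bar>d\<bar>" for a b d :: real by linarith
    from this[of "P t G1 0" "c * h * P t G2 0" "c * h * R t \<epsilon> * w j 0"]
    show ?thesis unfolding eq using c h0 R_nonneg[OF eps, of t] by (simp add: abs_mult)
  qed
  also have "\<dots> \<le> q t * (c\<^sup>2 * h\<^sup>2 * ?m) + c * h * (q t * (c * (LBINT y. V \<epsilon> y * modulus T y))) + c * h * R t \<epsilon> * 1"
  proof (intro add_mono mult_left_mono)
    show "\<bar>P t G1 0\<bar> \<le> q t * (c\<^sup>2 * h\<^sup>2 * ?m)"
      using abs_P_le_q[OF t c1 b1 i1] mult_left_mono[OF n1 q_nonneg] by (rule order_trans)
    show "\<bar>P t G2 0\<bar> \<le> q t * (c * (LBINT y. V \<epsilon> y * modulus T y))"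
      using abs_P_le_q[OF t c2 b2 i2] mult_left_mono[OF n2 q_nonneg] by (rule order_trans)
    show "\<bar>w j 0\<bar> \<le> 1" by (rule abs_w_le)
  qed (use c h0 R_nonneg[OF eps, of t] in auto)
  also have "\<dots> = c\<^sup>2 * h\<^sup>2 / sqrt (2 * pi * \<epsilon>) * q t + c\<^sup>2 * h * q t * (LBINT y. V \<epsilon> y * modulus T y) + c * h * R t \<epsilon>"
    by (simp add: power2_eq_square)
  finally show ?thesis .
qed

text \<open>The error is the same for all \<open>n\<close>: each summand costs a multiple of
  \<open>h * q (k * h)\<close> or \<open>h * R (k * h) \<epsilon>\<close>, and the sums of these
  over the grid are controlled by \<open>Q T\<close> and \<open>\<rho> T \<epsilon>\<close>.\<close>

lemma w_approx_renewal:
  assumes n: "real n * h \<le> T"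
  shows "\<bar>w n 0 - 1 + c * (\<Sum>k=1..n. h * q (real k * h) * w (n - k) 0)\<bar> \<le> walk_error c h \<epsilon> T"
proof -
  let ?I = "LBINT y. V \<epsilon> y * modulus T y"
  have I: "?I \<ge> 0" using modulus_nonneg by (intro integral_nonneg_AE) auto
  have eq: "w n 0 - 1 + c * (\<Sum>k=1..n. h * q (real k * h) * w (n - k) 0)
     = - (\<Sum>k=1..n. P (real k * h) (G (n - k)) 0 - c * h * q (real k * h) * w (n - k) 0)"
    by (subst w_renewal[of n]) (simp add: sum_subtractf sum_distrib_left mult_ac)
  have "\<bar>w n 0 - 1 + c * (\<Sum>k=1..n. h * q (real k * h) * w (n - k) 0)\<bar>
      \<le> (\<Sum>k=1..n. \<bar>P (real k * h) (G (n - k)) 0 - c * h * q (real k * h) * w (n - k) 0\<bar>)"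
    unfolding eq abs_minus_cancel by (rule sum_abs)
  also have "\<dots> \<le> (\<Sum>k=1..n. c\<^sup>2 * h / sqrt (2 * pi * \<epsilon>) * (h * q (real k * h))
      + c\<^sup>2 * ?I * (h * q (real k * h)) + c * (h * R (real k * h) \<epsilon>))"
  proof (rule sum_mono)
    fix k assume k: "k \<in> {1..n}"
    then have "real (n - k) * h \<le> real n * h" using h by (intro mult_right_mono) auto
    then have "real (n - k) * h \<le> T" using n by linarith
    moreover have "real k * h > 0" using k h by simp
    ultimately have "\<bar>P (real k * h) (G (n - k)) 0 - c * h * q (real k * h) * w (n - k) 0\<bar>
      \<le> c\<^sup>2 * h\<^sup>2 / sqrt (2 * pi * \<epsilon>) * q (real k * h) + c\<^sup>2 * h * q (real k * h) * ?I + c * h * R (real k * h) \<epsilon>"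
      by (intro P_G_approx)
    also have "\<dots> = c\<^sup>2 * h / sqrt (2 * pi * \<epsilon>) * (h * q (real k * h))
      + c\<^sup>2 * ?I * (h * q (real k * h)) + c * (h * R (real k * h) \<epsilon>)"
      by (simp add: power2_eq_square)
    finally show "\<bar>P (real k * h) (G (n - k)) 0 - c * h * q (real k * h) * w (n - k) 0\<bar>
      \<le> c\<^sup>2 * h / sqrt (2 * pi * \<epsilon>) * (h * q (real k * h))
      + c\<^sup>2 * ?I * (h * q (real k * h)) + c * (h * R (real k * h) \<epsilon>)" .
  qed
  also have "\<dots> = c\<^sup>2 * h / sqrt (2 * pi * \<epsilon>) * (\<Sum>k=1..n. h * q (real k * h))
      + c\<^sup>2 * ?I * (\<Sum>k=1..n. h * q (real k * h)) + c * (\<Sum>k=1..n. h * R (real k * h) \<epsilon>)"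
    by (simp add: sum.distrib sum_distrib_left)
  also have "\<dots> \<le> c\<^sup>2 * h / sqrt (2 * pi * \<epsilon>) * Q T + c\<^sup>2 * ?I * Q T + c * \<rho> T \<epsilon>"
    using c h eps I
    by (intro add_mono mult_left_mono sum_q_le[OF h n] sum_R_le[OF h n]) (auto simp: divide_nonneg_nonneg)
  finally show ?thesis by (simp add: walk_error_def mult_ac)
qed

end

text \<open>Khasminskii's argument, with damping replaced by amplification.\<close>

lemma u_exp_moment:
  assumes c: "c \<ge> 0" and h: "h > 0" and eps: "\<epsilon> > 0"
    and small: "c * h / sqrt (2 * pi * \<epsilon>) \<le> 1" and cQ: "4 * c * Q T \<le> 1" and n: "real n * h \<le> T"
  shows "\<bar>u (damp (- c) h \<epsilon>) h n x\<bar> \<le> 2"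
  using n
\<comment> \<open>Strong induction with the bound 2 closes because the renewal sum is at most
  \<open>4 * c * Q T\<close>, hence at most 1.\<close>
proof (induction n arbitrary: x rule: less_induct)
  case (less n)
  let ?a = "damp (- c) h \<epsilon>"
  \<comment> \<open>For \<open>x = c * h * V \<epsilon> y\<close> in \<open>[0, 1]\<close>,
    \<open>exp x - 1\<close> is at most \<open>x + x\<^sup>2\<close>, hence at most
    \<open>2 * x\<close>. This 2 and the bound 2 of the induction hypothesis make up the 4 in
    \<open>cQ\<close>.\<close>
  have a: "0 \<le> ?a y - 1 \<and> ?a y - 1 \<le> 2 * (c * h * V \<epsilon> y) \<and> \<bar>?a y\<bar> \<le> 3" for y
  proof -
    have x: "0 \<le> c * h * V \<epsilon> y" using c h by simp
    have "c * h * V \<epsilon> y \<le> c * h * (1 / sqrt (2 * pi * \<epsilon>))"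
      using c h by (intro mult_left_mono V_le eps) auto
    then have x1: "c * h * V \<epsilon> y \<le> 1" using small by simp
    have "exp (c * h * V \<epsilon> y) \<le> 1 + c * h * V \<epsilon> y + (c * h * V \<epsilon> y)\<^sup>2"
      by (rule exp_bound[OF x x1])
    moreover have "(c * h * V \<epsilon> y)\<^sup>2 \<le> c * h * V \<epsilon> y"
      using mult_left_mono[OF x1 x] by (simp add: power2_eq_square)
    moreover have "exp (c * h * V \<epsilon> y) \<ge> 1" using x by simp
    ultimately show ?thesis using x1 by (auto simp: damp_def)
  qed
  then have a3: "\<bar>?a y\<bar> \<le> 3" for y by blast
  have cont: "continuous_on UNIV (\<lambda>y. (1 - ?a y) * u ?a h j y)" for j
    using h by (intro continuous_intros continuous_on_damp eps continuous_on_u[OF _ continuous_on_damp[OF eps] a3]) auto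
  have eq: "u ?a h n x = 1 - (\<Sum>k=1..n. P (real k * h) (\<lambda>y. (1 - ?a y) * u ?a h (n - k) y) x)"
    using h by (intro u_renewal[OF _ continuous_on_damp[OF eps] a3]) auto
  have "\<bar>u ?a h n x\<bar> \<le> 1 + (\<Sum>k=1..n. \<bar>P (real k * h) (\<lambda>y. (1 - ?a y) * u ?a h (n - k) y) x\<bar>)"
    unfolding eq by (rule order_trans[OF abs_triangle_ineq4]) (auto intro: sum_abs)
  also have "\<dots> \<le> 1 + (\<Sum>k=1..n. 4 * c * (h * q (real k * h)))"
  proof (intro add_left_mono sum_mono)
    fix k assume k: "k \<in> {1..n}"
    let ?G = "\<lambda>y. (1 - ?a y) * u ?a h (n - k) y"
    have "real (n - k) * h \<le> real n * h" using h by (intro mult_right_mono) auto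
    then have IH: "\<bar>u ?a h (n - k) y\<bar> \<le> 2" for y
      using less.IH[of "n - k"] k less.prems by auto
    have g: "\<bar>?G y\<bar> \<le> 4 * c * h * V \<epsilon> y" for y
    proof -
      have "\<bar>1 - ?a y\<bar> * \<bar>u ?a h (n - k) y\<bar> \<le> 2 * (c * h * V \<epsilon> y) * 2"
        using a[of y] c h by (intro mult_mono IH) auto
      then show ?thesis by (simp add: abs_mult)
    qed
    have g': "\<bar>?G y\<bar> \<le> 4 * c * h * (1 / sqrt (2 * pi * \<epsilon>))" for y
      using c h by (intro order_trans[OF g] mult_left_mono V_le eps) auto
    have [measurable]: "?G \<in> borel_measurable borel"
      by (rule borel_measurable_continuous_onI[OF cont])
    have i: "integrable lborel ?G"
      by (rule integrable_dominated[OF _ _ g]) (use eps in auto)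
    have "(LBINT y. \<bar>?G y\<bar>) \<le> (LBINT y. 4 * c * h * V \<epsilon> y)"
      using eps i g by (intro integral_mono) auto
    then have "(LBINT y. \<bar>?G y\<bar>) \<le> 4 * c * h" using eps by simp
    then have "q (real k * h) * (LBINT y. \<bar>?G y\<bar>) \<le> q (real k * h) * (4 * c * h)"
      by (intro mult_left_mono q_nonneg)
    moreover have "\<bar>P (real k * h) ?G x\<bar> \<le> q (real k * h) * (LBINT y. \<bar>?G y\<bar>)"
      using k h by (intro abs_P_le_q[OF _ cont[of "n - k"] g' i]) simp
    ultimately show "\<bar>P (real k * h) ?G x\<bar> \<le> 4 * c * (h * q (real k * h))"
      by (simp add: mult_ac)
  qed
  also have "\<dots> = 1 + 4 * c * (\<Sum>k=1..n. h * q (real k * h))"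
    by (simp only: sum_distrib_left)
  also have "\<dots> \<le> 1 + 4 * c * Q T"
    using c by (intro add_left_mono mult_left_mono sum_q_le[OF h less.prems]) auto
  also have "\<dots> \<le> 2" using cQ by simp
  finally show ?case .
qed

end

subsection \<open>Discrete renewal inequalities\<close>

lemma renewal_upper_bound:
  fixes f r :: "nat \<Rightarrow> real"
  assumes dec: "\<And>i j. i \<le> j \<Longrightarrow> f j \<le> f i" and nonneg: "\<And>i. 0 \<le> f i" and r: "\<And>k. 0 \<le> r k" and c: "c \<ge> 0"
    and renewal: "\<bar>f m - 1 + c * (\<Sum>k=1..m. r k * f (m - k))\<bar> \<le> \<eta>"
  shows "c * (\<Sum>k=1..m. r k) * f m \<le> 1 + \<eta>"
proof -
  have "(\<Sum>k=1..m. r k) * f m \<le> (\<Sum>k=1..m. r k * f (m - k))"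
    unfolding sum_distrib_right by (intro sum_mono mult_left_mono dec r) auto
  then have "c * (\<Sum>k=1..m. r k) * f m \<le> c * (\<Sum>k=1..m. r k * f (m - k))"
    using c by (simp add: mult.assoc mult_left_mono)
  then show ?thesis using renewal nonneg[of m] by (simp add: abs_le_iff)
qed

text \<open>By the renewal equations at \<open>m\<close> and \<open>2 * m\<close>, the convolution
  at \<open>2 * m\<close> is, up to the errors, at least that at \<open>m\<close>. Its first half is
  at most \<open>Q * f m\<close>; its second half falls short of the convolution at \<open>m\<close>
  by at least \<open>\<delta> * F\<close>, where \<open>F\<close> sums \<open>f\<close> below
  \<open>m\<close>. So \<open>f m\<close> is bounded below in terms of \<open>F\<close>, and summing
  the renewal equation over \<open>n < m\<close> shows that \<open>F\<close> is at least
  \<open>m * (1 - \<eta>) / (1 + c * Q)\<close>.\<close>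

lemma renewal_lower_bound:
  fixes f r :: "nat \<Rightarrow> real"
  assumes dec: "\<And>i j. i \<le> j \<Longrightarrow> f j \<le> f i" and nonneg: "\<And>i. 0 \<le> f i" and r: "\<And>k. 0 \<le> r k" and c: "c \<ge> 0"
    and renewal: "\<And>n. n \<le> 2 * m \<Longrightarrow> \<bar>f n - 1 + c * (\<Sum>k=1..n. r k * f (n - k))\<bar> \<le> \<eta>"
    and Q: "(\<Sum>k=1..m. r k) \<le> Q"
    and gap: "\<And>k. k \<in> {1..m} \<Longrightarrow> \<delta> \<le> r k - r (m + k)" and \<delta>: "\<delta> \<ge> 0"
  shows "c * \<delta> * (real m * (1 - \<eta>) / (1 + c * Q)) - 2 * \<eta> \<le> c * Q * f m"
proof -
  define F where "F = (\<Sum>j<m. f j)"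
  have F0: "F \<ge> 0" unfolding F_def by (intro sum_nonneg nonneg)
  have Q0: "Q \<ge> 0" using Q sum_nonneg[of "{1..m}" r, OF r] by linarith
  have F_rev: "(\<Sum>k=1..m. f (m - k)) = F"
    unfolding F_def by (rule sum.reindex_bij_witness[of _ "\<lambda>j. m - j" "\<lambda>k. m - k"]) auto
  have shifted: "(\<Sum>n<m. if k \<le> n then f (n - k) else 0) \<le> F" for k
  proof -
    have "(\<Sum>n<m. if k \<le> n then f (n - k) else 0) = (\<Sum>n\<in>{k..<m}. f (n - k))"
      by (intro sum.mono_neutral_cong_right) auto
    also have "\<dots> = (\<Sum>j<m - k. f j)"
      by (rule sum.reindex_bij_witness[of _ "\<lambda>j. j + k" "\<lambda>n. n - k"]) auto
    also have "\<dots> \<le> F" unfolding F_def by (intro sum_mono2 nonneg) auto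
    finally show ?thesis .
  qed
  \<comment> \<open>Young's inequality for convolutions: after exchanging the sums, each shifted sum
    of \<open>f\<close> is at most \<open>F\<close>.\<close>
  have conv: "(\<Sum>n<m. \<Sum>k=1..n. r k * f (n - k)) \<le> Q * F"
  proof -
    have "(\<Sum>n<m. \<Sum>k=1..n. r k * f (n - k)) = (\<Sum>n<m. \<Sum>k=1..m. if k \<le> n then r k * f (n - k) else 0)"
      by (intro sum.cong refl sum.mono_neutral_cong_left) auto
    also have "\<dots> = (\<Sum>k=1..m. \<Sum>n<m. if k \<le> n then r k * f (n - k) else 0)"
      by (rule sum.swap)
    also have "\<dots> = (\<Sum>k=1..m. r k * (\<Sum>n<m. if k \<le> n then f (n - k) else 0))"
      by (auto simp: sum_distrib_left intro!: sum.cong)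
    also have "\<dots> \<le> (\<Sum>k=1..m. r k * F)"
      by (intro sum_mono mult_left_mono shifted r)
    also have "\<dots> \<le> Q * F"
      unfolding sum_distrib_right[symmetric] by (intro mult_right_mono Q F0)
    finally show ?thesis .
  qed
  have "real m * (1 - \<eta>) = (\<Sum>n<m. 1 - \<eta>)" by simp
  also have "\<dots> \<le> (\<Sum>n<m. f n + c * (\<Sum>k=1..n. r k * f (n - k)))"
  proof (rule sum_mono)
    fix n assume "n \<in> {..<m}"
    then show "1 - \<eta> \<le> f n + c * (\<Sum>k=1..n. r k * f (n - k))"
      using renewal[of n] by (simp add: abs_le_iff)
  qed
  also have "\<dots> = F + c * (\<Sum>n<m. \<Sum>k=1..n. r k * f (n - k))"
    by (simp add: F_def sum.distrib sum_distrib_left)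
  also have "\<dots> \<le> F + c * (Q * F)" by (intro add_left_mono mult_left_mono conv c)
  finally have "real m * (1 - \<eta>) \<le> (1 + c * Q) * F" by (simp add: algebra_simps)
  moreover have pos: "1 + c * Q > 0" using c Q0 by (simp add: add_pos_nonneg)
  ultimately have F: "real m * (1 - \<eta>) / (1 + c * Q) \<le> F"
    by (simp add: divide_le_eq mult.commute)
  have split: "(\<Sum>k=1..2*m. r k * f (2*m - k)) = (\<Sum>k=1..m. r k * f (2*m - k)) + (\<Sum>k=1..m. r (m + k) * f (m - k))"
  proof -
    have "{1..2*m} = {1..m} \<union> {m+1..2*m}" by auto
    then have "(\<Sum>k=1..2*m. r k * f (2*m - k)) = (\<Sum>k=1..m. r k * f (2*m - k)) + (\<Sum>k=m+1..2*m. r k * f (2*m - k))"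
      by (simp add: sum.union_disjoint)
    also have "(\<Sum>k=m+1..2*m. r k * f (2*m - k)) = (\<Sum>k=1..m. r (m + k) * f (m - k))"
      by (rule sum.reindex_bij_witness[of _ "\<lambda>k. m + k" "\<lambda>k. k - m"]) (auto simp: mult_2)
    finally show ?thesis .
  qed
  have first: "(\<Sum>k=1..m. r k * f (2*m - k)) \<le> Q * f m"
  proof -
    have "(\<Sum>k=1..m. r k * f (2*m - k)) \<le> (\<Sum>k=1..m. r k * f m)"
      by (intro sum_mono mult_left_mono dec r) auto
    also have "\<dots> \<le> Q * f m" unfolding sum_distrib_right[symmetric] by (intro mult_right_mono Q nonneg)
    finally show ?thesis .
  qed
  have second: "\<delta> * F \<le> (\<Sum>k=1..m. r k * f (m - k)) - (\<Sum>k=1..m. r (m + k) * f (m - k))"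
    unfolding F_rev[symmetric] sum_distrib_left sum_subtractf[symmetric] left_diff_distrib[symmetric]
    by (intro sum_mono mult_right_mono gap nonneg)
  \<comment> \<open>Monotonicity gives \<open>f m - f (2 * m)\<close> the favourable sign, so only
    the two errors \<open>\<eta>\<close> remain.\<close>
  have "f (2*m) \<le> f m" by (intro dec) auto
  then have "- 2 * \<eta> \<le> c * (\<Sum>k=1..2*m. r k * f (2*m - k)) - c * (\<Sum>k=1..m. r k * f (m - k))"
    using renewal[of "2*m"] renewal[of m] by (simp add: abs_le_iff)
  also have "\<dots> = c * ((\<Sum>k=1..2*m. r k * f (2*m - k)) - (\<Sum>k=1..m. r k * f (m - k)))"
    by (simp add: right_diff_distrib)
  also have "\<dots> \<le> c * (Q * f m - \<delta> * F)"
    using first second split c by (intro mult_left_mono) auto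
  finally have "c * \<delta> * F - 2 * \<eta> \<le> c * Q * f m" by (simp add: algebra_simps)
  moreover have "c * \<delta> * (real m * (1 - \<eta>) / (1 + c * Q)) \<le> c * \<delta> * F"
    using c \<delta> by (intro mult_left_mono F) auto
  ultimately show ?thesis by linarith
qed

section \<open>Renewal bounds applied to the damped walk\<close>

context symmetric_convolution_family
begin

lemma P_mono:
  assumes t: "t \<ge> 0" and f: "continuous_on UNIV f" "\<And>x. \<bar>f x\<bar> \<le> A" and g: "continuous_on UNIV g" "\<And>x. \<bar>g x\<bar> \<le> B"
    and le: "\<And>x. f x \<le> g x"
  shows "P t f x \<le> P t g x"
  unfolding P_def by (intro integral_mono integrable_nu[OF t f] integrable_nu[OF t g] le)

text \<open>A longer walk has one more factor, at most 1. Since \<open>u\<close> is unfolded from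
  the first step, the comparison is carried to the last step by monotonicity of
  \<open>P h\<close>.\<close>

lemma w_decreasing:
  assumes c: "c \<ge> 0" and h: "h > 0" and eps: "\<epsilon> > 0"
  shows "u (damp c h \<epsilon>) h (Suc n) x \<le> u (damp c h \<epsilon>) h n x"
proof (induction n arbitrary: x)
  case 0
  show ?case using abs_w_le[OF c h eps, of "Suc 0" x] by (simp add: abs_le_iff del: u.simps(2))
next
  case (Suc n)
  have cont: "continuous_on UNIV (\<lambda>y. damp c h \<epsilon> y * u (damp c h \<epsilon>) h j y)" for j
    by (intro continuous_intros continuous_on_damp eps continuous_on_w c h)
  have bnd: "\<bar>damp c h \<epsilon> y * u (damp c h \<epsilon>) h j y\<bar> \<le> 1 * 1" for j y
    unfolding abs_mult by (intro mult_mono abs_damp_le abs_w_le c h eps) auto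
  show ?case
    using damp_bounds[OF c less_imp_le[OF h]]
    by (subst (1 2) u.simps(2)) (intro P_mono[OF less_imp_le[OF h] cont bnd cont bnd] mult_left_mono Suc.IH, auto)
qed

lemma w_nonneg:
  assumes c: "c \<ge> 0" and h: "h > 0" and eps: "\<epsilon> > 0"
  shows "0 \<le> u (damp c h \<epsilon>) h n x"
proof (induction n arbitrary: x)
  case (Suc n)
  then show ?case
    using damp_bounds[OF c less_imp_le[OF h]] by (auto simp: P_def intro!: integral_nonneg_AE AE_I2)
qed simp

lemma q_antimono:
  assumes "0 < s" "s \<le> t"
  shows "q t \<le> q s"
proof -
  have "s * \<psi> v \<le> t * \<psi> v" for v using assms psi_nonneg by (intro mult_right_mono) auto
  then show ?thesis
    unfolding q_def using assms by (intro divide_right_mono integral_mono integrable_exp_psi) auto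
qed

text \<open>Convexity of \<open>q\<close>: the gap at \<open>r\<close> is the integral of
  \<open>exp (- r * \<psi> v)\<close> times a nonnegative factor free of \<open>r\<close>. Hence the
  smallest gap over \<open>(0, T]\<close> is \<open>q T - q (2 * T)\<close>.\<close>

lemma q_gap_antimono:
  assumes s: "0 < s" "s \<le> t" and T: "T \<ge> 0"
  shows "q t - q (t + T) \<le> q s - q (s + T)"
proof -
  have eq: "q r - q (r + T) = (LBINT v. exp (- r * \<psi> v) * (1 - exp (- T * \<psi> v))) / (2 * pi)" if "r > 0" for r
  proof -
    have "(LBINT v. exp (- r * \<psi> v)) - (LBINT v. exp (- (r + T) * \<psi> v))
        = (LBINT v. exp (- r * \<psi> v) - exp (- (r + T) * \<psi> v))"
      using that T by (intro Bochner_Integration.integral_diff[symmetric] integrable_exp_psi) auto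
    also have "\<dots> = (LBINT v. exp (- r * \<psi> v) * (1 - exp (- T * \<psi> v)))"
      by (intro Bochner_Integration.integral_cong refl) (simp add: algebra_simps flip: exp_add)
    finally show ?thesis unfolding q_def diff_divide_distrib[symmetric] by simp
  qed
  have b: "\<bar>1 - exp (- T * \<psi> v)\<bar> \<le> 1" "1 - exp (- T * \<psi> v) \<ge> 0" for v
    using T psi_nonneg[of v] by auto
  have i: "integrable lborel (\<lambda>v. exp (- r * \<psi> v) * (1 - exp (- T * \<psi> v)))" if "r > 0" for r
    using integrable_bounded_exp_psi[OF that _ b(1)] by (simp add: mult.commute)
  have "s * \<psi> v \<le> t * \<psi> v" for v using s psi_nonneg by (intro mult_right_mono) auto
  then have "(LBINT v. exp (- t * \<psi> v) * (1 - exp (- T * \<psi> v))) \<le> (LBINT v. exp (- s * \<psi> v) * (1 - exp (- T * \<psi> v)))"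
    using s b by (intro integral_mono i mult_right_mono) auto
  then show ?thesis using s by (simp add: eq divide_right_mono)
qed

text \<open>The null set \<open>{0}\<close> is exempted because \<open>\<psi>\<close> vanishes
  there, and with it the difference of two exponentials.\<close>

lemma integral_pos_off_0:
  fixes g :: "real \<Rightarrow> real"
  assumes i: "integrable lborel g" and g: "\<And>v. v \<noteq> 0 \<Longrightarrow> g v > 0" "g 0 \<ge> 0"
  shows "(LBINT v. g v) > 0"
proof -
  have g0: "g v \<ge> 0" for v using g by (cases "v = 0") (auto intro: less_imp_le)
  have "(LBINT v. g v) \<noteq> 0"
  proof
    assume "(LBINT v. g v) = 0"
    then have "AE v in lborel. g v = 0"
      using integral_nonneg_eq_0_iff_AE[OF i] g0 by simp
    moreover have "AE v in lborel. v \<noteq> (0::real)" by (rule AE_lborel_singleton)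
    ultimately have "AE v in (lborel :: real measure). False"
    proof eventually_elim
      fix v assume "g v = 0" "v \<noteq> 0"
      then show False using g(1)[of v] by simp
    qed
    then show False unfolding eventually_False ae_filter_eq_bot_iff by simp
  qed
  then show ?thesis using g0 integral_nonneg_AE[of g lborel] by (simp add: less_le)
qed

lemma q_pos: "t > 0 \<Longrightarrow> q t > 0"
  unfolding q_def by (intro divide_pos_pos integral_pos_off_0 integrable_exp_psi) auto

lemma q_gap_pos:
  assumes "0 < s" "s < t"
  shows "q t < q s"
proof -
  have "s * \<psi> v < t * \<psi> v" if "v \<noteq> 0" for v using assms psi_pos[OF that] by (intro mult_strict_right_mono) auto
  moreover have "s * \<psi> 0 \<le> t * \<psi> 0" using assms psi_nonneg by (intro mult_right_mono) auto
  ultimately have "(LBINT v. exp (- s * \<psi> v) - exp (- t * \<psi> v)) > 0"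
    using assms by (intro integral_pos_off_0 Bochner_Integration.integrable_diff integrable_exp_psi) auto
  also have "(LBINT v. exp (- s * \<psi> v) - exp (- t * \<psi> v)) = (LBINT v. exp (- s * \<psi> v)) - (LBINT v. exp (- t * \<psi> v))"
    using assms by (intro Bochner_Integration.integral_diff integrable_exp_psi) auto
  finally show ?thesis unfolding q_def by (simp add: divide_strict_right_mono)
qed

text \<open>The grid consisting of the single point \<open>T\<close> already contributes
  \<open>T * q T\<close>.\<close>

lemma Q_pos: "T > 0 \<Longrightarrow> Q T > 0"
  using sum_q_le[of T 1 T] mult_pos_pos[OF _ q_pos, of T T] by simp

text \<open>The kernel is \<open>r k = h * q (k * h)\<close> on \<open>2 * m\<close> steps, hence
  the horizon \<open>2 * T\<close> in the error and in \<open>Q\<close>. The mesh cancels in the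
  lower bound: the gap carries the factor \<open>h\<close>, the sum of \<open>f\<close> the factor
  \<open>m\<close>, and \<open>m * h = T\<close>.\<close>

lemma
  fixes m :: nat
  assumes c: "c \<ge> 0" and T: "T > 0" and m: "m > 0" and eps: "\<epsilon> > 0"
  defines "h \<equiv> T / real m"
  defines "\<eta> \<equiv> walk_error c h \<epsilon> (2 * T)"
  shows w_upper_bound: "c * (T * q T) * u (damp c h \<epsilon>) h m 0 \<le> 1 + \<eta>"
    and w_lower_bound: "c * (q T - q (2 * T)) * (T * (1 - \<eta>) / (1 + c * Q (2 * T))) - 2 * \<eta>
      \<le> c * Q (2 * T) * u (damp c h \<epsilon>) h m 0"
proof -
  have h: "h > 0" and mh: "real m * h = T" using T m by (auto simp: h_def)
  define r where "r k = h * q (real k * h)" for k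
  let ?f = "\<lambda>n. u (damp c h \<epsilon>) h n 0"
  have r0: "0 \<le> r k" for k unfolding r_def using h q_nonneg by simp
  have dec: "?f j \<le> ?f i" if "i \<le> j" for i j
    using lift_Suc_antimono_le[of ?f, OF w_decreasing[OF c h eps] that] .
  have nn: "0 \<le> ?f i" for i by (rule w_nonneg[OF c h eps])
  have ren: "\<bar>?f n - 1 + c * (\<Sum>k=1..n. r k * ?f (n - k))\<bar> \<le> \<eta>" if "n \<le> 2 * m" for n
  proof -
    have "real n * h \<le> real (2 * m) * h" using that h by (intro mult_right_mono) (auto simp del: of_nat_mult)
    then have "real n * h \<le> 2 * T" using mh by simp
    from w_approx_renewal[OF c h eps this] show ?thesis by (simp add: r_def \<eta>_def)
  qed
  have Q: "(\<Sum>k=1..m. r k) \<le> Q (2 * T)"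
    unfolding r_def using mh T by (intro sum_q_le h) auto
  have low: "T * q T \<le> (\<Sum>k=1..m. r k)"
  proof -
    have "(\<Sum>k=1..m. h * q T) \<le> (\<Sum>k=1..m. r k)"
      unfolding r_def
    proof (intro sum_mono mult_left_mono q_antimono)
      fix k assume k: "k \<in> {1..m}"
      then show "0 < real k * h" using h by simp
      show "real k * h \<le> T" unfolding mh[symmetric] using k h by (intro mult_right_mono) auto
    qed (use h in auto)
    then show ?thesis unfolding mh[symmetric] by (simp add: mult.assoc)
  qed
  have "c * (T * q T) * ?f m \<le> c * (\<Sum>k=1..m. r k) * ?f m"
    by (intro mult_right_mono mult_left_mono low c nn)
  also have "\<dots> \<le> 1 + \<eta>"
    by (rule renewal_upper_bound[OF dec nn r0 c ren]) auto
  finally show "c * (T * q T) * ?f m \<le> 1 + \<eta>" .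
  have gap: "h * (q T - q (2 * T)) \<le> r k - r (m + k)" if k: "k \<in> {1..m}" for k
  proof -
    have "real k * h \<le> T" unfolding mh[symmetric] using k h by (intro mult_right_mono) auto
    then have "q T - q (T + T) \<le> q (real k * h) - q (real k * h + T)"
      using k h T by (intro q_gap_antimono) auto
    moreover have "real (m + k) * h = real k * h + T" using mh by (simp add: algebra_simps)
    ultimately have "h * (q T - q (2 * T)) \<le> h * (q (real k * h) - q (real (m + k) * h))"
      using h by (intro mult_left_mono) auto
    then show ?thesis by (simp add: r_def right_diff_distrib)
  qed
  have \<delta>: "h * (q T - q (2 * T)) \<ge> 0" using h T q_antimono[of T "2 * T"] by simp
  from renewal_lower_bound[OF dec nn r0 c ren Q gap \<delta>]
  have "c * (h * (q T - q (2 * T))) * (real m * (1 - \<eta>) / (1 + c * Q (2 * T))) - 2 * \<eta> \<le> c * Q (2 * T) * ?f m"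
    by simp
  moreover have "c * (h * (q T - q (2 * T))) * (real m * (1 - \<eta>) / (1 + c * Q (2 * T)))
     = c * (q T - q (2 * T)) * ((real m * h) * (1 - \<eta>) / (1 + c * Q (2 * T)))"
    by simp
  ultimately show "c * (q T - q (2 * T)) * (T * (1 - \<eta>) / (1 + c * Q (2 * T))) - 2 * \<eta> \<le> c * Q (2 * T) * ?f m"
    unfolding mh by (simp only:)
qed

end

subsection \<open>Independence from conditional characteristic functions\<close>

text \<open>Unlike the library's \<open>indep_var\<close>, this allows the two variables to have different value types.\<close>

definition product_law :: "'a measure \<Rightarrow> 'b measure \<Rightarrow> ('a \<Rightarrow> 'b) \<Rightarrow> 'c measure \<Rightarrow> ('a \<Rightarrow> 'c) \<Rightarrow> bool" where
  "product_law M S J T \<xi> \<longleftrightarrow> J \<in> measurable M S \<and> \<xi> \<in> measurable M T \<and>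
     distr M S J \<Otimes>\<^sub>M distr M T \<xi> = distr M (S \<Otimes>\<^sub>M T) (\<lambda>\<omega>. (J \<omega>, \<xi> \<omega>))"

lemma set_integral_iexp_of_cond_char:
  fixes \<phi> :: complex
  assumes "prob_space M" and sub: "subalgebra M G" and [measurable]: "\<xi> \<in> borel_measurable M"
    and cond: "AE \<omega> in M. complex_cond_exp M G (\<lambda>\<omega>. iexp (u * \<xi> \<omega>)) \<omega> = \<phi>"
    and A: "A \<in> sets G"
  shows "(LINT \<omega>|M. indicator A \<omega> *\<^sub>R iexp (u * \<xi> \<omega>)) = measure M A * \<phi>"
proof -
  interpret prob_space M by fact
  interpret finite_measure_subalgebra M G
    by unfold_locales (rule sub)
  have [measurable]: "A \<in> sets M" using A sub by (auto simp: subalgebra_def)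
  have i: "integrable M (\<lambda>\<omega>. iexp (u * \<xi> \<omega>))"
    by (rule integrable_const_bound[of _ 1]) auto
  have iA: "integrable M (\<lambda>\<omega>. indicator A \<omega> *\<^sub>R iexp (u * \<xi> \<omega>))"
    by (rule integrable_const_bound[of _ 1]) (auto split: split_indicator)
  have part: "(LINT \<omega>|M. indicator A \<omega> * f \<omega>) = measure M A * c"
    if f: "integrable M f" and c: "AE \<omega> in M. real_cond_exp M G f \<omega> = c" for f :: "'a \<Rightarrow> real" and c
  proof -
    have "(LINT \<omega>|M. indicator A \<omega> * f \<omega>) = (LINT \<omega>:A|M. real_cond_exp M G f \<omega>)"
      using real_cond_exp_intA[OF f A] by (simp add: set_lebesgue_integral_def)
    also have "\<dots> = (LINT \<omega>|M. indicator A \<omega> * c)"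
      unfolding set_lebesgue_integral_def using c by (intro integral_cong_AE) auto
    finally show ?thesis by simp
  qed
  have Re: "(LINT \<omega>|M. indicator A \<omega> * Re (iexp (u * \<xi> \<omega>))) = measure M A * Re \<phi>"
    using cond by (intro part integrable_Re i) (auto simp: complex_cond_exp_def complex_eq_iff)
  have Im: "(LINT \<omega>|M. indicator A \<omega> * Im (iexp (u * \<xi> \<omega>))) = measure M A * Im \<phi>"
    using cond by (intro part integrable_Im i) (auto simp: complex_cond_exp_def complex_eq_iff)
  show ?thesis
    using Re Im integral_Re[OF iA] integral_Im[OF iA] by (simp add: complex_eq_iff)
qed

text \<open>Conditioned on an event of \<open>G\<close> with positive probability,
  \<open>\<xi>\<close> still has the characteristic function \<open>\<phi>\<close>. By Levy's
  uniqueness theorem its law is the same as without conditioning, which is independence of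
  \<open>G\<close>.\<close>

lemma product_law_of_cond_char:
  fixes \<phi> :: "real \<Rightarrow> complex"
  assumes "prob_space M" and sub: "subalgebra M G" and \<xi>[measurable]: "\<xi> \<in> borel_measurable M"
    and cond: "\<And>u. AE \<omega> in M. complex_cond_exp M G (\<lambda>\<omega>. iexp (u * \<xi> \<omega>)) \<omega> = \<phi> u"
    and J: "J \<in> measurable G S"
  shows "product_law M S J borel \<xi>" and "char (distr M borel \<xi>) u = \<phi> u"
proof -
  interpret prob_space M by fact
  note int = set_integral_iexp_of_cond_char[OF \<open>prob_space M\<close> sub \<xi> cond]
  have space: "space M \<in> sets G" using sub sets.top[of G] by (auto simp: subalgebra_def)
  have ch: "char (distr M borel \<xi>) u = \<phi> u" for u
  proof -
    have "char (distr M borel \<xi>) u = (LINT \<omega>|M. indicator (space M) \<omega> *\<^sub>R iexp (u * \<xi> \<omega>))"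
      unfolding char_def by (subst integral_distr) (auto intro!: Bochner_Integration.integral_cong)
    then show ?thesis using int[OF space] prob_space by simp
  qed
  then show "char (distr M borel \<xi>) u = \<phi> u" .
  have rd: "real_distribution (distr M borel \<xi>)"
    by (simp add: real_distribution_def real_distribution_axioms_def prob_space_distr)
  have prod: "prob (A \<inter> (\<xi> -` B \<inter> space M)) = prob A * prob (\<xi> -` B \<inter> space M)"
    if A: "A \<in> sets G" and [measurable]: "B \<in> sets borel" for A B
  proof (cases "prob A = 0")
    case True
    have AM: "A \<in> sets M" using A sub by (auto simp: subalgebra_def)
    have "prob (A \<inter> (\<xi> -` B \<inter> space M)) \<le> prob A" by (intro finite_measure_mono AM) auto
    then show ?thesis using True measure_nonneg[of M "A \<inter> (\<xi> -` B \<inter> space M)"] by simp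
  next
    case False
    have AM[measurable]: "A \<in> sets M" using A sub by (auto simp: subalgebra_def)
    have pA: "prob A > 0" using False by (simp add: zero_less_measure_iff)
    \<comment> \<open>\<open>N\<close> is the conditional probability given \<open>A\<close>; null
      events are set apart because of the normalisation.\<close>
    define N where "N = uniform_measure M A"
    have N: "N = density M (\<lambda>\<omega>. ennreal (indicator A \<omega> / prob A))"
      unfolding N_def uniform_measure_def
      by (intro density_cong) (auto simp: emeasure_eq_measure divide_ennreal[symmetric] pA ennreal_indicator)
    have sets_N[measurable_cong]: "sets N = sets M" by (simp add: N_def)
    interpret N: prob_space N
      unfolding N_def using pA by (intro prob_space_uniform_measure) (auto simp: emeasure_eq_measure)
    have \<xi>N[measurable]: "\<xi> \<in> borel_measurable N" by measurable
    have "distr N borel \<xi> = distr M borel \<xi>"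
    proof (rule Levy_uniqueness[OF _ rd])
      show "real_distribution (distr N borel \<xi>)"
        by (simp add: real_distribution_def real_distribution_axioms_def N.prob_space_distr)
      show "char (distr N borel \<xi>) = char (distr M borel \<xi>)"
      proof
        fix u
        have "char (distr N borel \<xi>) u = (LINT \<omega>|N. iexp (u * \<xi> \<omega>))"
          unfolding char_def by (subst integral_distr) auto
        also have "\<dots> = (LINT \<omega>|M. (indicator A \<omega> / prob A) *\<^sub>R iexp (u * \<xi> \<omega>))"
          unfolding N by (subst integral_density) (auto simp: divide_nonneg_nonneg)
        also have "\<dots> = (LINT \<omega>|M. (1 / prob A) *\<^sub>R (indicator A \<omega> *\<^sub>R iexp (u * \<xi> \<omega>)))"
          by (intro Bochner_Integration.integral_cong) auto
        also have "\<dots> = (1 / prob A) *\<^sub>R (prob A * \<phi> u)"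
          by (subst integral_scaleR_right) (use int[OF A] in auto)
        also have "\<dots> = \<phi> u" using False by (simp add: scaleR_conv_of_real)
        finally show "char (distr N borel \<xi>) u = char (distr M borel \<xi>) u" using ch by simp
      qed
    qed
    then have "measure (distr N borel \<xi>) B = measure (distr M borel \<xi>) B" by simp
    then have "measure N (\<xi> -` B \<inter> space M) = prob (\<xi> -` B \<inter> space M)"
      by (simp add: measure_distr N_def)
    moreover have "measure N (\<xi> -` B \<inter> space M) = prob (A \<inter> (\<xi> -` B \<inter> space M)) / prob A"
      unfolding N_def using pA by (subst measure_uniform_measure) (auto simp: emeasure_eq_measure)
    ultimately show ?thesis using pA by (simp add: field_simps)
  qed
  have JM[measurable]: "J \<in> measurable M S" using sub J by (rule measurable_from_subalg)
  have "distr M S J \<Otimes>\<^sub>M distr M borel \<xi> = distr M (S \<Otimes>\<^sub>M borel) (\<lambda>\<omega>. (J \<omega>, \<xi> \<omega>))"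
  proof (rule pair_measure_eqI)
    show "sigma_finite_measure (distr M S J)" "sigma_finite_measure (distr M borel \<xi>)"
      by (intro prob_space_imp_sigma_finite prob_space_distr; simp)+
    fix A B assume "A \<in> sets (distr M S J)" "B \<in> sets (distr M borel \<xi>)"
    then have [measurable]: "A \<in> sets S" "B \<in> sets borel" by auto
    have sp: "space G = space M" using sub by (simp add: subalgebra_def)
    have "J -` A \<inter> space M \<in> sets G" using measurable_sets[OF J, of A] sp by simp
    from prod[OF this, of B]
    have "prob ((J -` A \<inter> space M) \<inter> (\<xi> -` B \<inter> space M)) = prob (J -` A \<inter> space M) * prob (\<xi> -` B \<inter> space M)"
      by simp
    moreover have "(\<lambda>\<omega>. (J \<omega>, \<xi> \<omega>)) -` (A \<times> B) \<inter> space M = (J -` A \<inter> space M) \<inter> (\<xi> -` B \<inter> space M)"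
      by auto
    ultimately show "emeasure (distr M S J) A * emeasure (distr M borel \<xi>) B
        = emeasure (distr M (S \<Otimes>\<^sub>M borel) (\<lambda>\<omega>. (J \<omega>, \<xi> \<omega>))) (A \<times> B)"
      by (simp add: emeasure_distr emeasure_eq_measure ennreal_mult)
  qed auto
  then show "product_law M S J borel \<xi>"
    unfolding product_law_def by simp
qed

text \<open>\<open>A\<close> and \<open>B\<close> stand for the pasts of the two processes,
  \<open>C\<close> and \<open>D\<close> for their next increments. The filtration controls each
  increment given the past, but not the two increments jointly; their joint law comes from the
  independence of the processes, by regrouping a fourfold product law.\<close>

lemma (in prob_space) product_law_interchange:
  assumes AC: "product_law M S1 A T1 C" and BD: "product_law M S2 B T2 D"
    and joint: "product_law M (S1 \<Otimes>\<^sub>M T1) (\<lambda>\<omega>. (A \<omega>, C \<omega>)) (S2 \<Otimes>\<^sub>M T2) (\<lambda>\<omega>. (B \<omega>, D \<omega>))"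
  shows "product_law M (S1 \<Otimes>\<^sub>M S2) (\<lambda>\<omega>. (A \<omega>, B \<omega>)) (T1 \<Otimes>\<^sub>M T2) (\<lambda>\<omega>. (C \<omega>, D \<omega>))"
proof -
  have [measurable]: "random_variable S1 A" "random_variable T1 C" "random_variable S2 B" "random_variable T2 D"
    using AC BD by (auto simp: product_law_def)
  define a b c d where "a = distr M S1 A" and "b = distr M S2 B" and "c = distr M T1 C" and "d = distr M T2 D"
  have prob: "prob_space a" "prob_space b" "prob_space c" "prob_space d"
    unfolding a_def b_def c_def d_def by (intro prob_space_distr; simp)+
  interpret a: prob_space a by fact
  interpret b: prob_space b by fact
  interpret c: prob_space c by fact
  interpret d: prob_space d by fact
  interpret ac: pair_prob_space a c ..
  interpret bd: pair_prob_space b d ..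
  note defs = a_def b_def c_def d_def
  have [measurable_cong]: "sets a = sets S1" "sets b = sets S2" "sets c = sets T1" "sets d = sets T2"
    by (simp_all add: defs)
  have law: "distr M ((S1 \<Otimes>\<^sub>M T1) \<Otimes>\<^sub>M (S2 \<Otimes>\<^sub>M T2)) (\<lambda>\<omega>. ((A \<omega>, C \<omega>), (B \<omega>, D \<omega>))) = (a \<Otimes>\<^sub>M c) \<Otimes>\<^sub>M (b \<Otimes>\<^sub>M d)"
    using AC BD joint unfolding product_law_def defs by simp
  \<comment> \<open>Tonelli on the fourfold product: the integrand splits into a function of the
    pasts and one of the increments.\<close>
  have nn: "(\<integral>\<^sup>+\<omega>. f (A \<omega>, B \<omega>) * g (C \<omega>, D \<omega>) \<partial>M) = (\<integral>\<^sup>+x. \<integral>\<^sup>+y. f (x, y) \<partial>b \<partial>a) * (\<integral>\<^sup>+u. \<integral>\<^sup>+v. g (u, v) \<partial>d \<partial>c)"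
    if [measurable]: "f \<in> borel_measurable (S1 \<Otimes>\<^sub>M S2)" "g \<in> borel_measurable (T1 \<Otimes>\<^sub>M T2)"
    for f :: "_ \<Rightarrow> ennreal" and g :: "_ \<Rightarrow> ennreal"
  proof -
    define h where "h p = f (fst (fst p), fst (snd p)) * g (snd (fst p), snd (snd p))" for p
    have [measurable]: "h \<in> borel_measurable ((a \<Otimes>\<^sub>M c) \<Otimes>\<^sub>M (b \<Otimes>\<^sub>M d))"
      unfolding h_def[abs_def] by measurable
    have [measurable]: "h \<in> borel_measurable ((S1 \<Otimes>\<^sub>M T1) \<Otimes>\<^sub>M (S2 \<Otimes>\<^sub>M T2))"
      unfolding h_def[abs_def] by measurable
    have "(\<integral>\<^sup>+\<omega>. f (A \<omega>, B \<omega>) * g (C \<omega>, D \<omega>) \<partial>M) = (\<integral>\<^sup>+\<omega>. h ((A \<omega>, C \<omega>), (B \<omega>, D \<omega>)) \<partial>M)"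
      by (simp add: h_def)
    also have "\<dots> = (\<integral>\<^sup>+p. h p \<partial>((a \<Otimes>\<^sub>M c) \<Otimes>\<^sub>M (b \<Otimes>\<^sub>M d)))"
      unfolding law[symmetric] by (subst nn_integral_distr) auto
    also have "\<dots> = (\<integral>\<^sup>+s. \<integral>\<^sup>+t. h (s, t) \<partial>(b \<Otimes>\<^sub>M d) \<partial>(a \<Otimes>\<^sub>M c))"
      by (rule sigma_finite_measure.nn_integral_fst[OF bd.P.sigma_finite_measure_axioms, symmetric]) simp
    also have "\<dots> = (\<integral>\<^sup>+x. \<integral>\<^sup>+u. \<integral>\<^sup>+t. h ((x, u), t) \<partial>(b \<Otimes>\<^sub>M d) \<partial>c \<partial>a)"
      by (rule c.nn_integral_fst[symmetric]) simp
    also have "\<dots> = (\<integral>\<^sup>+x. \<integral>\<^sup>+u. \<integral>\<^sup>+y. \<integral>\<^sup>+v. h ((x, u), (y, v)) \<partial>d \<partial>b \<partial>c \<partial>a)"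
      by (intro nn_integral_cong d.nn_integral_fst[symmetric]) simp
    also have "\<dots> = (\<integral>\<^sup>+x. \<integral>\<^sup>+u. (\<integral>\<^sup>+y. f (x, y) \<partial>b) * (\<integral>\<^sup>+v. g (u, v) \<partial>d) \<partial>c \<partial>a)"
    proof (intro nn_integral_cong)
      fix x u assume x: "x \<in> space a" and u: "u \<in> space c"
      have [measurable]: "(\<lambda>y. f (x, y)) \<in> borel_measurable b" "(\<lambda>v. g (u, v)) \<in> borel_measurable d"
        using x u by (auto intro!: measurable_Pair2[of _ S1 S2] measurable_Pair2[of _ T1 T2]
            simp: defs cong: measurable_cong_sets)
      show "(\<integral>\<^sup>+y. \<integral>\<^sup>+v. h ((x, u), (y, v)) \<partial>d \<partial>b) = (\<integral>\<^sup>+y. f (x, y) \<partial>b) * (\<integral>\<^sup>+v. g (u, v) \<partial>d)"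
        by (simp add: h_def nn_integral_cmult nn_integral_multc)
    qed
    also have "\<dots> = (\<integral>\<^sup>+x. \<integral>\<^sup>+y. f (x, y) \<partial>b \<partial>a) * (\<integral>\<^sup>+u. \<integral>\<^sup>+v. g (u, v) \<partial>d \<partial>c)"
      by (simp add: nn_integral_cmult nn_integral_multc)
    finally show ?thesis .
  qed
  have "distr M (S1 \<Otimes>\<^sub>M S2) (\<lambda>\<omega>. (A \<omega>, B \<omega>)) \<Otimes>\<^sub>M distr M (T1 \<Otimes>\<^sub>M T2) (\<lambda>\<omega>. (C \<omega>, D \<omega>))
      = distr M ((S1 \<Otimes>\<^sub>M S2) \<Otimes>\<^sub>M (T1 \<Otimes>\<^sub>M T2)) (\<lambda>\<omega>. ((A \<omega>, B \<omega>), (C \<omega>, D \<omega>)))" (is "?L \<Otimes>\<^sub>M ?R = ?J")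
  proof (rule pair_measure_eqI)
    show "sigma_finite_measure ?L" "sigma_finite_measure ?R"
      by (intro prob_space_imp_sigma_finite prob_space_distr; simp)+
    fix E F assume "E \<in> sets ?L" "F \<in> sets ?R"
    then have [measurable]: "E \<in> sets (S1 \<Otimes>\<^sub>M S2)" "F \<in> sets (T1 \<Otimes>\<^sub>M T2)" by auto
    have one: "(\<integral>\<^sup>+x. \<integral>\<^sup>+y. 1 \<partial>b \<partial>a) = (1::ennreal)" "(\<integral>\<^sup>+u. \<integral>\<^sup>+v. 1 \<partial>d \<partial>c) = (1::ennreal)"
      by (simp_all add: a.emeasure_space_1 b.emeasure_space_1 c.emeasure_space_1 d.emeasure_space_1)
    have L: "emeasure ?L E = (\<integral>\<^sup>+x. \<integral>\<^sup>+y. indicator E (x, y) \<partial>b \<partial>a)"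
      using nn[of "indicator E" "\<lambda>_. 1"] one
      by (subst nn_integral_indicator[symmetric], simp, subst nn_integral_distr) auto
    have R: "emeasure ?R F = (\<integral>\<^sup>+u. \<integral>\<^sup>+v. indicator F (u, v) \<partial>d \<partial>c)"
      using nn[of "\<lambda>_. 1" "indicator F"] one
      by (subst nn_integral_indicator[symmetric], simp, subst nn_integral_distr) auto
    have "emeasure ?J (E \<times> F) = (\<integral>\<^sup>+\<omega>. indicator (E \<times> F) ((A \<omega>, B \<omega>), (C \<omega>, D \<omega>)) \<partial>M)"
      by (subst nn_integral_indicator[symmetric], simp, subst nn_integral_distr) auto
    also have "\<dots> = (\<integral>\<^sup>+\<omega>. indicator E (A \<omega>, B \<omega>) * indicator F (C \<omega>, D \<omega>) \<partial>M)"
      by (simp add: indicator_times)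
    also have "\<dots> = emeasure ?L E * emeasure ?R F"
      unfolding L R by (rule nn) auto
    finally show "emeasure ?L E * emeasure ?R F = emeasure ?J (E \<times> F)" ..
  qed auto
  then show ?thesis
    unfolding product_law_def by simp
qed

lemma (in prob_space) product_law_integral:
  fixes \<Phi> :: "'b \<times> 'c \<Rightarrow> real"
  assumes ind: "product_law M S J T \<xi>" and [measurable]: "\<Phi> \<in> borel_measurable (S \<Otimes>\<^sub>M T)" and B: "\<And>p. \<bar>\<Phi> p\<bar> \<le> B"
  shows "(LINT \<omega>|M. \<Phi> (J \<omega>, \<xi> \<omega>)) = (LINT \<omega>|M. LINT z|distr M T \<xi>. \<Phi> (J \<omega>, z))"
proof -
  have [measurable]: "random_variable S J" "random_variable T \<xi>"
    using ind by (auto simp: product_law_def)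
  have law: "distr M S J \<Otimes>\<^sub>M distr M T \<xi> = distr M (S \<Otimes>\<^sub>M T) (\<lambda>\<omega>. (J \<omega>, \<xi> \<omega>))"
    using ind unfolding product_law_def by simp
  interpret J: prob_space "distr M S J" by (rule prob_space_distr) simp
  interpret X: prob_space "distr M T \<xi>" by (rule prob_space_distr) simp
  interpret pair_prob_space "distr M S J" "distr M T \<xi>" ..
  have "(LINT \<omega>|M. \<Phi> (J \<omega>, \<xi> \<omega>)) = (LINT p|(distr M S J \<Otimes>\<^sub>M distr M T \<xi>). \<Phi> p)"
    unfolding law by (subst integral_distr) auto
  also have "\<dots> = (LINT x|distr M S J. LINT z|distr M T \<xi>. \<Phi> (x, z))"
    by (rule integral_fst'[symmetric], rule integrable_const_bound[of _ B]) (use B in auto)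
  also have "\<dots> = (LINT \<omega>|M. LINT z|distr M T \<xi>. \<Phi> (J \<omega>, z))"
    by (subst integral_distr) auto
  finally show ?thesis .
qed

subsection \<open>Symmetric stable processes on a grid\<close>

text \<open>The comparison function \<open>2 powr a * (1 + \<bar>v\<bar>) powr (- a)\<close> has an
  explicit antiderivative on the half-line that is smooth at \<open>0\<close>; the constant stems
  from \<open>1 + x \<le> 2 * max 1 x\<close>.\<close>

lemma integrable_inverse_one_plus_powr:
  fixes a :: real
  assumes a: "a > 1"
  shows "integrable lborel (\<lambda>v. 1 / (1 + \<bar>v\<bar> powr a))"
proof -
  define f where "f v = 2 powr a * (1 + v) powr (- a)" for v :: real
  define g where "g v = f \<bar>v\<bar>" for v :: real
  have f0: "0 \<le> f v" for v by (simp add: f_def)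
  have [measurable]: "f \<in> borel_measurable borel" unfolding f_def[abs_def] by measurable
  have [measurable]: "g \<in> borel_measurable borel" unfolding g_def[abs_def] by measurable
  \<comment> \<open>Coefficient of the antiderivative; it is negative because \<open>a > 1\<close>,
    and the integral over the half-line is \<open>- c\<close>.\<close>
  define c where "c = 2 powr a / (1 - a)"
  have "(\<integral>\<^sup>+v. ennreal (f v) * indicator {0..} v \<partial>lborel) = ennreal (0 - c * (1 + 0) powr (1 - a))"
  proof (rule nn_integral_FTC_atLeast)
    fix v :: real assume v: "0 \<le> v"
    have "((\<lambda>v. (1 + v) powr (1 - a)) has_real_derivative (1 - a) * (1 + v) powr (1 - a - 1)) (at v)"
      using v by (auto intro!: derivative_eq_intros)
    then have "((\<lambda>v. c * (1 + v) powr (1 - a)) has_real_derivative c * ((1 - a) * (1 + v) powr (1 - a - 1))) (at v)"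
      by (rule DERIV_cmult)
    then show "((\<lambda>v. c * (1 + v) powr (1 - a)) has_real_derivative f v) (at v)"
      using a by (simp add: c_def f_def)
  next
    have "((\<lambda>v::real. (1 + v) powr (1 - a)) \<longlongrightarrow> 0) at_top"
      using a by (intro tendsto_neg_powr filterlim_tendsto_add_at_top[OF tendsto_const filterlim_ident]) auto
    then have "((\<lambda>v. c * (1 + v) powr (1 - a)) \<longlongrightarrow> c * 0) at_top"
      by (intro tendsto_intros)
    then show "((\<lambda>v. c * (1 + v) powr (1 - a)) \<longlongrightarrow> 0) at_top" by simp
  qed (auto simp: f0)
  then have fin: "(\<integral>\<^sup>+v. ennreal (f v) * indicator {0..} v \<partial>lborel) < \<infinity>" by simp
  have "(\<lambda>v. f v * indicator {0..} v) \<in> borel_measurable lborel" by measurable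
  then have i: "integrable lborel (\<lambda>v. f v * indicator {0..} v)"
    using fin f0 by (intro integrableI_bounded) (auto simp: ennreal_mult ennreal_indicator abs_mult)
  have i2: "integrable lborel (\<lambda>v. f (- v) * indicator {0..} (- v))"
    using lborel_integrable_real_affine[OF i, of "-1" 0] by simp
  have ig: "integrable lborel (\<lambda>v. f v * indicator {0..} v + f (- v) * indicator {0..} (- v))"
    by (rule Bochner_Integration.integrable_add[OF i i2])
  show ?thesis
  proof (rule integrable_dominated[OF ig])
    fix v :: real
    have *: "1 / (1 + x powr a) \<le> f x" if x: "x \<ge> 0" for x
    proof -
      have "(1 + x) powr a \<le> 2 powr a * (1 + x powr a)"
      proof (cases "x \<le> 1")
        case True
        have "(1 + x) powr a \<le> 2 powr a" using True x a by (intro powr_mono2) auto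
        also have "\<dots> \<le> 2 powr a * (1 + x powr a)" by (simp add: algebra_simps)
        finally show ?thesis .
      next
        case False
        have "(1 + x) powr a \<le> (2 * x) powr a" using False a by (intro powr_mono2) auto
        also have "\<dots> = 2 powr a * x powr a" using x by (simp add: powr_mult)
        also have "\<dots> \<le> 2 powr a * (1 + x powr a)" by simp
        finally show ?thesis .
      qed
      moreover have "1 + x powr a > 0" by (simp add: add_pos_nonneg)
      moreover have "(1 + x) powr a > 0" using x by simp
      ultimately show ?thesis by (simp add: f_def powr_minus field_simps)
    qed
    have "\<bar>1 / (1 + \<bar>v\<bar> powr a)\<bar> = 1 / (1 + \<bar>v\<bar> powr a)" by (simp add: add_nonneg_nonneg)
    also have "\<dots> \<le> f \<bar>v\<bar>" by (rule *) simp
    also have "\<dots> \<le> f v * indicator {0..} v + f (- v) * indicator {0..} (- v)"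
      using f0 by (auto split: split_indicator simp: abs_if)
    finally show "\<bar>1 / (1 + \<bar>v\<bar> powr a)\<bar> \<le> f v * indicator {0..} v + f (- v) * indicator {0..} (- v)" .
  qed measurable
qed

locale stable_pair = prob_space M for M :: "'a measure" +
  fixes F :: "real \<Rightarrow> 'a measure" and X Y :: "real \<Rightarrow> 'a \<Rightarrow> real" and \<alpha>\<^sub>1 \<alpha>\<^sub>2 :: real
  assumes filt: "filtration_nonneg M F"
    and X: "symmetric_stable_process M F \<alpha>\<^sub>1 X"
    and Y: "symmetric_stable_process M F \<alpha>\<^sub>2 Y"
    and index: "max \<alpha>\<^sub>1 \<alpha>\<^sub>2 > 1"
    and indep: "indep_processes M X Y"
begin

definition Z :: "real \<Rightarrow> 'a \<Rightarrow> real" where "Z t \<omega> = X t \<omega> - Y t \<omega>"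
definition \<psi> :: "real \<Rightarrow> real" where "\<psi> v = \<bar>v\<bar> powr \<alpha>\<^sub>1 + \<bar>v\<bar> powr \<alpha>\<^sub>2"
definition \<nu> :: "real \<Rightarrow> real measure" where "\<nu> t = distr M borel (Z t)"

lemma stable_adapted:
  assumes "symmetric_stable_process M F \<alpha> W" "0 \<le> r" "r \<le> s"
  shows "W r \<in> borel_measurable (F s)"
proof -
  have "subalgebra (F s) (F r)" using filt assms(2,3) by (auto simp: filtration_nonneg_def)
  moreover have "W r \<in> borel_measurable (F r)" using assms by (auto simp: symmetric_stable_process_def)
  ultimately show ?thesis by (rule measurable_from_subalg)
qed

lemma stable_measurable:
  assumes "symmetric_stable_process M F \<alpha> W" "0 \<le> r"
  shows "W r \<in> borel_measurable M"
proof -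
  have "subalgebra M (F r)" using filt assms(2) by (auto simp: filtration_nonneg_def)
  moreover have "W r \<in> borel_measurable (F r)" using assms by (auto simp: symmetric_stable_process_def)
  ultimately show ?thesis by (rule measurable_from_subalg)
qed

lemmas X_measurable [measurable (raw)] = stable_measurable[OF X]
lemmas Y_measurable [measurable (raw)] = stable_measurable[OF Y]

lemma Z_measurable [measurable (raw)]: "0 \<le> t \<Longrightarrow> Z t \<in> borel_measurable M"
  unfolding Z_def[abs_def] using X_measurable Y_measurable by (intro borel_measurable_diff)

lemma Z_0: "\<omega> \<in> space M \<Longrightarrow> Z 0 \<omega> = 0"
  using X Y by (simp add: Z_def symmetric_stable_process_def)

lemma stable_increment:
  assumes W: "symmetric_stable_process M F \<alpha> W" and st: "0 \<le> s" "s < t"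
  shows "char (distr M borel (\<lambda>\<omega>. W t \<omega> - W s \<omega>)) u = complex_of_real (exp (- (t - s) * \<bar>u\<bar> powr \<alpha>))"
    and "J \<in> measurable (F s) S \<Longrightarrow> product_law M S J borel (\<lambda>\<omega>. W t \<omega> - W s \<omega>)"
proof -
  have sub: "subalgebra M (F s)" using filt st by (auto simp: filtration_nonneg_def)
  have [measurable]: "W t \<in> borel_measurable M" "W s \<in> borel_measurable M"
    using st by (auto intro!: stable_measurable[OF W])
  have m: "(\<lambda>\<omega>. W t \<omega> - W s \<omega>) \<in> borel_measurable M" by measurable
  have cond: "AE \<omega> in M. complex_cond_exp M (F s) (\<lambda>\<omega>. iexp (u * (W t \<omega> - W s \<omega>))) \<omega>
                     = complex_of_real (exp (- (t - s) * \<bar>u\<bar> powr \<alpha>))" for u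
    using W st unfolding symmetric_stable_process_def by blast
  show "char (distr M borel (\<lambda>\<omega>. W t \<omega> - W s \<omega>)) u = complex_of_real (exp (- (t - s) * \<bar>u\<bar> powr \<alpha>))"
    by (rule product_law_of_cond_char(2)[OF prob_space_axioms sub m cond, of id "F s"]) simp
  show "J \<in> measurable (F s) S \<Longrightarrow> product_law M S J borel (\<lambda>\<omega>. W t \<omega> - W s \<omega>)"
    by (rule product_law_of_cond_char(1)[OF prob_space_axioms sub m cond])
qed

lemma indep_var_functionals:
  assumes f: "f \<in> measurable (PiM {0..} (\<lambda>_. borel)) N1" and g: "g \<in> measurable (PiM {0..} (\<lambda>_. borel)) N2"
  shows "indep_var N1 (\<lambda>\<omega>. f (\<lambda>t\<in>{0..}. X t \<omega>)) N2 (\<lambda>\<omega>. g (\<lambda>t\<in>{0..}. Y t \<omega>))"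
  using indep_var_compose[OF indep[unfolded indep_processes_def] f g] by (simp add: comp_def)

lemma char_Z_increment:
  assumes st: "0 \<le> s" "s < t"
  shows "char (distr M borel (\<lambda>\<omega>. Z t \<omega> - Z s \<omega>)) u = complex_of_real (exp (- (t - s) * \<psi> u))"
proof -
  have t: "0 \<le> t" using st by simp
  have comp: "(\<lambda>x. x r) \<in> borel_measurable (PiM {0..} (\<lambda>_. borel))" if "0 \<le> r" for r :: real
    using that by (intro measurable_component_singleton) auto
  have [measurable]: "X t \<in> borel_measurable M" "X s \<in> borel_measurable M" "Y t \<in> borel_measurable M" "Y s \<in> borel_measurable M"
    using st t by (auto intro: X_measurable Y_measurable)
  have "indep_var borel (\<lambda>\<omega>. (\<lambda>x. x t - x s) (\<lambda>t\<in>{0..}. X t \<omega>)) borel (\<lambda>\<omega>. (\<lambda>y. - (y t - y s)) (\<lambda>t\<in>{0..}. Y t \<omega>))"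
    by (intro indep_var_functionals borel_measurable_diff borel_measurable_uminus comp st t)
  then have ind: "indep_var borel (\<lambda>\<omega>. X t \<omega> - X s \<omega>) borel (\<lambda>\<omega>. - (Y t \<omega> - Y s \<omega>))"
    using st t by simp
  have "char (distr M borel (\<lambda>\<omega>. Z t \<omega> - Z s \<omega>)) u
      = char (distr M borel (\<lambda>\<omega>. (X t \<omega> - X s \<omega>) + - (Y t \<omega> - Y s \<omega>))) u"
    by (simp add: Z_def algebra_simps)
  also have "\<dots> = char (distr M borel (\<lambda>\<omega>. X t \<omega> - X s \<omega>)) u * char (distr M borel (\<lambda>\<omega>. - (Y t \<omega> - Y s \<omega>))) u"
    by (rule char_distr_add[OF ind])
  also have "char (distr M borel (\<lambda>\<omega>. - (Y t \<omega> - Y s \<omega>))) u = char (distr M borel (\<lambda>\<omega>. Y t \<omega> - Y s \<omega>)) (- u)"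
    unfolding char_def by (subst (1 2) integral_distr) (auto simp: algebra_simps)
  finally show ?thesis
    by (simp add: stable_increment(1)[OF X st] stable_increment(1)[OF Y st] \<psi>_def algebra_simps flip: of_real_mult exp_add)
qed

lemma real_distribution_increment:
  assumes "0 \<le> s" "0 \<le> t"
  shows "real_distribution (distr M borel (\<lambda>\<omega>. Z t \<omega> - Z s \<omega>))"
  using Z_measurable[OF assms(1)] Z_measurable[OF assms(2)]
  by (simp add: real_distribution_def real_distribution_axioms_def prob_space_distr)

lemma nu_eq_increment: "0 \<le> t \<Longrightarrow> \<nu> t = distr M borel (\<lambda>\<omega>. Z t \<omega> - Z 0 \<omega>)"
  unfolding \<nu>_def by (intro distr_cong) (auto simp: Z_0)

lemma char_\<nu>: "0 \<le> t \<Longrightarrow> char (\<nu> t) u = complex_of_real (exp (- t * \<psi> u))"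
proof (cases "t = 0")
  \<comment> \<open>The increment formula requires \<open>s < t\<close>, so time \<open>0\<close> is
    treated directly.\<close>
  case True
  have "char (\<nu> 0) u = (LINT \<omega>|M. iexp (u * (Z 0 \<omega> - Z 0 \<omega>)))"
    unfolding char_def nu_eq_increment[OF order_refl] by (subst integral_distr) auto
  then show ?thesis using True prob_space by simp
next
  case False
  assume "0 \<le> t"
  then show ?thesis using False char_Z_increment[of 0 t u] by (simp add: nu_eq_increment)
qed

sublocale symmetric_convolution_family \<psi> \<nu>
proof (rule symmetric_convolution_family.intro)
  show "\<psi> \<in> borel_measurable borel" unfolding \<psi>_def[abs_def] by measurable
  show "0 \<le> \<psi> v" for v by (simp add: \<psi>_def)
  show "0 < \<psi> v" if "v \<noteq> 0" for v using that by (simp add: \<psi>_def add_pos_pos)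
  show "integrable lborel (\<lambda>v. 1 / (1 + \<psi> v))"
  \<comment> \<open>The power with the larger index alone bounds \<open>\<psi>\<close> from below,
    and this index exceeds 1.\<close>
  proof (rule integrable_dominated[OF integrable_inverse_one_plus_powr[OF index]])
    fix v :: real
    have "\<bar>v\<bar> powr (max \<alpha>\<^sub>1 \<alpha>\<^sub>2) \<le> \<psi> v" by (simp add: \<psi>_def max_def)
    moreover have "1 + \<bar>v\<bar> powr (max \<alpha>\<^sub>1 \<alpha>\<^sub>2) > 0" by (simp add: add_pos_nonneg)
    ultimately show "\<bar>1 / (1 + \<psi> v)\<bar> \<le> 1 / (1 + \<bar>v\<bar> powr (max \<alpha>\<^sub>1 \<alpha>\<^sub>2))"
      by (simp add: frac_le)
  qed (simp add: \<psi>_def)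
  show "real_distribution (\<nu> t)" if "0 \<le> t" for t
    using real_distribution_increment[of 0 t] that by (simp add: nu_eq_increment)
  show "char (\<nu> t) v = complex_of_real (exp (- t * \<psi> v))" if "0 \<le> t" for t v
    by (rule char_\<nu>[OF that])
qed

lemma distr_increment:
  assumes "0 \<le> s" "0 < h"
  shows "distr M borel (\<lambda>\<omega>. Z (s + h) \<omega> - Z s \<omega>) = \<nu> h"
proof (rule Levy_uniqueness)
  show "real_distribution (distr M borel (\<lambda>\<omega>. Z (s + h) \<omega> - Z s \<omega>))"
    using assms by (intro real_distribution_increment) auto
  show "real_distribution (\<nu> h)" using assms by (intro nu_dist) auto
  show "char (distr M borel (\<lambda>\<omega>. Z (s + h) \<omega> - Z s \<omega>)) = char (\<nu> h)"
    using assms char_Z_increment[of s "s + h"] by (auto simp: char_nu)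
qed

text \<open>Each past consists of finitely many grid values measurable with respect to
  \<open>F s\<close>, so \<open>stable_increment\<close> treats each process by itself, and
  \<open>indep_processes\<close> supplies the joint law of the two.\<close>

lemma grid_increment_product_law:
  fixes n :: nat
  assumes h: "0 < h"
  defines "S \<equiv> PiM {..n} (\<lambda>_. borel :: real measure)"
  defines "t \<equiv> real (Suc n) * h" and "s \<equiv> real n * h"
  shows "product_law M (S \<Otimes>\<^sub>M S) (\<lambda>\<omega>. (\<lambda>k\<in>{..n}. X (real k * h) \<omega>, \<lambda>k\<in>{..n}. Y (real k * h) \<omega>))
     (borel \<Otimes>\<^sub>M borel) (\<lambda>\<omega>. (X t \<omega> - X s \<omega>, Y t \<omega> - Y s \<omega>))"
proof (rule product_law_interchange)
  have st: "0 \<le> s" "s < t" "0 \<le> t" using h by (auto simp: s_def t_def)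
  have J: "(\<lambda>\<omega>. \<lambda>k\<in>{..n}. W (real k * h) \<omega>) \<in> measurable (F s) S" if W: "symmetric_stable_process M F \<alpha> W" for \<alpha> W
    unfolding S_def s_def using h
    by (intro measurable_restrict stable_adapted[OF W] mult_right_mono) auto
  show "product_law M S (\<lambda>\<omega>. \<lambda>k\<in>{..n}. X (real k * h) \<omega>) borel (\<lambda>\<omega>. X t \<omega> - X s \<omega>)"
    by (rule stable_increment(2)[OF X st(1,2) J[OF X]])
  show "product_law M S (\<lambda>\<omega>. \<lambda>k\<in>{..n}. Y (real k * h) \<omega>) borel (\<lambda>\<omega>. Y t \<omega> - Y s \<omega>)"
    by (rule stable_increment(2)[OF Y st(1,2) J[OF Y]])
  \<comment> \<open>Past and next increment form one functional of the whole path, so independence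
    of the paths carries over to these pairs.\<close>
  define K where "K x = (\<lambda>k\<in>{..n}. x (real k * h), x t - x s)" for x :: "real \<Rightarrow> real"
  have comp: "(\<lambda>x. x r) \<in> borel_measurable (PiM {0..} (\<lambda>_. borel))" if "0 \<le> r" for r :: real
    using that by (intro measurable_component_singleton) auto
  have K: "K \<in> measurable (PiM {0..} (\<lambda>_. borel)) (S \<Otimes>\<^sub>M borel)"
    unfolding K_def[abs_def] S_def using h
    by (intro measurable_Pair measurable_restrict borel_measurable_diff comp st) auto
  have K_eq: "K (\<lambda>t\<in>{0..}. W t \<omega>) = (\<lambda>k\<in>{..n}. W (real k * h) \<omega>, W t \<omega> - W s \<omega>)" for W :: "real \<Rightarrow> 'a \<Rightarrow> real" and \<omega>
    using st h by (auto simp: K_def restrict_def)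
  show "product_law M (S \<Otimes>\<^sub>M borel) (\<lambda>\<omega>. (\<lambda>k\<in>{..n}. X (real k * h) \<omega>, X t \<omega> - X s \<omega>))
     (S \<Otimes>\<^sub>M borel) (\<lambda>\<omega>. (\<lambda>k\<in>{..n}. Y (real k * h) \<omega>, Y t \<omega> - Y s \<omega>))"
    using indep_var_functionals[OF K K] unfolding K_eq indep_var_distribution_eq product_law_def by simp
qed

text \<open>The Markov property at one grid time. The past is recorded through \<open>X\<close> and
  \<open>Y\<close> separately, as in \<open>grid_increment_product_law\<close>, while only the
  differences enter \<open>\<Phi>\<close>.\<close>

lemma expectation_grid_step:
  fixes a G :: "real \<Rightarrow> real" and n :: nat
  assumes h: "0 < h" and a: "continuous_on UNIV a" "\<And>x. \<bar>a x\<bar> \<le> A" and G: "continuous_on UNIV G" "\<And>x. \<bar>G x\<bar> \<le> B"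
  shows "expectation (\<lambda>\<omega>. (\<Prod>k=1..n. a (Z (real k * h) \<omega>)) * G (Z (real (Suc n) * h) \<omega>))
    = expectation (\<lambda>\<omega>. (\<Prod>k=1..n. a (Z (real k * h) \<omega>)) * P h G (Z (real n * h) \<omega>))"
proof -
  define t s where "t = real (Suc n) * h" and "s = real n * h"
  have st: "0 \<le> s" "0 \<le> t" "t = s + h" using h by (auto simp: s_def t_def algebra_simps)
  define S where "S = PiM {..n} (\<lambda>_. borel :: real measure)"
  define J where "J \<omega> = (\<lambda>k\<in>{..n}. X (real k * h) \<omega>, \<lambda>k\<in>{..n}. Y (real k * h) \<omega>)" for \<omega>
  define \<xi> where "\<xi> \<omega> = (X t \<omega> - X s \<omega>, Y t \<omega> - Y s \<omega>)" for \<omega>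
  define \<Phi> :: "((nat \<Rightarrow> real) \<times> (nat \<Rightarrow> real)) \<times> (real \<times> real) \<Rightarrow> real" where
    "\<Phi> p = (\<Prod>k=1..n. a (fst (fst p) k - snd (fst p) k)) * G (fst (fst p) n - snd (fst p) n + (fst (snd p) - snd (snd p)))" for p
  have law: "product_law M (S \<Otimes>\<^sub>M S) J (borel \<Otimes>\<^sub>M borel) \<xi>"
    unfolding J_def[abs_def] \<xi>_def[abs_def] S_def t_def s_def by (rule grid_increment_product_law[OF h])
  have am: "a \<in> borel_measurable borel" and Gm: "G \<in> borel_measurable borel"
    using a G by (auto intro: borel_measurable_continuous_onI)
  have comp: "(\<lambda>x. x k) \<in> borel_measurable S" if "k \<in> {..n}" for k
    unfolding S_def using that by (rule measurable_component_singleton)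
  have proj: "(\<lambda>p. fst (fst p) k) \<in> borel_measurable ((S \<Otimes>\<^sub>M S) \<Otimes>\<^sub>M (borel \<Otimes>\<^sub>M borel))"
    "(\<lambda>p. snd (fst p) k) \<in> borel_measurable ((S \<Otimes>\<^sub>M S) \<Otimes>\<^sub>M (borel \<Otimes>\<^sub>M borel))" if "k \<in> {..n}" for k
    using measurable_compose[OF measurable_compose[OF measurable_fst measurable_fst] comp[OF that]]
      measurable_compose[OF measurable_compose[OF measurable_fst measurable_snd] comp[OF that]] by blast+
  have \<Phi>m: "\<Phi> \<in> borel_measurable ((S \<Otimes>\<^sub>M S) \<Otimes>\<^sub>M (borel \<Otimes>\<^sub>M borel))"
    unfolding \<Phi>_def[abs_def]
    by (intro borel_measurable_times borel_measurable_prod measurable_compose[OF _ am] measurable_compose[OF _ Gm]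
        borel_measurable_diff borel_measurable_add proj measurable_compose[OF measurable_snd measurable_fst]
        measurable_compose[OF measurable_snd measurable_snd]) auto
  have \<Phi>b: "\<bar>\<Phi> p\<bar> \<le> A ^ n * B" for p
  proof -
    have "\<bar>\<Prod>k=1..n. a (fst (fst p) k - snd (fst p) k)\<bar> \<le> (\<Prod>k=1..n. A)"
      unfolding abs_prod by (intro prod_mono) (use a in auto)
    then show ?thesis unfolding \<Phi>_def abs_mult
      using a(2)[of 0] by (intro mult_mono G) (auto intro: order_trans[OF abs_ge_zero])
  qed
  have Jk: "fst (J \<omega>) k - snd (J \<omega>) k = Z (real k * h) \<omega>" if "k \<le> n" for k \<omega>
    using that by (simp add: J_def Z_def)
  have \<xi>d: "fst (\<xi> \<omega>) - snd (\<xi> \<omega>) = Z t \<omega> - Z s \<omega>" for \<omega> by (simp add: \<xi>_def Z_def)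
  have \<xi>m[measurable]: "\<xi> \<in> measurable M (borel \<Otimes>\<^sub>M borel)" using law by (simp add: product_law_def)
  have Zm[measurable]: "Z t \<in> borel_measurable M" "Z s \<in> borel_measurable M" using st by (auto intro: Z_measurable)
  note Gm[measurable]
  have inner: "(LINT z|distr M (borel \<Otimes>\<^sub>M borel) \<xi>. G (c + (fst z - snd z))) = P h G c" for c
  proof -
    have "(LINT z|distr M (borel \<Otimes>\<^sub>M borel) \<xi>. G (c + (fst z - snd z))) = (LINT \<omega>|M. G (c + (fst (\<xi> \<omega>) - snd (\<xi> \<omega>))))"
      by (rule integral_distr) measurable
    also have "\<dots> = (LINT \<omega>|M. G (c + (Z t \<omega> - Z s \<omega>)))" by (simp only: \<xi>d)
    also have "\<dots> = (LINT z|distr M borel (\<lambda>\<omega>. Z t \<omega> - Z s \<omega>). G (c + z))"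
      by (rule integral_distr[symmetric]) measurable
    also have "\<dots> = P h G c"
      unfolding st(3) distr_increment[OF st(1) h] P_def ..
    finally show ?thesis .
  qed
  have "expectation (\<lambda>\<omega>. (\<Prod>k=1..n. a (Z (real k * h) \<omega>)) * G (Z (real (Suc n) * h) \<omega>)) = expectation (\<lambda>\<omega>. \<Phi> (J \<omega>, \<xi> \<omega>))"
    by (intro Bochner_Integration.integral_cong refl) (simp add: \<Phi>_def Jk \<xi>d s_def[symmetric] t_def[symmetric] del: of_nat_Suc)
  also have "\<dots> = (LINT \<omega>|M. LINT z|distr M (borel \<Otimes>\<^sub>M borel) \<xi>. \<Phi> (J \<omega>, z))"
    by (rule product_law_integral[OF law \<Phi>m \<Phi>b])
  also have "\<dots> = expectation (\<lambda>\<omega>. (\<Prod>k=1..n. a (Z (real k * h) \<omega>)) * P h G (Z (real n * h) \<omega>))"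
    by (intro Bochner_Integration.integral_cong refl) (simp add: \<Phi>_def Jk inner)
  finally show ?thesis .
qed

lemma expectation_grid_prod:
  fixes a :: "real \<Rightarrow> real"
  assumes h: "0 < h" and a: "continuous_on UNIV a" "\<And>x. \<bar>a x\<bar> \<le> A"
  shows "expectation (\<lambda>\<omega>. \<Prod>k=1..n. a (Z (real k * h) \<omega>)) = u a h n 0"
proof -
  \<comment> \<open>Each induction step moves the last factor from the product into
    \<open>u\<close>; \<open>n + j\<close> stays fixed, and for \<open>n = 0\<close> the start
    \<open>Z 0 = 0\<close> remains.\<close>
  have gen: "expectation (\<lambda>\<omega>. (\<Prod>k=1..n. a (Z (real k * h) \<omega>)) * u a h j (Z (real n * h) \<omega>)) = u a h (n + j) 0" for n j
  proof (induction n arbitrary: j)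
    case 0
    have "expectation (\<lambda>\<omega>. u a h j (Z 0 \<omega>)) = expectation (\<lambda>\<omega>. u a h j 0)"
      by (intro Bochner_Integration.integral_cong refl) (simp add: Z_0)
    then show ?case using prob_space by simp
  next
    case (Suc n)
    define G where "G y = a y * u a h j y" for y
    note u = continuous_on_u[OF less_imp_le[OF h] a] abs_u_le[OF less_imp_le[OF h] a]
    have c: "continuous_on UNIV G" unfolding G_def[abs_def] by (intro continuous_intros a u)
    have b: "\<bar>G y\<bar> \<le> A * A ^ j" for y
      unfolding G_def abs_mult using a(2)[of 0] by (intro mult_mono a u) (auto intro: order_trans[OF abs_ge_zero])
    have "expectation (\<lambda>\<omega>. (\<Prod>k=1..Suc n. a (Z (real k * h) \<omega>)) * u a h j (Z (real (Suc n) * h) \<omega>))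
        = expectation (\<lambda>\<omega>. (\<Prod>k=1..n. a (Z (real k * h) \<omega>)) * G (Z (real (Suc n) * h) \<omega>))"
      by (intro Bochner_Integration.integral_cong refl) (simp add: G_def mult.assoc del: of_nat_Suc)
    also have "\<dots> = expectation (\<lambda>\<omega>. (\<Prod>k=1..n. a (Z (real k * h) \<omega>)) * u a h (Suc j) (Z (real n * h) \<omega>))"
      using expectation_grid_step[OF h a c b] by (simp add: G_def)
    also have "\<dots> = u a h (Suc n + j) 0"
      using Suc.IH[of "Suc j"] by simp
    finally show ?case .
  qed
  from gen[of n 0] show ?thesis by simp
qed

end

subsection \<open>Laplace transform of the collision local time\<close>

lemma lborel_step_integral:
  fixes f :: "nat \<Rightarrow> real"
  assumes h: "h > 0"
  shows "(LBINT t. indicator {0..<real m * h} t * f (nat \<lfloor>t / h\<rfloor>)) = (\<Sum>k<m. h * f k)"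
proof -
  have eq: "indicator {0..<real m * h} t * f (nat \<lfloor>t / h\<rfloor>) = (\<Sum>k<m. f k * indicator {real k * h..<real (Suc k) * h} t)" for t
  proof -
    have *: "t \<in> {real k * h..<real (Suc k) * h} \<longleftrightarrow> 0 \<le> t \<and> nat \<lfloor>t / h\<rfloor> = k" for k
    proof -
      have "t \<in> {real k * h..<real (Suc k) * h} \<longleftrightarrow> of_int (int k) \<le> t / h \<and> t / h < of_int (int k) + 1"
        using h by (simp add: pos_le_divide_eq pos_divide_less_eq algebra_simps)
      also have "\<dots> \<longleftrightarrow> \<lfloor>t / h\<rfloor> = int k" by (simp only: floor_eq_iff)
      also have "\<dots> \<longleftrightarrow> 0 \<le> t \<and> nat \<lfloor>t / h\<rfloor> = k"
      proof -
        have e: "0 \<le> t \<longleftrightarrow> 0 \<le> \<lfloor>t / h\<rfloor>" using h by (simp add: zero_le_divide_iff)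
        show ?thesis unfolding e by linarith
      qed
      finally show ?thesis .
    qed
    have "(\<Sum>k<m. f k * indicator {real k * h..<real (Suc k) * h} t)
        = (\<Sum>k<m. if k = nat \<lfloor>t / h\<rfloor> then (if 0 \<le> t then f k else 0) else 0)"
      by (intro sum.cong refl) (simp only: indicator_def *, auto)
    also have "\<dots> = (if nat \<lfloor>t / h\<rfloor> < m \<and> 0 \<le> t then f (nat \<lfloor>t / h\<rfloor>) else 0)"
      by (subst sum.delta) auto
    also have "nat \<lfloor>t / h\<rfloor> < m \<and> 0 \<le> t \<longleftrightarrow> t \<in> {0..<real m * h}"
    proof (cases "0 \<le> t")
      case True
      then have "nat \<lfloor>t / h\<rfloor> < m \<longleftrightarrow> t / h < real m"
        using h by (simp add: nat_less_iff floor_less_iff)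
      then show ?thesis using True h by (simp add: pos_divide_less_eq)
    qed simp
    finally show ?thesis by simp
  qed
  have "(LBINT t. indicator {0..<real m * h} t * f (nat \<lfloor>t / h\<rfloor>))
      = (\<Sum>k<m. LBINT t. f k * indicator {real k * h..<real (Suc k) * h} t)"
    unfolding eq by (rule Bochner_Integration.integral_sum) (simp add: h)
  also have "\<dots> = (\<Sum>k<m. h * f k)"
    using h by (intro sum.cong refl) (simp add: algebra_simps)
  finally show ?thesis .
qed

text \<open>Right endpoints are chosen because the paths are only right-continuous: the node
  following \<open>t\<close> tends to \<open>t\<close> strictly from above. The bound
  \<open>B\<close> allows dominated convergence of the step functions.\<close>

lemma right_riemann_sum_tendsto:
  fixes f :: "real \<Rightarrow> real"
  assumes T: "T > 0" and right: "\<And>t. 0 \<le> t \<Longrightarrow> (f \<longlongrightarrow> f t) (at_right t)" and B: "\<And>t. \<bar>f t\<bar> \<le> B"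
  shows "(\<lambda>m. \<Sum>k=1..Suc m. T / real (Suc m) * f (real k * (T / real (Suc m)))) \<longlonglongrightarrow> (LINT t:{0..T}|lborel. f t)"
proof -
  define h where "h m = T / real (Suc m)" for m
  have h: "h m > 0" for m using T by (simp add: h_def)
  have mh: "real (Suc m) * h m = T" for m by (simp add: h_def)
  have h0: "h \<longlonglongrightarrow> 0"
    using tendsto_mult[OF tendsto_const[of T] LIMSEQ_inverse_real_of_nat] by (simp add: h_def[abs_def] divide_inverse)
  \<comment> \<open>\<open>Suc\<close> selects the first node strictly after \<open>t\<close>; the
    half-open interval keeps the index within the grid, and the endpoint \<open>T\<close> is a null
    set.\<close>
  define g where "g m t = indicator {0..<T} t * f (real (Suc (nat \<lfloor>t / h m\<rfloor>)) * h m)" for m t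
  have g_int: "(LBINT t. g m t) = (\<Sum>k=1..Suc m. T / real (Suc m) * f (real k * (T / real (Suc m))))" for m
  proof -
    have "(LBINT t. g m t) = (\<Sum>k<Suc m. h m * f (real (Suc k) * h m))"
      using lborel_step_integral[OF h, of "Suc m" m "\<lambda>k. f (real (Suc k) * h m)"] unfolding mh g_def .
    also have "\<dots> = (\<Sum>k=1..Suc m. h m * f (real k * h m))"
      by (rule sum.reindex_bij_witness[of _ "\<lambda>k. k - 1" Suc]) auto
    finally show ?thesis by (simp only: h_def)
  qed
  have g_meas: "g m \<in> borel_measurable borel" for m
  proof -
    have "(\<lambda>t. (\<lambda>i. f (real (Suc (nat i)) * h m)) \<lfloor>t / h m\<rfloor>) \<in> borel_measurable borel"
      by (rule measurable_compose[of "\<lambda>t. \<lfloor>t / h m\<rfloor>" _ "count_space UNIV"]) measurable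
    then show ?thesis unfolding g_def[abs_def] by (intro borel_measurable_times) auto
  qed
  have lim: "(\<lambda>m. g m t) \<longlonglongrightarrow> indicator {0..<T} t * f t" for t
  proof (cases "t \<in> {0..<T}")
    case True
    define s where "s m = real (Suc (nat \<lfloor>t / h m\<rfloor>)) * h m" for m
    have s: "t < s m \<and> s m \<le> t + h m" for m
    proof -
      have fl: "real (nat \<lfloor>t / h m\<rfloor>) = of_int \<lfloor>t / h m\<rfloor>" using True h[of m] by simp
      have "t / h m < of_int \<lfloor>t / h m\<rfloor> + 1" "of_int \<lfloor>t / h m\<rfloor> \<le> t / h m" by linarith+
      then have "t < (of_int \<lfloor>t / h m\<rfloor> + 1) * h m" "of_int \<lfloor>t / h m\<rfloor> * h m \<le> t"
        using h[of m] by (simp_all only: pos_divide_less_eq pos_le_divide_eq)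
      then show ?thesis using fl by (simp add: s_def algebra_simps)
    qed
    have "s \<longlonglongrightarrow> t"
    proof (rule tendsto_sandwich[of "\<lambda>_. t" _ _ "\<lambda>m. t + h m"])
      show "(\<lambda>m. t + h m) \<longlonglongrightarrow> t" using tendsto_add[OF tendsto_const h0, of t] by simp
    qed (use s in \<open>auto intro!: eventuallyI less_imp_le\<close>)
    moreover have "s m \<in> {t<..} \<and> s m \<noteq> t" for m using s[of m] by auto
    ultimately have "filterlim s (at_right t) sequentially"
      by (simp add: filterlim_at)
    then have "(\<lambda>m. f (s m)) \<longlonglongrightarrow> f t"
      using right[of t] True by (auto intro: filterlim_compose)
    then show ?thesis using True by (simp add: g_def s_def)
  qed (simp add: g_def)
  \<comment> \<open>Measurability on \<open>[0, T)\<close> is inherited from the step functions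
    through their pointwise limit.\<close>
  have f_meas: "(\<lambda>t. indicator {0..<T} t * f t) \<in> borel_measurable lborel"
    by (rule borel_measurable_LIMSEQ_real[OF lim]) (simp add: g_meas)
  have "(\<lambda>m. LBINT t. g m t) \<longlonglongrightarrow> (LBINT t. indicator {0..<T} t * f t)"
  proof (rule integral_dominated_convergence[where w="\<lambda>t. B * indicator {0..<T} t"])
    show "integrable lborel (\<lambda>t. B * indicator {0..<T} t)" using T by simp
    show "AE t in lborel. norm (g m t) \<le> B * indicator {0..<T} t" for m
      using B by (auto simp: g_def abs_mult split: split_indicator)
  qed (use lim f_meas g_meas in auto)
  also have "(LBINT t. indicator {0..<T} t * f t) = (LINT t:{0..T}|lborel. f t)"
  proof -
    have "AE t in lborel. t \<noteq> T" by (rule AE_lborel_singleton)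
    then have ae: "AE t in lborel. indicator {0..<T} t * f t = indicator {0..T} t *\<^sub>R f t"
      by eventually_elim (auto split: split_indicator)
    have "(\<lambda>t. indicator {0..<T} t * f t + indicator {T} t * f T) \<in> borel_measurable lborel"
      using f_meas by (intro borel_measurable_add) auto
    also have "(\<lambda>t. indicator {0..<T} t * f t + indicator {T} t * f T) = (\<lambda>t. indicator {0..T} t *\<^sub>R f t)"
      using T by (auto split: split_indicator)
    finally show ?thesis
      unfolding set_lebesgue_integral_def by (intro integral_cong_AE f_meas ae)
  qed
  finally show ?thesis unfolding g_int .
qed

context symmetric_convolution_family
begin

text \<open>After rescaling to the standard normal density, the argument
  \<open>sqrt (e n) * x\<close> of the modulus tends to \<open>0\<close>, and \<open>2 * Q T\<close>
  dominates.\<close>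

lemma integral_V_modulus_tendsto_0:
  assumes eps: "e \<longlonglongrightarrow> (0::real)" and pos: "\<And>n. e n > 0"
  shows "(\<lambda>n. LBINT y. V (e n) y * modulus T y) \<longlonglongrightarrow> 0"
proof -
  have eq: "(LBINT y. V (e n) y * modulus T y) = (LBINT x. modulus T (sqrt (e n) * x) * std_normal_density x)" for n
    using integral_normal_density_shift[of "sqrt (e n)" "modulus T" 0] pos[of n] by (simp add: mult.commute)
  have "(\<lambda>n. LBINT x. modulus T (sqrt (e n) * x) * std_normal_density x) \<longlonglongrightarrow> integral\<^sup>L lborel (\<lambda>x::real. 0::real)"
  proof (rule integral_dominated_convergence[where w="\<lambda>x. 2 * Q T * std_normal_density x"])
    show "AE x in lborel. (\<lambda>n. modulus T (sqrt (e n) * x) * std_normal_density x) \<longlonglongrightarrow> 0"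
    proof (rule AE_I2)
      fix x
      have "(\<lambda>n. sqrt (e n) * x) \<longlonglongrightarrow> sqrt 0 * x" by (intro tendsto_intros eps)
      then have "(\<lambda>n. modulus T (sqrt (e n) * x)) \<longlonglongrightarrow> 0" by (intro modulus_tendsto_0) simp
      from tendsto_mult_left_zero[OF this] show "(\<lambda>n. modulus T (sqrt (e n) * x) * std_normal_density x) \<longlonglongrightarrow> 0" .
    qed
    show "AE x in lborel. norm (modulus T (sqrt (e n) * x) * std_normal_density x) \<le> 2 * Q T * std_normal_density x" for n
      using modulus_nonneg modulus_le by (intro AE_I2) (simp add: abs_mult mult_right_mono)
  qed auto
  then show ?thesis unfolding eq by simp
qed

end

section \<open>Laplace transform and exponential moments of the mollified local time\<close>

context stable_pair
begin

context
  fixes T :: real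
  assumes T: "T > 0"
begin

abbreviation A :: "real \<Rightarrow> 'a \<Rightarrow> real" where
  "A \<epsilon> \<equiv> approx_collision_local_time X Y T \<epsilon>"

abbreviation mesh :: "nat \<Rightarrow> real" where "mesh m \<equiv> T / real (Suc m)"

lemma mesh_tendsto_0: "mesh \<longlonglongrightarrow> 0"
  using tendsto_mult[OF tendsto_const[of T] LIMSEQ_inverse_real_of_nat] by (simp add: divide_inverse)

definition A_sum :: "real \<Rightarrow> nat \<Rightarrow> 'a \<Rightarrow> real" where
  "A_sum \<epsilon> m \<omega> = (\<Sum>k=1..Suc m. mesh m * V \<epsilon> (Z (real k * mesh m) \<omega>))"

lemma Z_right_continuous:
  assumes "\<omega> \<in> space M" "0 \<le> t"
  shows "((\<lambda>t. Z t \<omega>) \<longlongrightarrow> Z t \<omega>) (at_right t)"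
  using X Y assms unfolding Z_def symmetric_stable_process_def cadlag_def by (auto intro!: tendsto_diff)

lemma A_sum_tendsto:
  assumes eps: "\<epsilon> > 0" and \<omega>: "\<omega> \<in> space M"
  shows "(\<lambda>m. A_sum \<epsilon> m \<omega>) \<longlonglongrightarrow> A \<epsilon> \<omega>"
  unfolding A_sum_def approx_collision_local_time_def Z_def[symmetric]
proof (rule right_riemann_sum_tendsto[OF T])
  show "((\<lambda>t. V \<epsilon> (Z t \<omega>)) \<longlongrightarrow> V \<epsilon> (Z t \<omega>)) (at_right t)" if "0 \<le> t" for t
    using continuous_on_tendsto_compose[OF continuous_on_normal_density Z_right_continuous[OF \<omega> that], of "sqrt \<epsilon>" UNIV 0] eps
    by simp
  show "\<bar>V \<epsilon> (Z t \<omega>)\<bar> \<le> 1 / sqrt (2 * pi * \<epsilon>)" for t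
    using V_le[OF eps] by simp
qed

lemma A_sum_measurable [measurable]: "A_sum \<epsilon> m \<in> borel_measurable M"
  unfolding A_sum_def[abs_def] using T
  by (intro borel_measurable_sum borel_measurable_times borel_measurable_const
      measurable_compose[OF Z_measurable borel_measurable_normal_density]) auto

lemma A_measurable [measurable]: "\<epsilon> > 0 \<Longrightarrow> A \<epsilon> \<in> borel_measurable M"
  by (rule borel_measurable_LIMSEQ_real[OF A_sum_tendsto A_sum_measurable])

lemma A_nonneg: "0 \<le> A \<epsilon> \<omega>"
  unfolding approx_collision_local_time_def set_lebesgue_integral_def by (intro integral_nonneg_AE) auto

lemma A_sum_nonneg: "0 \<le> A_sum \<epsilon> m \<omega>"
  unfolding A_sum_def using T by (intro sum_nonneg) auto

lemma exp_A_sum: "exp (- (c * A_sum \<epsilon> m \<omega>)) = (\<Prod>k=1..Suc m. damp c (mesh m) \<epsilon> (Z (real k * mesh m) \<omega>))"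
  unfolding A_sum_def damp_def
  by (subst exp_sum[symmetric]) (simp_all only: sum_distrib_left sum_negf mult.assoc finite_atLeastAtMost)

lemma expectation_exp_A_sum:
  assumes c: "c \<ge> 0" and eps: "\<epsilon> > 0"
  shows "expectation (\<lambda>\<omega>. exp (- (c * A_sum \<epsilon> m \<omega>))) = u (damp c (mesh m) \<epsilon>) (mesh m) (Suc m) 0"
proof -
  have h: "mesh m > 0" using T by simp
  show ?thesis
    unfolding exp_A_sum by (rule expectation_grid_prod[OF h continuous_on_damp[OF eps] abs_damp_le[OF c h eps]])
qed

lemma expectation_exp_A_tendsto:
  assumes c: "c \<ge> 0" and eps: "\<epsilon> > 0"
  shows "(\<lambda>m. u (damp c (mesh m) \<epsilon>) (mesh m) (Suc m) 0) \<longlonglongrightarrow> expectation (\<lambda>\<omega>. exp (- (c * A \<epsilon> \<omega>)))"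
  unfolding expectation_exp_A_sum[OF c eps, symmetric]
proof (rule integral_dominated_convergence[where w="\<lambda>_. 1"])
  show "AE \<omega> in M. (\<lambda>m. exp (- (c * A_sum \<epsilon> m \<omega>))) \<longlonglongrightarrow> exp (- (c * A \<epsilon> \<omega>))"
    by (intro AE_I2 tendsto_intros A_sum_tendsto eps)
  show "AE \<omega> in M. norm (exp (- (c * A_sum \<epsilon> m \<omega>))) \<le> 1" for m
    using c A_sum_nonneg by (intro AE_I2) simp
qed (use eps in auto)

text \<open>The limit of \<open>walk_error\<close> for vanishing mesh at fixed
  \<open>\<epsilon>\<close>. The linearisation term is of order \<open>h / sqrt \<epsilon>\<close>;
  it disappears because \<open>\<epsilon>\<close> is held fixed while \<open>h\<close> tends to
  \<open>0\<close>.\<close>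

definition limit_error :: "real \<Rightarrow> real \<Rightarrow> real" where
  "limit_error c \<epsilon> = c\<^sup>2 * Q (2 * T) * (LBINT y. V \<epsilon> y * modulus (2 * T) y) + c * \<rho> (2 * T) \<epsilon>"

lemma walk_error_tendsto: 
  "(\<lambda>m. walk_error c (mesh m) \<epsilon> (2 * T)) \<longlonglongrightarrow> limit_error c \<epsilon>"
proof -
  have eq: "walk_error c h \<epsilon> (2 * T) = h * (c\<^sup>2 / sqrt (2 * pi * \<epsilon>) * Q (2 * T)) + limit_error c \<epsilon>" for h
    by (simp add: walk_error_def limit_error_def)
  have "(\<lambda>m. mesh m * (c\<^sup>2 / sqrt (2 * pi * \<epsilon>) * Q (2 * T)) + limit_error c \<epsilon>) \<longlonglongrightarrow> 0 + limit_error c \<epsilon>"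
    by (intro tendsto_add tendsto_mult_left_zero mesh_tendsto_0 tendsto_const)
  then show ?thesis unfolding eq by simp
qed

lemma limit_error_tendsto_0:
  assumes "e \<longlonglongrightarrow> 0" "\<And>n. e n > 0"
  shows "(\<lambda>n. limit_error c (e n)) \<longlonglongrightarrow> 0"
proof -
  have "(\<lambda>n. limit_error c (e n)) \<longlonglongrightarrow> c\<^sup>2 * Q (2 * T) * 0 + c * 0"
    unfolding limit_error_def
    by (intro tendsto_add tendsto_mult tendsto_const integral_V_modulus_tendsto_0 rho_tendsto_0 assms)
  then show ?thesis by simp
qed

lemma
  assumes c: "c \<ge> 0" and eps: "\<epsilon> > 0"
  shows A_laplace_upper: "c * (T * q T) * expectation (\<lambda>\<omega>. exp (- (c * A \<epsilon> \<omega>))) \<le> 1 + limit_error c \<epsilon>"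
    and A_laplace_lower: "c * (q T - q (2 * T)) * (T * (1 - limit_error c \<epsilon>) / (1 + c * Q (2 * T))) - 2 * limit_error c \<epsilon>
      \<le> c * Q (2 * T) * expectation (\<lambda>\<omega>. exp (- (c * A \<epsilon> \<omega>)))"
proof -
  note lims = expectation_exp_A_tendsto[OF c eps] walk_error_tendsto[of c \<epsilon>]
  show "c * (T * q T) * expectation (\<lambda>\<omega>. exp (- (c * A \<epsilon> \<omega>))) \<le> 1 + limit_error c \<epsilon>"
  proof (rule LIMSEQ_le)
    show "(\<lambda>m. c * (T * q T) * u (damp c (mesh m) \<epsilon>) (mesh m) (Suc m) 0) \<longlonglongrightarrow> c * (T * q T) * expectation (\<lambda>\<omega>. exp (- (c * A \<epsilon> \<omega>)))"
      by (intro tendsto_intros lims)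
    show "(\<lambda>m. 1 + walk_error c (mesh m) \<epsilon> (2 * T)) \<longlonglongrightarrow> 1 + limit_error c \<epsilon>"
      by (intro tendsto_intros lims)
  qed (intro exI[of _ 0] allI impI, rule w_upper_bound[OF c T zero_less_Suc eps])
  have pos: "1 + c * Q (2 * T) \<noteq> 0" using c Q_nonneg[of "2 * T"] by (simp add: add_nonneg_eq_0_iff)
  show "c * (q T - q (2 * T)) * (T * (1 - limit_error c \<epsilon>) / (1 + c * Q (2 * T))) - 2 * limit_error c \<epsilon>
      \<le> c * Q (2 * T) * expectation (\<lambda>\<omega>. exp (- (c * A \<epsilon> \<omega>)))"
  proof (rule LIMSEQ_le)
    show "(\<lambda>m. c * Q (2 * T) * u (damp c (mesh m) \<epsilon>) (mesh m) (Suc m) 0)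
       \<longlonglongrightarrow> c * Q (2 * T) * expectation (\<lambda>\<omega>. exp (- (c * A \<epsilon> \<omega>)))"
      by (intro tendsto_intros lims)
    show "(\<lambda>m. c * (q T - q (2 * T)) * (T * (1 - walk_error c (mesh m) \<epsilon> (2 * T)) / (1 + c * Q (2 * T))) - 2 * walk_error c (mesh m) \<epsilon> (2 * T))
      \<longlonglongrightarrow> c * (q T - q (2 * T)) * (T * (1 - limit_error c \<epsilon>) / (1 + c * Q (2 * T))) - 2 * limit_error c \<epsilon>"
      by (intro tendsto_intros lims pos)
  qed (intro exI[of _ 0] allI impI, rule w_lower_bound[OF c T zero_less_Suc eps])
qed

text \<open>Fatou's lemma carries over the bound of \<open>u_exp_moment\<close>, whose smallness
  condition on the mesh holds eventually. The admissible \<open>c\<close> does not depend on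
  \<open>\<epsilon>\<close>, so the estimate survives the limit in
  \<open>\<epsilon>\<close>.\<close>

lemma A_exp_moment:
  assumes c: "c \<ge> 0" and eps: "\<epsilon> > 0" and cQ: "4 * c * Q T \<le> 1"
  shows "(\<integral>\<^sup>+\<omega>. ennreal (exp (c * A \<epsilon> \<omega>)) \<partial>M) \<le> 2"
proof -
  let ?E = "\<lambda>m \<omega>. ennreal (exp (c * A_sum \<epsilon> m \<omega>))"
  have "(\<integral>\<^sup>+\<omega>. ennreal (exp (c * A \<epsilon> \<omega>)) \<partial>M) = (\<integral>\<^sup>+\<omega>. liminf (\<lambda>m. ?E m \<omega>) \<partial>M)"
  proof (rule nn_integral_cong)
    fix \<omega> assume "\<omega> \<in> space M"
    then have "(\<lambda>m. ?E m \<omega>) \<longlonglongrightarrow> ennreal (exp (c * A \<epsilon> \<omega>))"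
      by (intro tendsto_ennrealI tendsto_intros A_sum_tendsto eps)
    then show "ennreal (exp (c * A \<epsilon> \<omega>)) = liminf (\<lambda>m. ?E m \<omega>)"
      by (rule lim_imp_Liminf[OF trivial_limit_sequentially, symmetric])
  qed
  also have "\<dots> \<le> liminf (\<lambda>m. \<integral>\<^sup>+\<omega>. ?E m \<omega> \<partial>M)"
    by (rule nn_integral_liminf) measurable
  also have "\<dots> \<le> 2"
  proof (rule Liminf_le)
    have "(\<lambda>m. c * mesh m / sqrt (2 * pi * \<epsilon>)) \<longlonglongrightarrow> c * 0 / sqrt (2 * pi * \<epsilon>)"
      unfolding divide_inverse[of "c * _"] by (intro tendsto_mult tendsto_const mesh_tendsto_0)
    then have "\<forall>\<^sub>F m in sequentially. c * mesh m / sqrt (2 * pi * \<epsilon>) < 1"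
      by (rule order_tendstoD) simp
    then show "\<forall>\<^sub>F m in sequentially. (\<integral>\<^sup>+\<omega>. ?E m \<omega> \<partial>M) \<le> 2"
    proof eventually_elim
      fix m assume small: "c * mesh m / sqrt (2 * pi * \<epsilon>) < 1"
      have h: "mesh m > 0" using T by simp
      have eq: "exp (c * A_sum \<epsilon> m \<omega>) = (\<Prod>k=1..Suc m. damp (- c) (mesh m) \<epsilon> (Z (real k * mesh m) \<omega>))" for \<omega>
        using exp_A_sum[of "- c"] by simp
      \<comment> \<open>A crude bound for integrability alone; the constant 2 comes from
        \<open>u_exp_moment\<close>.\<close>
      have b: "\<bar>damp (- c) (mesh m) \<epsilon> y\<bar> \<le> exp (c * mesh m / sqrt (2 * pi * \<epsilon>))" for y
      proof -
        have "c * mesh m * V \<epsilon> y \<le> c * mesh m * (1 / sqrt (2 * pi * \<epsilon>))"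
          using c h by (intro mult_left_mono V_le eps mult_nonneg_nonneg) auto
        then show ?thesis by (simp add: damp_def)
      qed
      have "\<bar>exp (c * A_sum \<epsilon> m \<omega>)\<bar> \<le> exp (c * mesh m / sqrt (2 * pi * \<epsilon>)) ^ Suc m" for \<omega>
      proof -
        have "\<bar>exp (c * A_sum \<epsilon> m \<omega>)\<bar> \<le> (\<Prod>k=1..Suc m. exp (c * mesh m / sqrt (2 * pi * \<epsilon>)))"
          unfolding eq abs_prod by (intro prod_mono conjI abs_ge_zero b)
        then show ?thesis by simp
      qed
      then have int: "integrable M (\<lambda>\<omega>. exp (c * A_sum \<epsilon> m \<omega>))"
        by (intro integrable_const_bound[of _ "exp (c * mesh m / sqrt (2 * pi * \<epsilon>)) ^ Suc m"]) (auto simp del: power_Suc)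
      have "(\<integral>\<^sup>+\<omega>. ?E m \<omega> \<partial>M) = ennreal (expectation (\<lambda>\<omega>. exp (c * A_sum \<epsilon> m \<omega>)))"
        by (rule nn_integral_eq_integral[OF int]) simp
      also have "expectation (\<lambda>\<omega>. exp (c * A_sum \<epsilon> m \<omega>)) = u (damp (- c) (mesh m) \<epsilon>) (mesh m) (Suc m) 0"
        unfolding eq by (rule expectation_grid_prod[OF h continuous_on_damp[OF eps] b])
      also have "ennreal \<dots> \<le> ennreal 2"
      proof (rule ennreal_leI)
        have "\<bar>u (damp (- c) (mesh m) \<epsilon>) (mesh m) (Suc m) 0\<bar> \<le> 2"
          using small by (intro u_exp_moment[OF c h eps _ cQ]) auto
        then show "u (damp (- c) (mesh m) \<epsilon>) (mesh m) (Suc m) 0 \<le> 2" by linarith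
      qed
      finally show "(\<integral>\<^sup>+\<omega>. ?E m \<omega> \<partial>M) \<le> 2" by simp
    qed
  qed simp
  finally show ?thesis .
qed

end

end

subsection \<open>Negative moments from the Laplace transform\<close>

text \<open>Discrete form of the integral of \<open>exp (- c * L)\<close> over \<open>c > 0\<close>,
  which is \<open>1 / L\<close>; the series is geometric.\<close>

lemma exp_geometric_le:
  fixes L :: real
  assumes "L > 0"
  shows "(\<Sum>k. ennreal (exp (- (real (Suc k) * L)))) \<le> ennreal (1 / L)"
proof -
  define r where "r = exp (- L)"
  have r: "0 < r" "r < 1" using assms by (auto simp: r_def)
  have eq: "exp (- (real (Suc k) * L)) = r * r ^ k" for k
    unfolding r_def by (simp add: algebra_simps flip: exp_of_nat_mult exp_add)
  have s: "(\<lambda>k. r * r ^ k) sums (r * (1 / (1 - r)))"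
    using r by (intro sums_mult geometric_sums) auto
  have "(\<Sum>k. ennreal (r * r ^ k)) = ennreal (r * (1 / (1 - r)))"
    using r by (subst suminf_ennreal2) (auto simp: sums_summable[OF s] sums_unique[OF s, symmetric])
  also have "\<dots> \<le> ennreal (1 / L)"
  proof (rule ennreal_leI)
    have "(1 + L) * r \<le> exp L * r" using r by (intro mult_right_mono exp_ge_add_one_self) auto
    then have "(1 + L) * r \<le> 1" by (simp add: r_def flip: exp_add)
    then show "r * (1 / (1 - r)) \<le> 1 / L" using r assms by (simp add: field_simps)
  qed
  finally show ?thesis unfolding eq .
qed

text \<open>Dyadic form of the Gamma integral of \<open>c powr (p - 1) * exp (- c * L)\<close>. For
  \<open>0 < L < 1\<close> a single summand suffices, the one where \<open>2 ^ k\<close> is below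
  \<open>1 / L\<close> by less than a factor 2: there \<open>exp (- (2 ^ k * L))\<close> is at least
  \<open>exp (- 1)\<close>, hence the factor \<open>exp 1\<close>, and the rounding costs
  \<open>2 powr p\<close>.\<close>

lemma ennreal_power_le_dyadic:
  assumes p: "0 < p" and L: "L \<ge> 0"
  shows "ennreal_power L (- p) \<le> 1 + ennreal (exp 1 * 2 powr p) * (\<Sum>k. ennreal (2 powr (real k * p) * exp (- (2 ^ k * L))))"
proof (cases "L = 0")
  case True
  \<comment> \<open>At \<open>L = 0\<close> the left-hand side is infinite, and so is the series,
    since its terms are at least 1.\<close>
  have "(\<Sum>k. ennreal (2 powr (real k * p))) = \<top>"
  proof (rule ccontr)
    assume "(\<Sum>k. ennreal (2 powr (real k * p))) \<noteq> \<top>"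
    then have "summable (\<lambda>k. 2 powr (real k * p))" by (intro summable_suminf_not_top) auto
    then have "(\<lambda>k. 2 powr (real k * p)) \<longlonglongrightarrow> 0" by (rule summable_LIMSEQ_zero)
    then have "\<forall>\<^sub>F k in sequentially. 2 powr (real k * p) < 1" by (rule order_tendstoD) simp
    then obtain k where "2 powr (real k * p) < 1" by (auto simp: eventually_sequentially)
    moreover have "2 powr (real k * p) \<ge> 1" using p by (intro ge_one_powr_ge_zero) auto
    ultimately show False by simp
  qed
  then show ?thesis using True by (simp add: ennreal_mult_top)
next
  case False
  then have L0: "L > 0" using L by simp
  show ?thesis
  proof (cases "L \<ge> 1")
    case True
    have "L powr (- p) \<le> L powr 0" using True p by (intro powr_mono) auto
    then have "ennreal_power L (- p) \<le> 1" using L0 True by (simp add: ennreal_power_def ennreal_le_1)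
    then show ?thesis by (rule order_trans) simp
  next
    case False
    define k where "k = nat \<lfloor>log 2 (1 / L)\<rfloor>"
    have lg: "log 2 (1 / L) \<ge> 0" using False L0 by simp
    have k1: "real k \<le> log 2 (1 / L)" and k2: "log 2 (1 / L) < real k + 1"
      unfolding k_def using lg by (auto simp: of_nat_nat)
    have "2 powr real k \<le> 2 powr (log 2 (1 / L))" using k1 by (intro powr_mono) auto
    then have a: "2 ^ k * L \<le> 1" using L0 by (simp add: powr_realpow field_simps)
    have "L powr (- p) = (2 powr (log 2 (1 / L))) powr p"
    proof -
      have "2 powr (log 2 (1 / L)) = 1 / L" using L0 by simp
      then show ?thesis using L0 by (simp add: powr_minus_divide powr_divide)
    qed
    also have "\<dots> \<le> (2 powr (real k + 1)) powr p"
      using k2 p by (intro powr_mono2 powr_mono) auto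
    also have "\<dots> = 2 powr p * 2 powr (real k * p)"
      by (simp add: powr_powr algebra_simps flip: powr_add)
    also have "\<dots> \<le> 2 powr p * 2 powr (real k * p) * (exp 1 * exp (- (2 ^ k * L)))"
      using a by (simp flip: exp_add)
    finally have "ennreal_power L (- p) \<le> ennreal (exp 1 * 2 powr p) * ennreal (2 powr (real k * p) * exp (- (2 ^ k * L)))"
      using L0 by (simp add: ennreal_power_def mult_ac ennreal_mult'[symmetric])
    also have "\<dots> \<le> ennreal (exp 1 * 2 powr p) * (\<Sum>k. ennreal (2 powr (real k * p) * exp (- (2 ^ k * L))))"
    proof -
      have "f k \<le> suminf f" for f :: "nat \<Rightarrow> ennreal"
        using sum_le_suminf[of f "{k}"] by simp
      from this[of "\<lambda>k. ennreal (2 powr (real k * p) * exp (- (2 ^ k * L)))"]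
      show ?thesis by (rule mult_left_mono) (rule zero_le)
    qed
    finally show ?thesis by (rule order_trans) (rule add_increasing[OF zero_le order_refl])
  qed
qed

text \<open>Series replace the integral over the Laplace parameter. Integer points lead to the
  harmonic series and settle \<open>p \<ge> 1\<close> including the boundary; dyadic points lead to
  a geometric series of ratio \<open>2 powr (p - 1)\<close> and settle
  \<open>0 < p < 1\<close>.\<close>

lemma (in prob_space) negative_moment_iff:
  fixes L :: "'a \<Rightarrow> real" and p c \<mu> C :: real
  assumes L[measurable]: "L \<in> borel_measurable M" and nonneg: "AE \<omega> in M. 0 \<le> L \<omega>"
    and upper: "\<And>s. s > 0 \<Longrightarrow> expectation (\<lambda>\<omega>. exp (- (s * L \<omega>))) \<le> C / s"
    and c: "c > 0" and lower: "\<And>s. s \<ge> 1 \<Longrightarrow> c / s \<le> expectation (\<lambda>\<omega>. exp (- (s * L \<omega>)))"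
    and \<mu>: "\<mu> > 0" and exp_moment: "(\<integral>\<^sup>+\<omega>. ennreal (exp (\<mu> * L \<omega>)) \<partial>M) < \<infinity>"
  shows "(\<integral>\<^sup>+\<omega>. ennreal_power (L \<omega>) (- p) \<partial>M) < \<infinity> \<longleftrightarrow> p < 1"
proof -
  have int: "integrable M (\<lambda>\<omega>. exp (- (s * L \<omega>)))" if "s > 0" for s
    by (rule integrable_const_bound[of _ 1]) (use nonneg that in \<open>auto elim!: eventually_mono\<close>)
  have nn: "(\<integral>\<^sup>+\<omega>. ennreal (exp (- (s * L \<omega>))) \<partial>M) = ennreal (expectation (\<lambda>\<omega>. exp (- (s * L \<omega>))))" if "s > 0" for s
    by (rule nn_integral_eq_integral[OF int[OF that]]) simp
  have meas[measurable]: "(\<lambda>\<omega>. ennreal_power (L \<omega>) a) \<in> borel_measurable M" for a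
    unfolding ennreal_power_def by measurable
  have ge1: False if p: "p \<ge> 1" and fin: "(\<integral>\<^sup>+\<omega>. ennreal_power (L \<omega>) (- p) \<partial>M) < \<infinity>"
  proof -
    \<comment> \<open>\<open>1 / L \<omega>\<close> is compared with
      \<open>1 + L \<omega> powr (- p)\<close>, the 1 covering \<open>L \<omega> \<ge> 1\<close>.
      For \<open>L \<omega> \<le> 0\<close> the right-hand side is infinite by the definition of
      \<open>ennreal_power\<close>.\<close>
    have ptw: "(\<Sum>k. ennreal (exp (- (real (Suc k) * L \<omega>)))) \<le> 1 + ennreal_power (L \<omega>) (- p)" for \<omega>
    proof (cases "L \<omega> > 0")
      case True
      have "1 / L \<omega> \<le> 1 + L \<omega> powr (- p)"
      proof (cases "L \<omega> \<ge> 1")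
        case False
        have "L \<omega> powr (-1) \<le> L \<omega> powr (- p)" using False True p by (intro powr_mono') auto
        moreover have "L \<omega> powr (-1) = 1 / L \<omega>" using True by (simp add: powr_minus_divide)
        ultimately show ?thesis by linarith
      qed (use True in \<open>auto simp: add_increasing2\<close>)
      then have "ennreal (1 / L \<omega>) \<le> 1 + ennreal_power (L \<omega>) (- p)"
        using True by (simp add: ennreal_power_def ennreal_leI flip: ennreal_1 ennreal_plus)
      with exp_geometric_le[OF True] show ?thesis by (rule order_trans)
    qed (use p in \<open>simp add: ennreal_power_def\<close>)
    have "(\<Sum>k. ennreal (c / real (Suc k))) \<le> (\<Sum>k. \<integral>\<^sup>+\<omega>. ennreal (exp (- (real (Suc k) * L \<omega>))) \<partial>M)"
      using lower by (intro suminf_le) (auto simp: nn simp del: of_nat_Suc intro!: ennreal_leI)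
    also have "\<dots> = (\<integral>\<^sup>+\<omega>. (\<Sum>k. ennreal (exp (- (real (Suc k) * L \<omega>)))) \<partial>M)"
      by (rule nn_integral_suminf[symmetric]) measurable
    also have "\<dots> \<le> (\<integral>\<^sup>+\<omega>. 1 + ennreal_power (L \<omega>) (- p) \<partial>M)"
      by (intro nn_integral_mono ptw)
    also have "\<dots> < \<infinity>" using fin by (simp add: nn_integral_add emeasure_space_1)
    finally have "summable (\<lambda>k. c / real (Suc k))"
      using c by (intro summable_suminf_not_top) auto
    then have "summable (\<lambda>k. (1 / c) * (c / real (Suc k)))" by (rule summable_mult)
    then have "summable (\<lambda>k. inverse (real (Suc k)))"
      using c by (simp add: divide_inverse del: of_nat_Suc)
    then show False using not_summable_harmonic[where ?'a = real]
      by (subst (asm) summable_Suc_iff) simp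
  qed
  have le0: "(\<integral>\<^sup>+\<omega>. ennreal_power (L \<omega>) (- p) \<partial>M) < \<infinity>" if p: "p \<le> 0"
  proof -
    define a where "a = - p"
    \<comment> \<open>The constant stems from \<open>y \<le> exp y\<close> at
      \<open>y = \<mu> * L \<omega> / a\<close>, raised to the power \<open>a\<close>.\<close>
    define K where "K = (if a = 0 then 1 else (a / \<mu>) powr a)"
    have K: "K \<ge> 0" by (simp add: K_def)
    have ptw: "ennreal_power (L \<omega>) a \<le> 1 + ennreal K * ennreal (exp (\<mu> * L \<omega>))" for \<omega>
    proof (cases "L \<omega> > 0 \<and> a \<noteq> 0")
      case True
      then have a: "a > 0" and L0: "L \<omega> > 0" using p by (auto simp: a_def)
      have "\<mu> * L \<omega> / a \<le> exp (\<mu> * L \<omega> / a)"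
        using exp_ge_add_one_self[of "\<mu> * L \<omega> / a"] by linarith
      then have "(\<mu> * L \<omega> / a) powr a \<le> exp (\<mu> * L \<omega> / a) powr a"
        using a L0 \<mu> by (intro powr_mono2) auto
      also have "\<dots> = exp (\<mu> * L \<omega>)" using a by (simp add: powr_def)
      finally have *: "(\<mu> * L \<omega> / a) powr a \<le> exp (\<mu> * L \<omega>)" .
      have "L \<omega> powr a = (a / \<mu> * (\<mu> * L \<omega> / a)) powr a" using a \<mu> by simp
      also have "\<dots> = K * (\<mu> * L \<omega> / a) powr a"
        using a \<mu> L0 unfolding K_def by (subst powr_mult) auto
      also have "\<dots> \<le> K * exp (\<mu> * L \<omega>)" using * K by (rule mult_left_mono)
      finally have "ennreal_power (L \<omega>) a \<le> ennreal K * ennreal (exp (\<mu> * L \<omega>))"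
        using L0 K by (simp add: ennreal_power_def ennreal_leI flip: ennreal_mult)
      then show ?thesis by (rule order_trans) simp
    next
      case False
      then show ?thesis using p by (auto simp: ennreal_power_def a_def add_increasing2)
    qed
    have "(\<integral>\<^sup>+\<omega>. ennreal_power (L \<omega>) (- p) \<partial>M) \<le> (\<integral>\<^sup>+\<omega>. 1 + ennreal K * ennreal (exp (\<mu> * L \<omega>)) \<partial>M)"
      unfolding a_def[symmetric] by (intro nn_integral_mono ptw)
    also have "\<dots> < \<infinity>"
      using exp_moment by (simp add: nn_integral_add nn_integral_cmult emeasure_space_1 ennreal_mult_less_top)
    finally show ?thesis .
  qed
  have mid: "(\<integral>\<^sup>+\<omega>. ennreal_power (L \<omega>) (- p) \<partial>M) < \<infinity>" if p: "0 < p" "p < 1"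
  proof -
    have "(\<integral>\<^sup>+\<omega>. ennreal_power (L \<omega>) (- p) \<partial>M)
      \<le> (\<integral>\<^sup>+\<omega>. 1 + ennreal (exp 1 * 2 powr p) * (\<Sum>k. ennreal (2 powr (real k * p) * exp (- (2 ^ k * L \<omega>)))) \<partial>M)"
      using nonneg by (intro nn_integral_mono_AE) (auto elim!: eventually_mono intro!: ennreal_power_le_dyadic p)
    also have "\<dots> = 1 + ennreal (exp 1 * 2 powr p) * (\<Sum>k. \<integral>\<^sup>+\<omega>. ennreal (2 powr (real k * p) * exp (- (2 ^ k * L \<omega>))) \<partial>M)"
      by (simp add: nn_integral_add nn_integral_cmult nn_integral_suminf emeasure_space_1)
    also have "\<dots> \<le> 1 + ennreal (exp 1 * 2 powr p) * (\<Sum>k. ennreal (C * (2 powr (p - 1)) ^ k))"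
    proof (intro add_left_mono mult_left_mono suminf_le)
      fix k
      have "(\<integral>\<^sup>+\<omega>. ennreal (2 powr (real k * p) * exp (- (2 ^ k * L \<omega>))) \<partial>M)
         = ennreal (2 powr (real k * p) * expectation (\<lambda>\<omega>. exp (- (2 ^ k * L \<omega>))))"
        by (simp add: ennreal_mult nn_integral_cmult nn)
      also have "\<dots> \<le> ennreal (2 powr (real k * p) * (C / 2 ^ k))"
        by (intro ennreal_leI mult_left_mono upper) auto
      also have "2 powr (real k * p) * (C / 2 ^ k) = C * (2 powr (p - 1)) ^ k"
        by (simp add: powr_diff power_divide powr_powr mult.commute flip: powr_realpow)
      finally show "(\<integral>\<^sup>+\<omega>. ennreal (2 powr (real k * p) * exp (- (2 ^ k * L \<omega>))) \<partial>M) \<le> ennreal (C * (2 powr (p - 1)) ^ k)" .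
    qed auto
    also have "\<dots> < \<infinity>"
    proof -
      have C: "C \<ge> 0"
      proof -
        have "0 \<le> expectation (\<lambda>\<omega>. exp (- (1 * L \<omega>)))" by simp
        also have "\<dots> \<le> C / 1" by (rule upper) simp
        finally show ?thesis by simp
      qed
      have "2 powr (p - 1) < 2 powr 0" using p by (intro powr_less_mono) auto
      then have "summable (\<lambda>k. C * (2 powr (p - 1)) ^ k)"
        by (intro summable_mult summable_geometric) auto
      then have "(\<Sum>k. ennreal (C * (2 powr (p - 1)) ^ k)) < \<top>"
        using C by (subst suminf_ennreal2) auto
      then show ?thesis by (simp add: ennreal_mult_less_top)
    qed
    finally show ?thesis .
  qed
  show ?thesis using ge1 le0 mid by (meson not_le)
qed

section \<open>Passage from the mollified to the actual collision local time\<close>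

lemma (in stable_pair) collision_local_time_AE_limit:
  assumes T: "T > 0" and L: "is_collision_local_time M X Y T L"
  obtains e :: "nat \<Rightarrow> real" where "\<And>n. e n > 0" "e \<longlonglongrightarrow> 0"
    "AE \<omega> in M. (\<lambda>n. approx_collision_local_time X Y T (e n) \<omega>) \<longlonglongrightarrow> L \<omega>"
proof -
  have [measurable]: "L \<in> borel_measurable M" using L by (simp add: is_collision_local_time_def)
  let ?A = "approx_collision_local_time X Y T"
  have inv0: "(\<lambda>n. 1 / real (Suc n)) \<longlonglongrightarrow> 0"
    using LIMSEQ_inverse_real_of_nat by (simp add: divide_inverse)
  have "filterlim (\<lambda>n. 1 / real (Suc n)) (at_right 0) sequentially"
    using inv0 by (simp add: filterlim_at)
  then have lim: "(\<lambda>n. \<integral>\<^sup>+\<omega>. ennreal ((?A (1 / real (Suc n)) \<omega> - L \<omega>)\<^sup>2) \<partial>M) \<longlonglongrightarrow> 0"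
    using L unfolding is_collision_local_time_def by (auto elim: filterlim_compose[rotated])
  then have "\<forall>\<^sub>F n in sequentially. (\<integral>\<^sup>+\<omega>. ennreal ((?A (1 / real (Suc n)) \<omega> - L \<omega>)\<^sup>2) \<partial>M) < 1"
    by (rule order_tendstoD) simp
  then obtain N where N: "\<And>n. n \<ge> N \<Longrightarrow> (\<integral>\<^sup>+\<omega>. ennreal ((?A (1 / real (Suc n)) \<omega> - L \<omega>)\<^sup>2) \<partial>M) < 1"
    by (auto simp: eventually_sequentially)
  \<comment> \<open>The shift by \<open>N\<close> keeps the squared distances integrable from the
    first term on, so that their Bochner integrals are not the default value
    \<open>0\<close>.\<close>
  define e where "e n = 1 / real (Suc (n + N))" for n
  have e: "e n > 0" for n by (simp add: e_def)
  have e0: "e \<longlonglongrightarrow> 0" unfolding e_def by (rule LIMSEQ_ignore_initial_segment[OF inv0])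
  define D where "D n \<omega> = (?A (e n) \<omega> - L \<omega>)\<^sup>2" for n \<omega>
  have [measurable]: "?A (e n) \<in> borel_measurable M" for n by (rule A_measurable[OF T e])
  have [measurable]: "D n \<in> borel_measurable M" for n unfolding D_def[abs_def] by measurable
  have D0: "D n \<omega> \<ge> 0" for n \<omega> by (simp add: D_def)
  have fin: "(\<integral>\<^sup>+\<omega>. ennreal (D n \<omega>) \<partial>M) < 1" for n
    unfolding D_def e_def by (rule N) simp
  have int: "integrable M (D n)" for n
    using fin[of n] D0 by (intro integrableI_bounded) (auto intro: less_trans)
  have lim': "(\<lambda>n. \<integral>\<^sup>+\<omega>. ennreal (D n \<omega>) \<partial>M) \<longlonglongrightarrow> 0"
    unfolding D_def e_def by (rule LIMSEQ_ignore_initial_segment[OF lim])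
  have "(\<lambda>n. ennreal (expectation (D n))) \<longlonglongrightarrow> ennreal 0"
    using lim' int D0 by (simp add: nn_integral_eq_integral)
  then have "(\<lambda>n. expectation (\<lambda>\<omega>. norm (D n \<omega>))) \<longlonglongrightarrow> 0"
    using D0 by (subst (asm) tendsto_ennreal_iff) auto
  \<comment> \<open>Almost sure convergence along one sequence serves all Laplace parameters at
    once, gives \<open>L \<ge> 0\<close> almost surely and permits Fatou's lemma for the exponential
    moment.\<close>
  from tendsto_L1_AE_subseq[OF int this] obtain r
    where r: "strict_mono r" and ae: "AE \<omega> in M. (\<lambda>n. D (r n) \<omega>) \<longlonglongrightarrow> 0" by auto
  show ?thesis
  proof (rule that[of "e \<circ> r"])
    show "(e \<circ> r) n > 0" for n by (simp add: e)
    show "(e \<circ> r) \<longlonglongrightarrow> 0" by (rule LIMSEQ_subseq_LIMSEQ[OF e0 r])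
    show "AE \<omega> in M. (\<lambda>n. ?A ((e \<circ> r) n) \<omega>) \<longlonglongrightarrow> L \<omega>"
      using ae
    proof eventually_elim
      fix \<omega> assume "(\<lambda>n. D (r n) \<omega>) \<longlonglongrightarrow> 0"
      then have "(\<lambda>n. sqrt (D (r n) \<omega>)) \<longlonglongrightarrow> sqrt 0" by (rule tendsto_real_sqrt)
      then have "(\<lambda>n. \<bar>?A (e (r n)) \<omega> - L \<omega>\<bar>) \<longlonglongrightarrow> 0" by (simp add: D_def)
      then have "(\<lambda>n. ?A (e (r n)) \<omega> - L \<omega>) \<longlonglongrightarrow> 0" by (rule tendsto_rabs_zero_cancel)
      from tendsto_add[OF this tendsto_const, of "L \<omega>"]
      show "(\<lambda>n. ?A ((e \<circ> r) n) \<omega>) \<longlonglongrightarrow> L \<omega>" by simp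
    qed
  qed
qed

text \<open>The constants \<open>q T\<close>, \<open>q (2 * T)\<close> and \<open>Q (2 * T)\<close>
  are free of \<open>\<epsilon>\<close>, so the limit along \<open>e\<close> removes
  \<open>limit_error\<close> and leaves exact bounds for the Laplace transform of
  \<open>L\<close>.\<close>

lemma (in stable_pair) collision_local_time_negative_moment_iff:
  assumes T: "T > 0" and L: "is_collision_local_time M X Y T L"
  shows "(\<integral>\<^sup>+\<omega>. ennreal_power (L \<omega>) (- p) \<partial>M) < \<infinity> \<longleftrightarrow> p < 1"
proof -
  let ?A = "approx_collision_local_time X Y T"
  obtain e where e: "\<And>n. e n > 0" and e0: "e \<longlonglongrightarrow> 0"
    and ae: "AE \<omega> in M. (\<lambda>n. ?A (e n) \<omega>) \<longlonglongrightarrow> L \<omega>"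
    using collision_local_time_AE_limit[OF T L] by blast
  have Lm[measurable]: "L \<in> borel_measurable M" using L by (simp add: is_collision_local_time_def)
  have Am[measurable]: "?A (e n) \<in> borel_measurable M" for n by (rule A_measurable[OF T e])
  have A0: "0 \<le> ?A (e n) \<omega>" for n \<omega> by (rule A_nonneg[OF T])
  have nonneg: "AE \<omega> in M. 0 \<le> L \<omega>"
    using ae by eventually_elim (auto intro!: LIMSEQ_le_const A0)
  have laplace: "(\<lambda>n. expectation (\<lambda>\<omega>. exp (- (c * ?A (e n) \<omega>)))) \<longlonglongrightarrow> expectation (\<lambda>\<omega>. exp (- (c * L \<omega>)))"
    if c: "c \<ge> 0" for c
  proof (rule integral_dominated_convergence[where w="\<lambda>_. 1"])
    show "AE \<omega> in M. (\<lambda>n. exp (- (c * ?A (e n) \<omega>))) \<longlonglongrightarrow> exp (- (c * L \<omega>))"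
      using ae by eventually_elim (intro tendsto_intros)
    show "AE \<omega> in M. norm (exp (- (c * ?A (e n) \<omega>))) \<le> 1" for n
      using c A0 by (intro AE_I2) simp
  qed auto
  have err: "(\<lambda>n. limit_error T c (e n)) \<longlonglongrightarrow> 0" for c
    by (rule limit_error_tendsto_0[OF T e0 e])
  let ?Q = "Q (2 * T)" and ?d = "q T - q (2 * T)"
  have Q: "?Q > 0" and Q1: "Q T > 0" using T by (auto intro!: Q_pos)
  have qT: "q T > 0" and d: "?d > 0" using q_pos[OF T] q_gap_pos[of T "2 * T"] T by auto
  show ?thesis
  proof (rule negative_moment_iff[OF Lm nonneg])
    fix s :: real assume s: "s > 0"
    have "s * (T * q T) * expectation (\<lambda>\<omega>. exp (- (s * L \<omega>))) \<le> 1 + 0"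
    proof (rule LIMSEQ_le)
      show "(\<lambda>n. s * (T * q T) * expectation (\<lambda>\<omega>. exp (- (s * ?A (e n) \<omega>)))) \<longlonglongrightarrow> s * (T * q T) * expectation (\<lambda>\<omega>. exp (- (s * L \<omega>)))"
        using s by (intro tendsto_intros laplace) simp
      show "(\<lambda>n. 1 + limit_error T s (e n)) \<longlonglongrightarrow> 1 + 0" by (intro tendsto_intros err)
    qed (use A_laplace_upper[OF T _ e] s in \<open>auto intro!: exI[of _ 0] simp: less_imp_le\<close>)
    then show "expectation (\<lambda>\<omega>. exp (- (s * L \<omega>))) \<le> (1 / (T * q T)) / s"
      using s T qT by (simp add: field_simps)
  next
    show "0 < ?d * T / (?Q * (1 + ?Q))" using d T Q by simp
    fix s :: real assume s: "s \<ge> 1"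
    have "s * ?d * (T * (1 - 0) / (1 + s * ?Q)) - 2 * 0 \<le> s * ?Q * expectation (\<lambda>\<omega>. exp (- (s * L \<omega>)))"
    proof (rule LIMSEQ_le)
      show "(\<lambda>n. s * ?Q * expectation (\<lambda>\<omega>. exp (- (s * ?A (e n) \<omega>)))) \<longlonglongrightarrow> s * ?Q * expectation (\<lambda>\<omega>. exp (- (s * L \<omega>)))"
        using s by (intro tendsto_intros laplace) simp
      have "1 + s * ?Q \<noteq> 0" using s Q by (simp add: add_nonneg_eq_0_iff)
      then show "(\<lambda>n. s * ?d * (T * (1 - limit_error T s (e n)) / (1 + s * ?Q)) - 2 * limit_error T s (e n))
          \<longlonglongrightarrow> s * ?d * (T * (1 - 0) / (1 + s * ?Q)) - 2 * 0" by (intro tendsto_intros err)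
      have "0 \<le> s" using s by simp
      then show "\<exists>N. \<forall>n\<ge>N. s * ?d * (T * (1 - limit_error T s (e n)) / (1 + s * ?Q)) - 2 * limit_error T s (e n)
          \<le> s * ?Q * expectation (\<lambda>\<omega>. exp (- (s * ?A (e n) \<omega>)))"
        by (intro exI[of _ 0] allI impI A_laplace_lower[OF T _ e])
    qed
    then have "s * (?d * T / (1 + s * ?Q)) \<le> s * (?Q * expectation (\<lambda>\<omega>. exp (- (s * L \<omega>))))"
      by (simp add: mult.assoc)
    then have "?d * T / (1 + s * ?Q) \<le> ?Q * expectation (\<lambda>\<omega>. exp (- (s * L \<omega>)))"
      by (rule mult_left_le_imp_le) (use s in simp)
    \<comment> \<open>As \<open>s \<ge> 1\<close>, \<open>1 + s * ?Q\<close> is at most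
      \<open>s * (1 + ?Q)\<close>; this produces the constant
      \<open>?d * T / (?Q * (1 + ?Q))\<close>.\<close>
    moreover have "?d * T / (s * (1 + ?Q)) \<le> ?d * T / (1 + s * ?Q)"
      using s d T Q by (intro divide_left_mono mult_nonneg_nonneg) (auto simp: algebra_simps intro!: mult_pos_pos add_pos_pos)
    ultimately have "?d * T / (s * (1 + ?Q)) \<le> ?Q * expectation (\<lambda>\<omega>. exp (- (s * L \<omega>)))" by linarith
    then have "?d * T / (s * (1 + ?Q)) / ?Q \<le> expectation (\<lambda>\<omega>. exp (- (s * L \<omega>)))"
      using Q by (simp only: pos_divide_le_eq mult.commute)
    then show "?d * T / (?Q * (1 + ?Q)) / s \<le> expectation (\<lambda>\<omega>. exp (- (s * L \<omega>)))"
      by (simp only: divide_divide_eq_left mult_ac)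
  next
    define \<mu> where "\<mu> = 1 / (4 * Q T)"
    show \<mu>: "0 < 1 / (4 * Q T)" using Q1 by simp
    have "(\<integral>\<^sup>+\<omega>. ennreal (exp (\<mu> * L \<omega>)) \<partial>M) = (\<integral>\<^sup>+\<omega>. liminf (\<lambda>n. ennreal (exp (\<mu> * ?A (e n) \<omega>))) \<partial>M)"
    proof (rule nn_integral_cong_AE)
      show "AE \<omega> in M. ennreal (exp (\<mu> * L \<omega>)) = liminf (\<lambda>n. ennreal (exp (\<mu> * ?A (e n) \<omega>)))"
        using ae
      proof eventually_elim
        fix \<omega> assume "(\<lambda>n. ?A (e n) \<omega>) \<longlonglongrightarrow> L \<omega>"
        then have "(\<lambda>n. ennreal (exp (\<mu> * ?A (e n) \<omega>))) \<longlonglongrightarrow> ennreal (exp (\<mu> * L \<omega>))"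
          by (intro tendsto_ennrealI tendsto_intros)
        then show "ennreal (exp (\<mu> * L \<omega>)) = liminf (\<lambda>n. ennreal (exp (\<mu> * ?A (e n) \<omega>)))"
          by (rule lim_imp_Liminf[OF trivial_limit_sequentially, symmetric])
      qed
    qed
    also have "\<dots> \<le> liminf (\<lambda>n. \<integral>\<^sup>+\<omega>. ennreal (exp (\<mu> * ?A (e n) \<omega>)) \<partial>M)"
      by (rule nn_integral_liminf) measurable
    also have "\<dots> \<le> 2"
    proof (rule Liminf_le)
      have "0 \<le> \<mu>" "4 * \<mu> * Q T \<le> 1" using Q1 by (auto simp: \<mu>_def)
      then show "\<forall>\<^sub>F n in sequentially. (\<integral>\<^sup>+\<omega>. ennreal (exp (\<mu> * ?A (e n) \<omega>)) \<partial>M) \<le> 2"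
        by (intro always_eventually allI A_exp_moment[OF T _ e])
    qed simp
    also have "\<dots> < \<infinity>" by simp
    finally show "(\<integral>\<^sup>+\<omega>. ennreal (exp (1 / (4 * Q T) * L \<omega>)) \<partial>M) < \<infinity>" unfolding \<mu>_def .
  qed
qed

theorem corollary1p1:
  fixes M :: "'a measure" and F :: "real \<Rightarrow> 'a measure"
    and X Y :: "real \<Rightarrow> 'a \<Rightarrow> real" and L :: "'a \<Rightarrow> real"
    and \<alpha>\<^sub>1 \<alpha>\<^sub>2 T p :: real
  assumes "prob_space M" and "complete_measure M" and "filtration_nonneg M F"
    and "T > 0"
    and "\<alpha>\<^sub>1 \<in> {0<..2}" and "\<alpha>\<^sub>2 \<in> {0<..2}" and "max \<alpha>\<^sub>1 \<alpha>\<^sub>2 > 1"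
    and "symmetric_stable_process M F \<alpha>\<^sub>1 X"
    and "symmetric_stable_process M F \<alpha>\<^sub>2 Y"
    and "indep_processes M X Y"
    and "is_collision_local_time M X Y T L"
  shows "(\<integral>\<^sup>+\<omega>. ennreal_power (L \<omega>) (- p) \<partial>M) < \<infinity> \<longleftrightarrow> p < 1"
proof -
  interpret prob_space M by fact
  interpret stable_pair M F X Y \<alpha>\<^sub>1 \<alpha>\<^sub>2
    by unfold_locales fact+
  show ?thesis by (rule collision_local_time_negative_moment_iff) fact+
qed

end
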